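(* Let $2\le p<\infty$. For a discrete Grothendieck Banach lattice $E$, the following are equivalent: (a) $E$ has the strong $p$-GP property. (b) $E$ has the strong GP property. (c) $E$ has the weak $p$-GP property. (d) $E$ has the $p$-GP property. (e) $E$ has the GP property.
   Context: A Banach lattice is discrete if for every $x>0$ there is an atom $a$ (an element $a>0$ such that $0\le y\le a$ implies $y=\lambda a$ for some scalar $\lambda$) with $0<a\le x$. A Grothendieck Banach lattice is a Banach lattice $E$ in which every weak* null sequence in $E^*$ is weakly null. A (norm bounded) subset $A$ of $E$ is limited (resp. almost limited) if every weak* null sequence (resp. every disjoint weak* null sequence) in $E^*$ converges uniformly to zero on $A$. $E$ has the GP property (resp. strong GP property) if every limited (resp. almost limited) set in $E$ is relatively compact. A sequence $(x_n^* )_n\subset E^*$ is weak* $p$-summable if $(x_n^*(x))_n\in\ell_p$ for every $x\in E$. A subset $A$ of $E$ is $p$-limited (resp. almost $p$-limited) if for every (resp. every pairwise disjoint) weak* $p$-summable sequence $(x_n^* )_n\subset E^*$ there is $(a_n)_n\in\ell_p$ with $|x_n^*(x)|\le a_n$ for all $x\in A$ and $n\in\mathbb{N}$. A bounded set $A\subset E$ is relatively $p$-compact if there is a norm $p$-summable sequence $(x_n)_n$ in $E$ such that $A\subseteq\{\sum_{j=1}^\infty\lambda_jx_j:(\lambda_j)_j\in B_{\ell_{p^*}}\}$, where $1/p+1/p^*=1$ and $B_{\ell_{p^*}}$ is the closed unit ball of $\ell_{p^*}$. $E$ has the $p$-GP property if every $p$-limited subset is relatively $p$-compact; the weak $p$-GP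 property if every $p$-limited subset is relatively compact; the strong $p$-GP property if every almost $p$-limited subset is relatively compact. *)

theory Defs
  imports "HOL-Analysis.Analysis" "HOL-Library.Lattice_Algebras"
begin

section \<open>Banach lattices and their duals\<close>

text \<open>Real Banach lattices; \<open>lattice_ab_group_add_abs\<close> provides \<open>\<bar>x\<bar> = sup x (- x)\<close>.\<close>

class banach_lattice = banach + ordered_real_vector + lattice_ab_group_add_abs +
  assumes norm_mono_abs: "\<bar>x\<bar> \<le> \<bar>y\<bar> \<Longrightarrow> norm x \<le> norm y"

instance real :: banach_lattice
  by standard (auto simp: sup_real_def)

type_synonym 'a dual = "'a \<Rightarrow>\<^sub>L real"

definition lattice_atom :: "'a::banach_lattice \<Rightarrow> bool" where
  "lattice_atom a \<longleftrightarrow> 0 < a \<and> (\<forall>y. 0 \<le> y \<and> y \<le> a \<longrightarrow> (\<exists>c::real. y = c *\<^sub>R a))"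

definition discrete_lattice :: "'a::banach_lattice itself \<Rightarrow> bool" where
  "discrete_lattice _ \<longleftrightarrow> (\<forall>x::'a. 0 < x \<longrightarrow> (\<exists>a. lattice_atom a \<and> a \<le> x))"

definition dual_le :: "'a::banach_lattice dual \<Rightarrow> 'a dual \<Rightarrow> bool" where
  "dual_le f g \<longleftrightarrow> (\<forall>x\<ge>0. blinfun_apply f x \<le> blinfun_apply g x)"

definition dual_is_sup :: "'a::banach_lattice dual \<Rightarrow> 'a dual \<Rightarrow> 'a dual \<Rightarrow> bool" where
  "dual_is_sup f g h \<longleftrightarrow> dual_le f h \<and> dual_le g h \<and>
     (\<forall>k. dual_le f k \<and> dual_le g k \<longrightarrow> dual_le h k)"

definition dual_is_inf :: "'a::banach_lattice dual \<Rightarrow> 'a dual \<Rightarrow> 'a dual \<Rightarrow> bool" where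
  "dual_is_inf f g h \<longleftrightarrow> dual_le h f \<and> dual_le h g \<and>
     (\<forall>k. dual_le k f \<and> dual_le k g \<longrightarrow> dual_le k h)"

text \<open>\<open>\<bar>f\<bar> \<and> \<bar>g\<bar> = 0\<close> in the dual lattice, with the lattice operations given by their
  universal properties. The moduli \<open>u = \<bar>f\<bar>\<close> and \<open>v = \<bar>g\<bar>\<close> always exist (Riesz--Kantorovich)
  and are unique (\<open>dual_is_sup_unique\<close> below), so the existential quantifier only names them.\<close>

definition dual_disjoint :: "'a::banach_lattice dual \<Rightarrow> 'a dual \<Rightarrow> bool" where
  "dual_disjoint f g \<longleftrightarrow>
     (\<exists>u v. dual_is_sup f (- f) u \<and> dual_is_sup g (- g) v \<and> dual_is_inf u v 0)"

lemma dual_le_antisym: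
  assumes "dual_le f g" "dual_le g f"
  shows "f = g"
proof (rule blinfun_eqI)
  fix x :: 'a
  have eq: "blinfun_apply f y = blinfun_apply g y" if "0 \<le> y" for y
    using assms that unfolding dual_le_def by (meson order_antisym)
  have "x = pprt x - (- nprt x)"
    using prts[of x] by simp
  moreover have "blinfun_apply f (pprt x) = blinfun_apply g (pprt x)"
    by (rule eq) simp
  moreover have "blinfun_apply f (- nprt x) = blinfun_apply g (- nprt x)"
    by (rule eq) simp
  ultimately show "blinfun_apply f x = blinfun_apply g x"
    by (metis blinfun.diff_right)
qed

lemma dual_is_sup_unique:
  "dual_is_sup f g h \<Longrightarrow> dual_is_sup f g k \<Longrightarrow> h = k"
  unfolding dual_is_sup_def by (blast intro: dual_le_antisym)

definition pairwise_disjoint_seq :: "(nat \<Rightarrow> 'a::banach_lattice dual) \<Rightarrow> bool" where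
  "pairwise_disjoint_seq f \<longleftrightarrow> (\<forall>m n. m \<noteq> n \<longrightarrow> dual_disjoint (f m) (f n))"

definition weak_star_null :: "(nat \<Rightarrow> 'a::real_normed_vector dual) \<Rightarrow> bool" where
  "weak_star_null f \<longleftrightarrow> (\<forall>x. (\<lambda>n. blinfun_apply (f n) x) \<longlonglongrightarrow> 0)"

definition weakly_null :: "(nat \<Rightarrow> 'b::real_normed_vector) \<Rightarrow> bool" where
  "weakly_null y \<longleftrightarrow> (\<forall>\<phi>::'b dual. (\<lambda>n. blinfun_apply \<phi> (y n)) \<longlonglongrightarrow> 0)"

definition grothendieck :: "'a::real_normed_vector itself \<Rightarrow> bool" where
  "grothendieck _ \<longleftrightarrow> (\<forall>f::nat \<Rightarrow> 'a dual. weak_star_null f \<longrightarrow> weakly_null f)"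

section \<open>Limited and \<open>p\<close>-limited sets\<close>

definition limited :: "'a::real_normed_vector set \<Rightarrow> bool" where
  "limited A \<longleftrightarrow> bounded A \<and>
     (\<forall>f::nat \<Rightarrow> 'a dual. weak_star_null f \<longrightarrow>
        uniform_limit A (\<lambda>n. blinfun_apply (f n)) (\<lambda>_. 0) sequentially)"

definition almost_limited :: "'a::banach_lattice set \<Rightarrow> bool" where
  "almost_limited A \<longleftrightarrow> bounded A \<and>
     (\<forall>f::nat \<Rightarrow> 'a dual. pairwise_disjoint_seq f \<and> weak_star_null f \<longrightarrow>
        uniform_limit A (\<lambda>n. blinfun_apply (f n)) (\<lambda>_. 0) sequentially)"

text \<open>Exponents are real numbers, so \<open>p < \<infinity>\<close> is implicit.\<close>

definition ell :: "real \<Rightarrow> (nat \<Rightarrow> real) set" where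
  "ell p = {a. summable (\<lambda>n. \<bar>a n\<bar> powr p)}"

definition ell_norm :: "real \<Rightarrow> (nat \<Rightarrow> real) \<Rightarrow> real" where
  "ell_norm p a = (\<Sum>n. \<bar>a n\<bar> powr p) powr (1 / p)"

definition ell_unit_ball :: "real \<Rightarrow> (nat \<Rightarrow> real) set" where
  "ell_unit_ball p = {a \<in> ell p. ell_norm p a \<le> 1}"

definition conj_exp :: "real \<Rightarrow> real" where
  "conj_exp p = p / (p - 1)"

text \<open>\<open>conj_exp\<close> is meaningful for \<open>1 < p\<close> only.\<close>

lemma conj_exp: "1 < p \<Longrightarrow> 1 / p + 1 / conj_exp p = 1"
  by (simp add: conj_exp_def field_simps)

definition weak_star_p_summable :: "real \<Rightarrow> (nat \<Rightarrow> 'a::real_normed_vector dual) \<Rightarrow> bool" where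
  "weak_star_p_summable p f \<longleftrightarrow> (\<forall>x. (\<lambda>n. blinfun_apply (f n) x) \<in> ell p)"

definition p_limited :: "real \<Rightarrow> 'a::real_normed_vector set \<Rightarrow> bool" where
  "p_limited p A \<longleftrightarrow>
     (\<forall>f::nat \<Rightarrow> 'a dual. weak_star_p_summable p f \<longrightarrow>
        (\<exists>a\<in>ell p. \<forall>x\<in>A. \<forall>n. \<bar>blinfun_apply (f n) x\<bar> \<le> a n))"

definition almost_p_limited :: "real \<Rightarrow> 'a::banach_lattice set \<Rightarrow> bool" where
  "almost_p_limited p A \<longleftrightarrow>
     (\<forall>f::nat \<Rightarrow> 'a dual. pairwise_disjoint_seq f \<and> weak_star_p_summable p f \<longrightarrow>
        (\<exists>a\<in>ell p. \<forall>x\<in>A. \<forall>n. \<bar>blinfun_apply (f n) x\<bar> \<le> a n))"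

definition relatively_compact :: "'a::real_normed_vector set \<Rightarrow> bool" where
  "relatively_compact A \<longleftrightarrow> compact (closure A)"

definition relatively_p_compact :: "real \<Rightarrow> 'a::real_normed_vector set \<Rightarrow> bool" where
  "relatively_p_compact p A \<longleftrightarrow> bounded A \<and>
     (\<exists>x::nat \<Rightarrow> 'a. (\<lambda>n. norm (x n)) \<in> ell p \<and>
        A \<subseteq> {y. \<exists>c\<in>ell_unit_ball (conj_exp p). (\<lambda>j. c j *\<^sub>R x j) sums y})"

section \<open>Gelfand--Phillips type properties\<close>

definition GP_property :: "'a::real_normed_vector itself \<Rightarrow> bool" where
  "GP_property _ \<longleftrightarrow> (\<forall>A::'a set. limited A \<longrightarrow> relatively_compact A)"

definition strong_GP_property :: "'a::banach_lattice itself \<Rightarrow> bool" where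
  "strong_GP_property _ \<longleftrightarrow> (\<forall>A::'a set. almost_limited A \<longrightarrow> relatively_compact A)"

definition p_GP_property :: "real \<Rightarrow> 'a::real_normed_vector itself \<Rightarrow> bool" where
  "p_GP_property p _ \<longleftrightarrow> (\<forall>A::'a set. p_limited p A \<longrightarrow> relatively_p_compact p A)"

definition weak_p_GP_property :: "real \<Rightarrow> 'a::real_normed_vector itself \<Rightarrow> bool" where
  "weak_p_GP_property p _ \<longleftrightarrow> (\<forall>A::'a set. p_limited p A \<longrightarrow> relatively_compact A)"

definition strong_p_GP_property :: "real \<Rightarrow> 'a::banach_lattice itself \<Rightarrow> bool" where
  "strong_p_GP_property p _ \<longleftrightarrow> (\<forall>A::'a set. almost_p_limited p A \<longrightarrow> relatively_compact A)"

end

theory Submission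
  imports Defs
begin

text \<open>
  All five properties are equivalent to order continuity of the norm, in the form that disjoint order
  bounded sequences are norm null (\<open>disjoint_null\<close>).

  Necessity. If a disjoint sequence \<open>u\<close> in an order interval is not norm null, a subsequence of it is
  bounded away from \<open>0\<close> and has no convergent subsequence. For \<open>p \<ge> 2\<close> it is \<open>p\<close>-limited: its signed
  sums are bounded and \<open>\<ell>\<^sub>p\<close> has cotype \<open>p\<close>, so an operator \<open>T\<close> into \<open>\<ell>\<^sub>p\<close> satisfies
  \<open>(\<Sum>n. norm (T (u n))\<^sup>p) < \<infinity>\<close> (lemma \<open>p_limited_disjoint_order_bounded\<close>). In a Grothendieck space
  it is also limited, because \<open>g \<mapsto> (g (u n))\<^sub>n\<close> maps the dual space to \<open>\<ell>\<^sub>1\<close>, a space with the Schur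
  property (lemma \<open>limited_disjoint_order_bounded\<close>). So the weak \<open>p\<close>-GP property and the GP property
  both force order continuity.

  Sufficiency. With an order continuous norm and enough atoms, every \<open>x\<close> is the sum of its
  coordinates along the normalized atoms. A set that is not relatively compact, but has bounded
  coordinates, is detected by functionals on disjoint finite blocks of atoms; these are disjoint in
  the dual lattice and weak* null, which settles almost limited sets. For the \<open>p\<close>-versions the
  functionals have to be scaled by weights \<open>t n\<close> so that \<open>(\<Sum>n. t n) = \<infinity>\<close> although
  \<open>(\<Sum>n. t n * norm (P\<^sub>n x)\<^sup>p)\<close> converges for all \<open>x\<close>, where \<open>P\<^sub>n\<close> is the projection onto the
  \<open>n\<close>-th block (lemma \<open>block_weights\<close>). Such weights exist because the functions
  \<open>x \<mapsto> norm (P\<^sub>n x)\<^sup>p\<close> converge to \<open>0\<close> pointwise on the compact set of all coefficient families with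
  finite sections in the unit ball, by the Grothendieck property, and hence have convex combinations
  that are uniformly small, by Simons' argument.

  The same weights show that the tails of a \<open>p\<close>-limited set have small \<open>p\<close>-summing norm. For the finite
  blocks between consecutive tails Pietsch's domination theorem, proved here by Blackwell's
  approachability argument, and a separation argument give \<open>p\<close>-convex hulls whose size does not
  depend on the dimension, and these add up to the vectors required by relative \<open>p\<close>-compactness.
  So the two strong properties and the \<open>p\<close>-GP property follow from order continuity. They imply the
  GP property and the weak \<open>p\<close>-GP property, as limited sets are almost limited, \<open>p\<close>-limited sets are
  almost \<open>p\<close>-limited and relatively \<open>p\<close>-compact sets are relatively compact.
\<close>

section \<open>Hahn--Banach extension and separation\<close>

definition sublinear :: "('b::real_vector \<Rightarrow> real) \<Rightarrow> bool" where
  "sublinear q \<longleftrightarrow> (\<forall>x y. q (x + y) \<le> q x + q y) \<and> (\<forall>c x. 0 \<le> c \<longrightarrow> q (c *\<^sub>R x) = c * q x)"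

lemma sublinear_add: "sublinear q \<Longrightarrow> q (x + y) \<le> q x + q y"
  and sublinear_scale: "sublinear q \<Longrightarrow> 0 \<le> c \<Longrightarrow> q (c *\<^sub>R x) = c * q x"
  by (auto simp: sublinear_def)

lemma sublinear_zero: "sublinear q \<Longrightarrow> q 0 = 0"
  using sublinear_scale[of q 0 0] by simp

lemma sublinear_minus: "sublinear q \<Longrightarrow> - q (- x) \<le> q x"
  using sublinear_add[of q x "- x"] sublinear_zero[of q] by simp

text \<open>Zorn's lemma for the pointwise order: the values of a chain at \<open>x\<close> stay above
  \<open>- p (- x)\<close>, so its pointwise infimum exists, and two members of a chain being comparable makes
  the infimum subadditive.\<close>

lemma minimal_sublinear_exists:
  assumes p: "sublinear p"
  shows "\<exists>q. sublinear q \<and> q \<le> p \<and> (\<forall>r. sublinear r \<and> r \<le> q \<longrightarrow> r = q)"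
proof -
  define A where "A = {q. sublinear q \<and> q \<le> p}"
  have low: "- p (- x) \<le> q x" if "q \<in> A" for q x
    using that sublinear_minus[of q x] unfolding A_def le_fun_def by (smt (verit) mem_Collect_eq)
  have "\<exists>m\<in>A. \<forall>a\<in>A. a \<le> m \<longrightarrow> a = m"
  proof (rule predicate_Zorn[where P = "\<lambda>a b. b \<le> a"])
    show "partial_order_on A (relation_of (\<lambda>a b. b \<le> a) A)"
      by (auto simp: partial_order_on_def preorder_on_def relation_of_def refl_on_def trans_def
          antisym_def)
  next
    fix C assume C: "C \<in> Chains (relation_of (\<lambda>a b. b \<le> a) A)"
    have CA: "C \<subseteq> A" and chain: "\<And>a b. a \<in> C \<Longrightarrow> b \<in> C \<Longrightarrow> a \<le> b \<or> b \<le> a"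
      using C by (auto simp: Chains_def relation_of_def)
    show "\<exists>u\<in>A. \<forall>a\<in>C. u \<le> a"
    proof (cases "C = {}")
      case True
      then show ?thesis using p by (auto simp: A_def)
    next
      case False
      define u where "u x = (INF q\<in>C. q x)" for x
      have bdd: "bdd_below ((\<lambda>q. q x) ` C)" for x
        using low CA by (intro bdd_belowI[of _ "- p (- x)"]) auto
      have ule: "u x \<le> q x" if "q \<in> C" for q x
        unfolding u_def using that bdd by (intro cINF_lower) auto
      have uge: "m \<le> u x" if "\<And>q. q \<in> C \<Longrightarrow> m \<le> q x" for m x
        unfolding u_def using that False by (intro cINF_greatest) auto
      have sub: "sublinear q" if "q \<in> C" for q using that CA by (auto simp: A_def)
      have "u (x + y) \<le> u x + u y" for x y
      proof -
        have "u (x + y) - q2 y \<le> q1 x" if "q1 \<in> C" "q2 \<in> C" for q1 q2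
          using chain[OF that]
        proof
          assume "q1 \<le> q2"
          then show ?thesis using ule[OF that(1), of "x + y"] sublinear_add[OF sub[OF that(1)], of x y]
            by (smt (verit) le_funD)
        next
          assume "q2 \<le> q1"
          then show ?thesis using ule[OF that(2), of "x + y"] sublinear_add[OF sub[OF that(2)], of x y]
            by (smt (verit) le_funD)
        qed
        then have "u (x + y) - q2 y \<le> u x" if "q2 \<in> C" for q2 using that by (intro uge) auto
        then have "u (x + y) - u x \<le> u y" by (intro uge) (simp add: algebra_simps)
        then show ?thesis by simp
      qed
      moreover have "u (c *\<^sub>R x) = c * u x" if c: "0 \<le> c" for c x
      proof (rule antisym)
        show "c * u x \<le> u (c *\<^sub>R x)"
          using c ule sub by (intro uge) (auto simp: sublinear_scale intro!: mult_left_mono)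
        show "u (c *\<^sub>R x) \<le> c * u x"
        proof (cases "c = 0")
          case True
          obtain q where q: "q \<in> C" using False by blast
          have "u 0 \<le> 0" using ule[OF q, of 0] sublinear_zero[OF sub[OF q]] by simp
          then show ?thesis using True by simp
        next
          case cn: False
          have "u (c *\<^sub>R x) / c \<le> u x"
            using c cn ule sub by (intro uge) (metis divide_right_mono nonzero_mult_div_cancel_left sublinear_scale)
          then show ?thesis using c cn by (simp add: field_simps)
        qed
      qed
      ultimately have "sublinear u" by (simp add: sublinear_def)
      moreover obtain q where "q \<in> C" using False by blast
      then have "u \<le> p" using CA ule[of q] by (auto simp: A_def le_fun_def intro: order_trans)
      ultimately show ?thesis using ule by (auto simp: A_def le_fun_def)
    qed
  qed
  then show ?thesis unfolding A_def using order_trans by blast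
qed

text \<open>Lowering \<open>q\<close> along the ray spanned by \<open>y\<close> forces \<open>r (- y) \<le> - q y\<close>. Applied to a minimal
  \<open>q\<close> it gives \<open>q (- y) = - q y\<close>, that is linearity; applied once before minimising it fixes the value
  of the functional at \<open>y\<close>.\<close>

lemma sublinear_lower_along:
  assumes q: "sublinear q"
  shows "\<exists>r. sublinear r \<and> r \<le> q \<and> r (- y) \<le> - q y"
proof -
  define r where "r x = (INF t\<in>{0..}. q (x + t *\<^sub>R y) - t * q y)" for x
  have low: "- q (- x) \<le> q (x + t *\<^sub>R y) - t * q y" if "0 \<le> t" for x t
    using sublinear_add[OF q, of "x + t *\<^sub>R y" "- x"] sublinear_scale[OF q that, of y] by simp
  have bdd: "bdd_below ((\<lambda>t. q (x + t *\<^sub>R y) - t * q y) ` {0..})" for x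
    using low by (intro bdd_belowI[of _ "- q (- x)"]) auto
  have rle: "r x \<le> q (x + t *\<^sub>R y) - t * q y" if "0 \<le> t" for x t
    unfolding r_def using that bdd by (intro cINF_lower) auto
  have rge: "m \<le> r x" if "\<And>t. 0 \<le> t \<Longrightarrow> m \<le> q (x + t *\<^sub>R y) - t * q y" for m x
    unfolding r_def using that by (intro cINF_greatest) auto
  have "r (x + z) \<le> r x + r z" for x z
  proof -
    have *: "r (x + z) - (q (z + t *\<^sub>R y) - t * q y) \<le> q (x + s *\<^sub>R y) - s * q y"
      if "0 \<le> s" "0 \<le> t" for s t
      using rle[of "s + t" "x + z"] that sublinear_add[OF q, of "x + s *\<^sub>R y" "z + t *\<^sub>R y"]
      by (simp add: algebra_simps)
    have "r (x + z) - (q (z + t *\<^sub>R y) - t * q y) \<le> r x" if "0 \<le> t" for t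
      using * that by (intro rge) auto
    then have "r (x + z) - r x \<le> r z" by (intro rge) (simp add: algebra_simps)
    then show ?thesis by simp
  qed
  moreover have "r (c *\<^sub>R x) = c * r x" if c: "0 \<le> c" for c x
  proof (cases "c = 0")
    case True
    have "r 0 \<le> 0" using rle[of 0 0] sublinear_zero[OF q] by simp
    moreover have "0 \<le> r 0" using low[of _ 0] sublinear_zero[OF q] by (intro rge) auto
    ultimately show ?thesis using True by simp
  next
    case False
    have eq: "q (c *\<^sub>R x + (c * t) *\<^sub>R y) - (c * t) * q y = c * (q (x + t *\<^sub>R y) - t * q y)" for t
      using sublinear_scale[OF q c, of "x + t *\<^sub>R y"] by (simp add: algebra_simps)
    show ?thesis
    proof (rule antisym)
      have "r (c *\<^sub>R x) / c \<le> r x"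
      proof (rule rge)
        fix t :: real assume "0 \<le> t"
        then have "r (c *\<^sub>R x) \<le> c * (q (x + t *\<^sub>R y) - t * q y)"
          using rle[of "c * t" "c *\<^sub>R x"] eq[of t] c by simp
        then show "r (c *\<^sub>R x) / c \<le> q (x + t *\<^sub>R y) - t * q y"
          using c False by (simp add: field_simps)
      qed
      then show "r (c *\<^sub>R x) \<le> c * r x" using c False by (simp add: field_simps)
      show "c * r x \<le> r (c *\<^sub>R x)"
      proof (rule rge)
        fix t :: real assume t: "0 \<le> t"
        have "c * r x \<le> c * (q (x + (t / c) *\<^sub>R y) - (t / c) * q y)"
          using rle[of "t / c" x] c t by (intro mult_left_mono) auto
        then show "c * r x \<le> q (c *\<^sub>R x + t *\<^sub>R y) - t * q y"
          using eq[of "t / c"] False by simp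
      qed
    qed
  qed
  ultimately have "sublinear r" by (simp add: sublinear_def)
  moreover have "r \<le> q" using rle[of 0] by (auto simp: le_fun_def)
  moreover have "r (- y) \<le> - q y" using rle[of 1 "- y"] sublinear_zero[OF q] by simp
  ultimately show ?thesis by blast
qed

theorem hahn_banach:
  assumes p: "sublinear p"
  shows "\<exists>f. linear f \<and> (\<forall>x. f x \<le> p x) \<and> f y = p y"
proof -
  obtain r where r: "sublinear r" "r \<le> p" "r (- y) \<le> - p y"
    using sublinear_lower_along[OF p] by blast
  obtain f where f: "sublinear f" "f \<le> r" and min: "\<And>g. sublinear g \<Longrightarrow> g \<le> f \<Longrightarrow> g = f"
    using minimal_sublinear_exists[OF r(1)] by blast
  have odd: "f (- x) = - f x" for x
  proof -
    obtain g where "sublinear g" "g \<le> f" "g (- x) \<le> - f x"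
      using sublinear_lower_along[OF f(1)] by blast
    then have "f (- x) \<le> - f x" using min by metis
    then show ?thesis using sublinear_minus[OF f(1), of x] by simp
  qed
  have add: "f (x + z) = f x + f z" for x z
    using sublinear_add[OF f(1), of x z] sublinear_add[OF f(1), of "x + z" "- z"] odd[of z] by simp
  have "f (c *\<^sub>R x) = c * f x" for c x
  proof (cases "0 \<le> c")
    case True then show ?thesis using sublinear_scale[OF f(1)] by simp
  next
    case False
    then have "f (- (c *\<^sub>R x)) = - c * f x"
      using sublinear_scale[OF f(1), of "- c" x] by simp
    then show ?thesis using odd[of "c *\<^sub>R x"] by simp
  qed
  then have "linear f" using add by (intro linearI) auto
  moreover have "f x \<le> p x" for x using f(2) r(2) by (meson le_funD order_trans)
  moreover have "p y \<le> f y" using odd[of y] f(2) r(3) le_funD[OF f(2), of "- y"] by simp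
  ultimately show ?thesis by (meson order_antisym)
qed

lemma bounded_linear_of_le_norm:
  fixes f :: "'b::real_normed_vector \<Rightarrow> real"
  assumes "linear f" "\<And>x. f x \<le> C * norm x"
  shows "bounded_linear f" "\<bar>f x\<bar> \<le> C * norm x"
proof -
  have *: "\<bar>f x\<bar> \<le> C * norm x" for x
    using assms(2)[of x] assms(2)[of "- x"] linear_neg[OF assms(1), of x] by auto
  then show "\<bar>f x\<bar> \<le> C * norm x" .
  show "bounded_linear f"
    using assms(1) * by (auto simp: linear_conv_bounded_linear[symmetric] linear_iff mult.commute
        intro!: bounded_linear_intro[of _ C])
qed

lemma norming_functional:
  fixes x :: "'b::real_normed_vector"
  obtains g :: "'b \<Rightarrow>\<^sub>L real" where "norm g \<le> 1" "blinfun_apply g x = norm x"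
proof -
  have "sublinear (norm :: 'b \<Rightarrow> real)" by (auto simp: sublinear_def norm_triangle_ineq)
  from hahn_banach[OF this, of x] obtain f :: "'b \<Rightarrow> real"
    where f: "linear f" "\<And>z. f z \<le> norm z" "f x = norm x" by blast
  note b = bounded_linear_of_le_norm[OF f(1), of 1, simplified, OF f(2)]
  show thesis
  proof
    show "norm (Blinfun f) \<le> 1"
      using b by (intro norm_blinfun_bound) (auto simp: bounded_linear_Blinfun_apply)
    show "blinfun_apply (Blinfun f) x = norm x" using b f(3) by (simp add: bounded_linear_Blinfun_apply)
  qed
qed

text \<open>Hahn--Banach for the Minkowski gauge of \<open>K\<close>, which is at least \<open>1\<close> outside \<open>K\<close>.\<close>

lemma separate_from_convex:
  fixes K :: "'b::real_normed_vector set"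
  assumes K: "convex K" and r: "0 < r" "ball 0 r \<subseteq> K" and d: "d \<notin> K"
  obtains f :: "'b \<Rightarrow>\<^sub>L real" where "\<And>x. x \<in> K \<Longrightarrow> blinfun_apply f x \<le> 1" "1 \<le> blinfun_apply f d"
proof -
  define S where "S x = {s. 0 < s \<and> (1 / s) *\<^sub>R x \<in> K}" for x
  define q where "q x = Inf (S x)" for x
  have inS: "s \<in> S x" if "norm x < r * s" "0 < s" for s x
  proof -
    have "(1 / s) *\<^sub>R x \<in> ball 0 r" using that by (simp add: field_simps)
    then show ?thesis using r that by (auto simp: S_def)
  qed
  have ne: "S x \<noteq> {}" for x
  proof -
    have "norm x < r * ((norm x + 1) / r)" "0 < (norm x + 1) / r"
      using r(1) by (auto intro!: divide_pos_pos add_nonneg_pos)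
    then show ?thesis using inS[of x] by blast
  qed
  have bdd: "bdd_below (S x)" for x by (rule bdd_belowI[of _ 0]) (auto simp: S_def)
  have qle: "q x \<le> s" if "s \<in> S x" for x s unfolding q_def using that bdd by (rule cInf_lower)
  have qge: "m \<le> q x" if "\<And>s. s \<in> S x \<Longrightarrow> m \<le> s" for x m
    unfolding q_def using that ne by (intro cInf_greatest) auto
  have "q (x + y) \<le> q x + q y" for x y
  proof -
    have S: "s + t \<in> S (x + y)" if s: "s \<in> S x" and t: "t \<in> S y" for s t
    proof -
      have pos: "0 < s" "0 < t" using s t by (auto simp: S_def)
      have "(s / (s + t)) *\<^sub>R ((1 / s) *\<^sub>R x) + (t / (s + t)) *\<^sub>R ((1 / t) *\<^sub>R y) \<in> K"
        using s t pos by (intro convexD[OF K]) (auto simp: S_def add_divide_distrib[symmetric])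
      then show ?thesis using pos by (simp add: S_def scaleR_add_right)
    qed
    have "q (x + y) - t \<le> q x" if "t \<in> S y" for t
      using qle[OF S[OF _ that]] by (intro qge) (simp add: algebra_simps)
    then have "q (x + y) - q x \<le> q y" by (intro qge) (simp add: algebra_simps)
    then show ?thesis by simp
  qed
  moreover have "q (c *\<^sub>R x) = c * q x" if c: "0 \<le> c" for c x
  proof (cases "c = 0")
    case True
    have "q 0 \<le> e" if "0 < e" for e
      using qle[OF inS[of 0 e]] that r by simp
    then have "q 0 \<le> 0" using field_le_epsilon[of "q 0" 0] by simp
    moreover have "0 \<le> q 0" by (rule qge) (auto simp: S_def)
    ultimately show ?thesis using True by simp
  next
    case False
    then have c: "0 < c" using c by simp
    have le: "q (c *\<^sub>R x) \<le> c * q x" if c: "0 < c" for c x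
    proof -
      have "c * s \<in> S (c *\<^sub>R x)" if "s \<in> S x" for s using that c by (auto simp: S_def)
      then have "q (c *\<^sub>R x) / c \<le> q x" using c qle by (intro qge) (simp add: field_simps)
      then show ?thesis using c by (simp add: field_simps)
    qed
    have "q ((1 / c) *\<^sub>R (c *\<^sub>R x)) \<le> (1 / c) * q (c *\<^sub>R x)" by (rule le) (use c in simp)
    then have "c * q x \<le> q (c *\<^sub>R x)" using c by (simp add: field_simps)
    then show ?thesis using le[OF c, of x] by simp
  qed
  ultimately have sub: "sublinear q" by (simp add: sublinear_def)
  obtain f where f: "linear f" "\<And>x. f x \<le> q x" "f d = q d" using hahn_banach[OF sub, of d] by blast
  have "q x \<le> (2 / r) * norm x" for x
  proof (cases "x = 0")
    case False
    then have "norm x < r * ((2 / r) * norm x)" "0 < (2 / r) * norm x" using r by auto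
    then show ?thesis using qle inS by blast
  qed (simp add: sublinear_zero[OF sub])
  then have "f x \<le> (2 / r) * norm x" for x using f(2) order_trans by blast
  then have b: "bounded_linear f" using bounded_linear_of_le_norm(1)[OF f(1)] by blast
  show thesis
  proof
    show "blinfun_apply (Blinfun f) x \<le> 1" if "x \<in> K" for x
      using order_trans[OF f(2)[of x] qle[of 1 x]] that b
      by (auto simp: bounded_linear_Blinfun_apply S_def)
    have "1 \<le> q d"
    proof (rule qge, rule ccontr)
      fix s assume s: "s \<in> S d" "\<not> 1 \<le> s"
      have "0 \<in> K" using r by auto
      then have "s *\<^sub>R ((1 / s) *\<^sub>R d) + (1 - s) *\<^sub>R 0 \<in> K"
        using s by (intro convexD[OF K]) (auto simp: S_def)
      then show False using s d by (simp add: S_def)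
    qed
    then show "1 \<le> blinfun_apply (Blinfun f) d" using b f(3) by (simp add: bounded_linear_Blinfun_apply)
  qed
qed

section \<open>Disjointness in Banach lattices\<close>

lemma norm_abs_eq: "norm \<bar>x\<bar> = norm (x::'a::banach_lattice)"
  by (intro antisym norm_mono_abs) (simp_all add: abs_idempotent)

lemma norm_mono_pos: "0 \<le> x \<Longrightarrow> x \<le> y \<Longrightarrow> norm x \<le> norm (y::'a::banach_lattice)"
  by (rule norm_mono_abs) (simp add: abs_of_nonneg)

lemma norm_le_of_abs_le: "\<bar>x\<bar> \<le> y \<Longrightarrow> norm x \<le> norm (y::'a::banach_lattice)"
  using norm_mono_pos[of "\<bar>x\<bar>" y] by (simp add: norm_abs_eq)

text \<open>The negative part of a limit is dominated by its distance to the positive approximants.\<close>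

lemma closed_positive_cone: "closed {x::'a::banach_lattice. 0 \<le> x}"
  unfolding closed_sequential_limits
proof (intro allI impI, elim conjE)
  fix f and x :: 'a
  assume f: "\<forall>n. f n \<in> {x. 0 \<le> x}" and lim: "f \<longlonglongrightarrow> x"
  have "\<bar>nprt x\<bar> \<le> \<bar>x - f n\<bar>" for n
  proof -
    have "- \<bar>x - f n\<bar> \<le> x - f n" using abs_ge_minus_self[of "x - f n"] by (simp add: minus_le_iff)
    also have "\<dots> \<le> x" using f by simp
    finally have "- \<bar>x - f n\<bar> \<le> nprt x" by (simp add: nprt_def)
    then have "- nprt x \<le> \<bar>x - f n\<bar>" by (simp add: minus_le_iff)
    then show ?thesis by (simp add: abs_of_nonpos)
  qed
  then have "norm (nprt x) \<le> norm (x - f n)" for n by (rule norm_mono_abs)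
  moreover have "(\<lambda>n. norm (x - f n)) \<longlonglongrightarrow> norm (x - x)" by (intro tendsto_intros lim)
  ultimately have "norm (nprt x) \<le> 0"
    by (intro LIMSEQ_le_const[of "\<lambda>n. norm (x - f n)"]) auto
  then show "x \<in> {x. 0 \<le> x}" using zero_le_iff_zero_nprt[of x] by simp
qed

lemma tendsto_le_banach_lattice:
  fixes x :: "'a::banach_lattice"
  assumes "f \<longlonglongrightarrow> x" "g \<longlonglongrightarrow> y" "\<And>n. f n \<le> g n"
  shows "x \<le> y"
proof -
  have "(\<lambda>n. g n - f n) \<longlonglongrightarrow> y - x" by (intro tendsto_intros assms)
  then have "y - x \<in> {x. 0 \<le> x}"
    by (rule closed_sequentially[OF closed_positive_cone, rotated]) (use assms(3) in simp)
  then show ?thesis by simp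
qed

definition disjoint_elems :: "'a::banach_lattice \<Rightarrow> 'a \<Rightarrow> bool" where
  "disjoint_elems x y \<longleftrightarrow> inf \<bar>x\<bar> \<bar>y\<bar> = 0"

lemma disj_sym: "disjoint_elems x y \<longleftrightarrow> disjoint_elems y x"
  by (simp add: disjoint_elems_def inf_commute)

lemma disj_zero [simp]: "disjoint_elems 0 y"
  by (simp add: disjoint_elems_def inf_absorb1)

lemma disj_minus [simp]: "disjoint_elems (- x) y \<longleftrightarrow> disjoint_elems x y"
  by (simp add: disjoint_elems_def)

lemma disj_mono: "disjoint_elems x y \<Longrightarrow> \<bar>z\<bar> \<le> \<bar>x\<bar> \<Longrightarrow> disjoint_elems z y"
  unfolding disjoint_elems_def using inf_mono[of "\<bar>z\<bar>" "\<bar>x\<bar>" "\<bar>y\<bar>" "\<bar>y\<bar>"]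
  by (intro antisym) auto

lemma inf_add_le:
  fixes a b c :: "'a::banach_lattice"
  assumes "0 \<le> a" "0 \<le> b" "0 \<le> c"
  shows "inf (a + b) c \<le> inf a c + inf b c"
proof -
  have "inf (a + b) c \<le> inf (a + b) (inf (a + c) (inf (c + b) (c + c)))"
    using assms by (auto intro: le_infI2 simp: add_increasing add_increasing2)
  also have "\<dots> = inf a c + inf b c"
    by (simp add: add_inf_distrib_left add_inf_distrib_right inf_aci)
  finally show ?thesis .
qed

lemma disj_add:
  assumes "disjoint_elems x z" "disjoint_elems y z"
  shows "disjoint_elems (x + y) z"
proof -
  have "inf \<bar>x + y\<bar> \<bar>z\<bar> \<le> inf (\<bar>x\<bar> + \<bar>y\<bar>) \<bar>z\<bar>" by (intro inf_mono abs_triangle_ineq) simp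
  also have "\<dots> \<le> inf \<bar>x\<bar> \<bar>z\<bar> + inf \<bar>y\<bar> \<bar>z\<bar>" by (rule inf_add_le) auto
  also have "\<dots> = 0" using assms by (simp add: disjoint_elems_def)
  finally show ?thesis unfolding disjoint_elems_def by (intro antisym) auto
qed

lemma disj_sum: "(\<And>i. i \<in> I \<Longrightarrow> disjoint_elems (x i) z) \<Longrightarrow> disjoint_elems (sum x I) z"
  by (induction I rule: infinite_finite_induct) (auto intro: disj_add)

lemma abs_scaleR_lattice: "\<bar>c *\<^sub>R x\<bar> = \<bar>c\<bar> *\<^sub>R \<bar>x::'a::banach_lattice\<bar>"
proof -
  have le: "\<bar>c *\<^sub>R x\<bar> \<le> \<bar>c\<bar> *\<^sub>R \<bar>x\<bar>" for c and x :: 'a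
  proof (rule abs_leI)
    have *: "d *\<^sub>R y \<le> \<bar>d\<bar> *\<^sub>R \<bar>y\<bar>" for d and y :: 'a
    proof (cases "0 \<le> d")
      case True then show ?thesis using scaleR_left_mono[OF abs_ge_self True, of y] by simp
    next
      case False
      then have "(- d) *\<^sub>R (- y) \<le> (- d) *\<^sub>R \<bar>y\<bar>"
        by (intro scaleR_left_mono) (auto simp: abs_ge_minus_self)
      then show ?thesis using False by simp
    qed
    show "c *\<^sub>R x \<le> \<bar>c\<bar> *\<^sub>R \<bar>x\<bar>" by (rule *)
    show "- (c *\<^sub>R x) \<le> \<bar>c\<bar> *\<^sub>R \<bar>x\<bar>" using *[of "- c" x] by simp
  qed
  show ?thesis
  proof (cases "c = 0")
    case False
    have "\<bar>inverse c *\<^sub>R (c *\<^sub>R x)\<bar> \<le> \<bar>inverse c\<bar> *\<^sub>R \<bar>c *\<^sub>R x\<bar>" by (rule le)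
    then have "\<bar>c\<bar> *\<^sub>R \<bar>x\<bar> \<le> \<bar>c\<bar> *\<^sub>R (\<bar>inverse c\<bar> *\<^sub>R \<bar>c *\<^sub>R x\<bar>)"
      using False by (intro scaleR_left_mono) auto
    also have "\<dots> = \<bar>c *\<^sub>R x\<bar>" using False by (simp add: abs_mult[symmetric])
    finally show ?thesis using le by (intro antisym)
  qed simp
qed

lemma disj_scaleR: 
  assumes "disjoint_elems x y" shows "disjoint_elems (c *\<^sub>R x) y"
proof -
  obtain n :: nat where n: "\<bar>c\<bar> \<le> real n" using real_arch_simple by blast
  have "disjoint_elems (real m *\<^sub>R x) y" for m
    by (induction m) (auto simp: scaleR_left_distrib assms intro!: disj_add)
  moreover have "\<bar>c *\<^sub>R x\<bar> \<le> \<bar>real n *\<^sub>R x\<bar>"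
    using n by (simp add: abs_scaleR_lattice scaleR_right_mono)
  ultimately show ?thesis using disj_mono by blast
qed

lemma disj_diff: "disjoint_elems x z \<Longrightarrow> disjoint_elems y z \<Longrightarrow> disjoint_elems (x - y) z"
  using disj_add[of x z "- y"] by simp

lemma disj_self: "disjoint_elems x x \<longleftrightarrow> x = 0"
  by (simp add: disjoint_elems_def)

text \<open>For disjoint \<open>x\<close> and \<open>y\<close> one has
  \<open>\<bar>x + y\<bar> \<ge> \<bar>\<bar>x\<bar> - \<bar>y\<bar>\<bar> = \<bar>x\<bar> + \<bar>y\<bar> - 2 (\<bar>x\<bar> \<and> \<bar>y\<bar>)\<close>.\<close>

lemma abs_add_disj:
  assumes "disjoint_elems x y"
  shows "\<bar>x + y\<bar> = \<bar>x\<bar> + \<bar>y\<bar>"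
proof (rule antisym)
  have i: "inf \<bar>x\<bar> \<bar>y\<bar> = 0" using assms by (simp add: disjoint_elems_def)
  then have s: "sup \<bar>x\<bar> \<bar>y\<bar> = \<bar>x\<bar> + \<bar>y\<bar>" using add_eq_inf_sup[of "\<bar>x\<bar>" "\<bar>y\<bar>"] by simp
  have le: "\<bar>x\<bar> - \<bar>y\<bar> \<le> \<bar>x + y\<bar>" "\<bar>y\<bar> - \<bar>x\<bar> \<le> \<bar>x + y\<bar>"
    using abs_triangle_ineq2[of x "- y"] abs_triangle_ineq2[of y "- x"]
    by (simp_all add: add.commute)
  have "\<bar>x\<bar> + \<bar>x\<bar> \<le> \<bar>x + y\<bar> + (\<bar>x\<bar> + \<bar>y\<bar>)"
    using add_right_mono[OF le(1), of "\<bar>x\<bar> + \<bar>y\<bar>"] by (simp add: algebra_simps)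
  moreover have "\<bar>y\<bar> + \<bar>y\<bar> \<le> \<bar>x + y\<bar> + (\<bar>x\<bar> + \<bar>y\<bar>)"
    using add_right_mono[OF le(2), of "\<bar>x\<bar> + \<bar>y\<bar>"] by (simp add: algebra_simps)
  ultimately have "sup (\<bar>x\<bar> + \<bar>x\<bar>) (\<bar>y\<bar> + \<bar>y\<bar>) \<le> \<bar>x + y\<bar> + (\<bar>x\<bar> + \<bar>y\<bar>)" by simp
  moreover have "sup (\<bar>x\<bar> + \<bar>x\<bar>) (\<bar>y\<bar> + \<bar>y\<bar>) = (\<bar>x\<bar> + \<bar>y\<bar>) + (\<bar>x\<bar> + \<bar>y\<bar>)"
  proof -
    have "2 *\<^sub>R sup \<bar>x\<bar> \<bar>y\<bar> \<le> sup (2 *\<^sub>R \<bar>x\<bar>) (2 *\<^sub>R \<bar>y\<bar>)"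
    proof -
      have "sup \<bar>x\<bar> \<bar>y\<bar> \<le> (1/2) *\<^sub>R sup (2 *\<^sub>R \<bar>x\<bar>) (2 *\<^sub>R \<bar>y\<bar>)"
        using scaleR_left_mono[of "2 *\<^sub>R \<bar>x\<bar>" "sup (2 *\<^sub>R \<bar>x\<bar>) (2 *\<^sub>R \<bar>y\<bar>)" "1/2"]
          scaleR_left_mono[of "2 *\<^sub>R \<bar>y\<bar>" "sup (2 *\<^sub>R \<bar>x\<bar>) (2 *\<^sub>R \<bar>y\<bar>)" "1/2"] by simp
      from scaleR_left_mono[OF this, of 2] show ?thesis by simp
    qed
    moreover have "sup (2 *\<^sub>R \<bar>x\<bar>) (2 *\<^sub>R \<bar>y\<bar>) \<le> 2 *\<^sub>R sup \<bar>x\<bar> \<bar>y\<bar>"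
      by (intro sup_least scaleR_left_mono) auto
    ultimately have "2 *\<^sub>R sup \<bar>x\<bar> \<bar>y\<bar> = sup (2 *\<^sub>R \<bar>x\<bar>) (2 *\<^sub>R \<bar>y\<bar>)" by (rule antisym)
    then show ?thesis using s by (simp add: scaleR_2)
  qed
  ultimately show "\<bar>x\<bar> + \<bar>y\<bar> \<le> \<bar>x + y\<bar>" by simp
  show "\<bar>x + y\<bar> \<le> \<bar>x\<bar> + \<bar>y\<bar>" by (rule abs_triangle_ineq)
qed

lemma abs_sum_disj:
  assumes "finite I" "\<And>i j. i \<in> I \<Longrightarrow> j \<in> I \<Longrightarrow> i \<noteq> j \<Longrightarrow> disjoint_elems (x i) (x j)"
  shows "\<bar>sum x I\<bar> = (\<Sum>i\<in>I. \<bar>x i\<bar>)"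
  using assms
proof (induction I rule: finite_induct)
  case (insert i I)
  have "disjoint_elems (sum x I) (x i)" using insert by (intro disj_sum) auto
  then show ?case using insert abs_add_disj[of "x i" "sum x I"] by (simp add: disj_sym)
qed simp

lemma disj_sum_le:
  assumes "finite I" "\<And>i j. i \<in> I \<Longrightarrow> j \<in> I \<Longrightarrow> i \<noteq> j \<Longrightarrow> disjoint_elems (x i) (x j)"
    and "\<And>i. i \<in> I \<Longrightarrow> 0 \<le> x i \<and> x i \<le> y" and "0 \<le> y"
  shows "sum x I \<le> y"
  using assms
proof (induction I rule: finite_induct)
  case (insert i I)
  have "disjoint_elems (sum x I) (x i)" using insert by (intro disj_sum) auto
  moreover have nn: "0 \<le> sum x I" "0 \<le> x i" using insert by (auto intro: sum_nonneg)
  ultimately have "inf (sum x I) (x i) = 0" by (simp add: disjoint_elems_def)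
  then have "x i + sum x I = sup (sum x I) (x i)"
    using add_eq_inf_sup[of "sum x I" "x i"] by (simp add: add.commute)
  also have "\<dots> \<le> y" using insert by (intro sup_least) auto
  finally show ?case using insert by simp
qed simp

lemma blinfun_sum_abs_le:
  fixes f :: "'a::banach_lattice dual"
  assumes "finite I" "\<And>i j. i \<in> I \<Longrightarrow> j \<in> I \<Longrightarrow> i \<noteq> j \<Longrightarrow> disjoint_elems (x i) (x j)"
  shows "(\<Sum>i\<in>I. \<bar>blinfun_apply f (x i)\<bar>) \<le> norm f * norm (sum x I)"
proof -
  define y where "y i = sgn (blinfun_apply f (x i)) *\<^sub>R x i" for i
  have dy: "disjoint_elems (y i) (y j)" if "i \<in> I" "j \<in> I" "i \<noteq> j" for i j
    unfolding y_def using assms(2)[OF that] disj_scaleR disj_sym by metis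
  have "\<bar>sum y I\<bar> = (\<Sum>i\<in>I. \<bar>y i\<bar>)" by (rule abs_sum_disj[OF assms(1) dy])
  also have "\<dots> \<le> (\<Sum>i\<in>I. \<bar>x i\<bar>)"
  proof (rule sum_mono)
    fix i
    have "\<bar>y i\<bar> = \<bar>sgn (blinfun_apply f (x i))\<bar> *\<^sub>R \<bar>x i\<bar>" by (simp add: y_def abs_scaleR_lattice)
    also have "\<dots> \<le> 1 *\<^sub>R \<bar>x i\<bar>" by (rule scaleR_right_mono) (auto simp: sgn_if)
    finally show "\<bar>y i\<bar> \<le> \<bar>x i\<bar>" by simp
  qed
  also have "\<dots> = \<bar>sum x I\<bar>" by (rule abs_sum_disj[symmetric]) (use assms in auto)
  finally have n: "norm (sum y I) \<le> norm (sum x I)" by (rule norm_mono_abs)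
  have "(\<Sum>i\<in>I. \<bar>blinfun_apply f (x i)\<bar>) = blinfun_apply f (sum y I)"
    by (simp add: y_def blinfun.sum_right blinfun.scaleR_right abs_sgn mult.commute)
  also have "\<dots> \<le> norm f * norm (sum y I)" using norm_blinfun[of f "sum y I"] by simp
  also have "\<dots> \<le> norm f * norm (sum x I)" using n by (intro mult_left_mono) auto
  finally show ?thesis .
qed

text \<open>This is order continuity of the norm in the form that is used below; for Banach lattices the
  two conditions are equivalent.\<close>

definition disjoint_null :: "'a::banach_lattice itself \<Rightarrow> bool" where
  "disjoint_null _ \<longleftrightarrow> (\<forall>(x::'a) u. (\<forall>n::nat. 0 \<le> u n \<and> u n \<le> x) \<and>
     (\<forall>m n. m \<noteq> n \<longrightarrow> disjoint_elems (u m) (u n)) \<longrightarrow> u \<longlonglongrightarrow> 0)"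

section \<open>Coordinates with respect to atoms\<close>

definition atoms :: "'a::banach_lattice set" where
  "atoms = {a. lattice_atom a \<and> norm a = 1}"

lemma atoms_pos: "a \<in> atoms \<Longrightarrow> 0 < a"
  by (simp add: atoms_def lattice_atom_def)

lemma atoms_norm: "a \<in> atoms \<Longrightarrow> norm a = 1"
  by (simp add: atoms_def)

lemma atoms_multiple: "a \<in> atoms \<Longrightarrow> 0 \<le> y \<Longrightarrow> y \<le> a \<Longrightarrow> \<exists>c. y = c *\<^sub>R a"
  by (simp add: atoms_def lattice_atom_def)

lemma scaleR_pos_iff: "0 < (a::'a::banach_lattice) \<Longrightarrow> 0 \<le> c *\<^sub>R a \<longleftrightarrow> 0 \<le> c"
  by (metis less_le_not_le linear scaleR_nonneg_nonneg neg_le_0_iff_le order_antisym scaleR_minus_left scaleR_eq_0_iff)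

lemma disj_atoms:
  assumes "a \<in> atoms" "b \<in> atoms" "a \<noteq> b"
  shows "disjoint_elems a b"
proof (rule ccontr)
  assume nd: "\<not> disjoint_elems a b"
  have ab: "\<bar>a\<bar> = a" "\<bar>b\<bar> = b" using assms atoms_pos by (auto intro!: abs_of_nonneg less_imp_le)
  have i0: "0 \<le> inf a b" using assms atoms_pos by (auto intro: less_imp_le)
  obtain c where c: "inf a b = c *\<^sub>R a" using atoms_multiple[OF assms(1) i0] by auto
  obtain d where d: "inf a b = d *\<^sub>R b" using atoms_multiple[OF assms(2) i0] by auto
  have ne: "inf a b \<noteq> 0" using nd ab by (simp add: disjoint_elems_def)
  have cd: "0 < c" "0 < d"
    using c d i0 ne scaleR_pos_iff[OF atoms_pos[OF assms(1)], of c]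
      scaleR_pos_iff[OF atoms_pos[OF assms(2)], of d] by (auto simp: less_le)
  have "norm (c *\<^sub>R a) = norm (d *\<^sub>R b)" using c d by simp
  then have "c = d" using cd assms by (simp add: atoms_norm)
  then have "a = b" using c d cd by (metis less_irrefl scaleR_left_imp_eq)
  then show False using assms by simp
qed

text \<open>The largest multiple of \<open>a\<close> below \<open>x\<close> leaves a remainder disjoint from \<open>a\<close>: the meet of the
  remainder and \<open>a\<close> is again a multiple of \<open>a\<close>, and it could be added.\<close>

lemma atom_decomposition_pos:
  assumes a: "a \<in> atoms" and x: "0 \<le> x"
  shows "\<exists>t\<ge>0. t *\<^sub>R a \<le> x \<and> disjoint_elems (x - t *\<^sub>R a) a"
proof -
  have a0: "0 < a" "\<bar>a\<bar> = a" using atoms_pos[OF a] by (auto intro: abs_of_nonneg less_imp_le)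
  define S where "S = {t. 0 \<le> t \<and> t *\<^sub>R a \<le> x}"
  have S0: "0 \<in> S" using x by (simp add: S_def)
  have "t \<le> norm x" if "t \<in> S" for t
    using that norm_mono_pos[of "t *\<^sub>R a" x] a0(1) atoms_norm[OF a]
    by (auto simp: S_def scaleR_nonneg_nonneg less_imp_le)
  then have bdd: "bdd_above S" by (rule bdd_aboveI)
  have "closed S"
  proof -
    have "S = {0..} \<inter> ((\<lambda>t. x - t *\<^sub>R a) -` {z. 0 \<le> z})" by (auto simp: S_def)
    moreover have "closed ((\<lambda>t. x - t *\<^sub>R a) -` {z. 0 \<le> z})"
      by (intro closed_vimage closed_positive_cone continuous_intros)
    ultimately show ?thesis by auto
  qed
  then have "Sup S \<in> S" using closed_contains_Sup[of S] S0 bdd by blast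
  define t where "t = Sup S"
  have t: "0 \<le> t" "t *\<^sub>R a \<le> x" using \<open>Sup S \<in> S\<close> by (auto simp: S_def t_def)
  have r: "0 \<le> x - t *\<^sub>R a" using t by simp
  obtain s where s: "inf (x - t *\<^sub>R a) a = s *\<^sub>R a"
    using atoms_multiple[OF a, of "inf (x - t *\<^sub>R a) a"] r less_imp_le[OF a0(1)] by auto
  have "0 \<le> s *\<^sub>R a" using s r a0 by (metis le_inf_iff less_imp_le)
  then have s0: "0 \<le> s" using scaleR_pos_iff[OF a0(1)] by simp
  have "s *\<^sub>R a \<le> x - t *\<^sub>R a" using s by (metis inf_le1)
  then have "t + s \<in> S" using s0 t by (simp add: S_def algebra_simps)
  then have "t + s \<le> t" unfolding t_def using bdd by (intro cSup_upper)
  then have "s = 0" using s0 by simp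
  then have "disjoint_elems (x - t *\<^sub>R a) a" using s r a0 by (simp add: disjoint_elems_def)
  then show ?thesis using t by blast
qed

lemma atom_decomposition:
  assumes a: "a \<in> atoms"
  shows "\<exists>!t. disjoint_elems (x - t *\<^sub>R a) a"
proof (rule ex_ex1I)
  obtain s where s: "disjoint_elems (pprt x - s *\<^sub>R a) a"
    using atom_decomposition_pos[OF a, of "pprt x"] by auto
  obtain t where t: "disjoint_elems (- nprt x - t *\<^sub>R a) a"
    using atom_decomposition_pos[OF a, of "- nprt x"] by auto
  have "x - (s - t) *\<^sub>R a = (pprt x - s *\<^sub>R a) - (- nprt x - t *\<^sub>R a)"
    by (subst prts[of x]) (simp add: algebra_simps)
  then show "\<exists>t. disjoint_elems (x - t *\<^sub>R a) a" using disj_diff[OF s t] by metis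
next
  fix s t assume "disjoint_elems (x - s *\<^sub>R a) a" "disjoint_elems (x - t *\<^sub>R a) a"
  from disj_diff[OF this] have d: "disjoint_elems ((t - s) *\<^sub>R a) a" by (simp add: algebra_simps)
  then have "disjoint_elems ((t - s) *\<^sub>R a) ((t - s) *\<^sub>R a)" using disj_scaleR disj_sym by metis
  then show "s = t" using atoms_pos[OF a] by (auto simp: disj_self)
qed

definition coord :: "'a::banach_lattice \<Rightarrow> 'a \<Rightarrow> real" where
  "coord a x = (THE t. disjoint_elems (x - t *\<^sub>R a) a)"

lemma coord_disj: "a \<in> atoms \<Longrightarrow> disjoint_elems (x - coord a x *\<^sub>R a) a"
  unfolding coord_def by (rule theI'[OF atom_decomposition])

lemma coord_eqI: "a \<in> atoms \<Longrightarrow> disjoint_elems (x - t *\<^sub>R a) a \<Longrightarrow> coord a x = t"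
  using atom_decomposition coord_disj by blast

lemma coord_add: "a \<in> atoms \<Longrightarrow> coord a (x + y) = coord a x + coord a y"
  using disj_add[OF coord_disj[of a x] coord_disj[of a y]]
  by (intro coord_eqI) (auto simp: algebra_simps)

lemma coord_scaleR: "a \<in> atoms \<Longrightarrow> coord a (c *\<^sub>R x) = c * coord a x"
  using disj_scaleR[OF coord_disj[of a x], of c]
  by (intro coord_eqI) (auto simp: algebra_simps)

lemma linear_coord: "a \<in> atoms \<Longrightarrow> linear (coord a)"
  by (intro linearI) (auto simp: coord_add coord_scaleR)

lemma coord_nonneg: "a \<in> atoms \<Longrightarrow> 0 \<le> x \<Longrightarrow> 0 \<le> coord a x"
  using atom_decomposition_pos coord_eqI by metis

lemma coord_eq_0: "a \<in> atoms \<Longrightarrow> disjoint_elems x a \<Longrightarrow> coord a x = 0"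
  by (rule coord_eqI) auto

lemma coord_atom: "a \<in> atoms \<Longrightarrow> b \<in> atoms \<Longrightarrow> coord a b = (if a = b then 1 else 0)"
  using coord_eqI[of a a 1] coord_eq_0[of a b] disj_atoms[of b a] by auto

lemma coord_mono: "a \<in> atoms \<Longrightarrow> x \<le> y \<Longrightarrow> coord a x \<le> coord a y"
  using coord_nonneg[of a "y - x"] linear_diff[OF linear_coord, of a y x] by simp

definition proj :: "'a::banach_lattice set \<Rightarrow> 'a \<Rightarrow> 'a" where
  "proj F x = (\<Sum>a\<in>F. coord a x *\<^sub>R a)"

lemma linear_proj: "F \<subseteq> atoms \<Longrightarrow> linear (proj F)"
  unfolding proj_def
  by (intro linearI) (auto simp: coord_add coord_scaleR sum.distrib scaleR_left_distrib
      scaleR_sum_right subset_iff intro!: sum.cong simp flip: sum.distrib)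

lemma disj_coords: "a \<in> atoms \<Longrightarrow> b \<in> atoms \<Longrightarrow> a \<noteq> b \<Longrightarrow> disjoint_elems (s *\<^sub>R a) (t *\<^sub>R b)"
  using disj_scaleR disj_sym disj_atoms by metis

lemma disj_sum_atoms:
  assumes "F \<subseteq> atoms" "G \<subseteq> atoms" "F \<inter> G = {}"
  shows "disjoint_elems (\<Sum>a\<in>F. z a *\<^sub>R a) (\<Sum>a\<in>G. w a *\<^sub>R a)"
proof (rule disj_sum)
  fix a assume a: "a \<in> F"
  have "disjoint_elems (\<Sum>a\<in>G. w a *\<^sub>R a) (z a *\<^sub>R a)"
    using a assms by (intro disj_sum disj_coords) auto
  then show "disjoint_elems (z a *\<^sub>R a) (\<Sum>a\<in>G. w a *\<^sub>R a)" by (simp add: disj_sym)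
qed

lemma coord_sum_atoms:
  assumes "finite F" "F \<subseteq> atoms" "b \<in> atoms"
  shows "coord b (\<Sum>a\<in>F. z a *\<^sub>R a) = (if b \<in> F then z b else 0)"
proof -
  have "coord b (\<Sum>a\<in>F. z a *\<^sub>R a) = (\<Sum>a\<in>F. if a = b then z a else 0)"
    unfolding linear_sum[OF linear_coord[OF assms(3)]]
    using assms by (intro sum.cong) (auto simp: coord_scaleR coord_atom)
  then show ?thesis using assms(1) by simp
qed

lemma coord_proj:
  assumes "finite F" "F \<subseteq> atoms" "b \<in> atoms"
  shows "coord b (proj F x) = (if b \<in> F then coord b x else 0)"
  unfolding proj_def by (rule coord_sum_atoms[OF assms])

lemma proj_sum_atoms:
  assumes "finite F" "F \<subseteq> atoms" "finite G" "G \<subseteq> atoms"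
  shows "proj G (\<Sum>a\<in>F. z a *\<^sub>R a) = (\<Sum>a\<in>F \<inter> G. z a *\<^sub>R a)"
proof -
  have "proj G (\<Sum>a\<in>F. z a *\<^sub>R a) = (\<Sum>a\<in>G. if a \<in> F then z a *\<^sub>R a else 0)"
    unfolding proj_def using assms by (intro sum.cong) (auto simp: coord_sum_atoms subset_iff)
  also have "\<dots> = (\<Sum>a\<in>F \<inter> G. z a *\<^sub>R a)"
    using sum.inter_restrict[OF assms(3), of "\<lambda>a. z a *\<^sub>R a" F] by (simp add: Int_commute)
  finally show ?thesis .
qed

lemma proj_proj:
  assumes "finite F" "F \<subseteq> atoms" "finite G" "G \<subseteq> atoms"
  shows "proj G (proj F x) = proj (F \<inter> G) x"
  using proj_sum_atoms[OF assms] by (simp add: proj_def)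

lemma proj_diff_subset:
  assumes "finite G" "F \<subseteq> G"
  shows "proj G x - proj F x = proj (G - F) x"
  unfolding proj_def using assms by (simp add: sum_diff)

lemma disj_remainder:
  assumes "finite F" "F \<subseteq> atoms"
  shows "disjoint_elems (x - proj F x) (proj F y)"
proof -
  have "disjoint_elems (x - proj F x) a" if "a \<in> F" for a
  proof -
    have aa: "a \<in> atoms" using that assms by auto
    have "coord a (x - proj F x) = 0"
      using coord_proj[OF assms aa] that linear_diff[OF linear_coord[OF aa]] by simp
    then show ?thesis using coord_disj[OF aa, of "x - proj F x"] by simp
  qed
  then have "disjoint_elems (proj F y) (x - proj F x)"
    unfolding proj_def[of F y] by (intro disj_sum disj_scaleR) (simp add: disj_sym)
  then show ?thesis by (simp add: disj_sym)
qed

lemma abs_split_proj: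
  assumes "finite F" "F \<subseteq> atoms"
  shows "\<bar>x\<bar> = \<bar>x - proj F x\<bar> + \<bar>proj F x\<bar>"
  using abs_add_disj[OF disj_remainder[OF assms, of x x]] by simp

lemma norm_proj_le:
  assumes "finite F" "F \<subseteq> atoms"
  shows "norm (proj F x) \<le> norm x"
  using abs_split_proj[OF assms, of x] by (intro norm_mono_abs) simp

lemma norm_remainder_le:
  assumes "finite F" "F \<subseteq> atoms"
  shows "norm (x - proj F x) \<le> norm x"
  using abs_split_proj[OF assms, of x] by (intro norm_mono_abs) simp

lemma norm_remainder_antimono:
  assumes "finite G" "G \<subseteq> atoms" "F \<subseteq> G"
  shows "norm (x - proj G x) \<le> norm (x - proj F x)"
proof -
  have F: "finite F" "F \<subseteq> atoms" using assms finite_subset by auto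
  have "F \<inter> G = F" using assms(3) by blast
  then have "x - proj G x = (x - proj F x) - proj G (x - proj F x)"
    using linear_diff[OF linear_proj[OF assms(2)]] proj_proj[OF F assms(1,2), of x] by simp
  then show ?thesis using norm_remainder_le[OF assms(1,2)] by metis
qed

lemma proj_nonneg: "F \<subseteq> atoms \<Longrightarrow> 0 \<le> x \<Longrightarrow> 0 \<le> proj F x"
  unfolding proj_def
  by (intro sum_nonneg scaleR_nonneg_nonneg coord_nonneg) (auto intro: less_imp_le atoms_pos)

lemma proj_le: "finite F \<Longrightarrow> F \<subseteq> atoms \<Longrightarrow> 0 \<le> x \<Longrightarrow> proj F x \<le> x"
  using abs_split_proj[of F x] abs_of_nonneg[OF proj_nonneg, of F x] abs_of_nonneg[of x]
    abs_ge_zero[of "x - proj F x"] by (metis le_add_same_cancel2)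

lemma abs_coord_le_norm:
  assumes "a \<in> atoms"
  shows "\<bar>coord a x\<bar> \<le> norm x"
  using norm_proj_le[of "{a}" x] assms by (simp add: proj_def atoms_norm)

lemma bounded_linear_proj: "finite F \<Longrightarrow> F \<subseteq> atoms \<Longrightarrow> bounded_linear (proj F)"
  using linear_proj[of F] norm_proj_le[of F]
  by (intro bounded_linear_intro[of _ 1]) (auto simp: linear_add linear_scale)

section \<open>Expansion along the atoms\<close>

lemma proj_pos_null:
  fixes x :: "'a::banach_lattice"
  assumes oc: "disjoint_null TYPE('a)" and x: "0 \<le> x"
    and G: "\<And>n. finite (G n)" "\<And>n. G n \<subseteq> atoms" "\<And>m n. m \<noteq> n \<Longrightarrow> G m \<inter> G n = {}"
  shows "(\<lambda>n::nat. proj (G n) x) \<longlonglongrightarrow> 0"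
proof -
  have "0 \<le> proj (G n) x \<and> proj (G n) x \<le> x" for n
    using proj_nonneg[OF G(2) x] proj_le[OF G(1,2) x] by simp
  moreover have "disjoint_elems (proj (G m) x) (proj (G n) x)" if "m \<noteq> n" for m n
    unfolding proj_def by (intro disj_sum_atoms G that)
  ultimately show ?thesis
    using oc[unfolded disjoint_null_def, rule_format, of "\<lambda>n. proj (G n) x" x] by simp
qed

lemma proj_null:
  fixes x :: "'a::banach_lattice"
  assumes oc: "disjoint_null TYPE('a)"
    and G: "\<And>n. finite (G n)" "\<And>n. G n \<subseteq> atoms" "\<And>m n. m \<noteq> n \<Longrightarrow> G m \<inter> G n = {}"
  shows "(\<lambda>n::nat. proj (G n) x) \<longlonglongrightarrow> 0"
proof -
  have "(\<lambda>n. proj (G n) (pprt x) - proj (G n) (- nprt x)) \<longlonglongrightarrow> 0 - 0"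
    by (intro tendsto_diff proj_pos_null oc G) auto
  moreover have "proj (G n) (pprt x) - proj (G n) (- nprt x) = proj (G n) x" for n
    using linear_diff[OF linear_proj[OF G(2)], of n "pprt x" "- nprt x"] prts[of x] by simp
  ultimately show ?thesis by simp
qed

lemma disjoint_sequence_choice:
  assumes "\<And>F. finite F \<Longrightarrow> F \<subseteq> A \<Longrightarrow> \<exists>G y. finite G \<and> G \<subseteq> A \<and> G \<inter> F = {} \<and> Q G y"
  obtains G :: "nat \<Rightarrow> 'a set" and y where "\<And>n. finite (G n)" "\<And>n. G n \<subseteq> A" "\<And>n. Q (G n) (y n)"
    "\<And>m n. m \<noteq> n \<Longrightarrow> G m \<inter> G n = {}"
proof -
  obtain g h where gh: "\<And>F. finite F \<Longrightarrow> F \<subseteq> A \<Longrightarrow>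
      finite (g F) \<and> g F \<subseteq> A \<and> g F \<inter> F = {} \<and> Q (g F) (h F)"
    using assms by metis
  define U where "U = rec_nat {} (\<lambda>_ F. F \<union> g F)"
  have U: "U 0 = {}" "\<And>n. U (Suc n) = U n \<union> g (U n)" by (auto simp: U_def)
  have fin: "finite (U n) \<and> U n \<subseteq> A" for n by (induction n) (auto simp: U gh)
  have mono: "U m \<subseteq> U n" if "m \<le> n" for m n
    using that by (rule lift_Suc_mono_le[of U, rotated]) (auto simp: U)
  have lt: "g (U m) \<inter> g (U n) = {}" if "m < n" for m n
    using gh[of "U n"] fin[of n] mono[of "Suc m" n] that U(2)[of m] by fastforce
  show thesis
  proof
    show "finite (g (U n))" "g (U n) \<subseteq> A" "Q (g (U n)) (h (U n))" for n using gh fin by auto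
    show "g (U m) \<inter> g (U n) = {}" if "m \<noteq> n" for m n
      using lt[of m n] lt[of n m] that by (cases "m < n") auto
  qed
qed

lemma normalized_atom:
  assumes "lattice_atom (a::'a::banach_lattice)"
  shows "(1 / norm a) *\<^sub>R a \<in> atoms"
proof -
  define s where "s = 1 / norm a"
  have a: "0 < a" "a \<noteq> 0" using assms by (auto simp: lattice_atom_def)
  then have s: "0 < s" by (simp add: s_def)
  have "\<exists>c. y = c *\<^sub>R (s *\<^sub>R a)" if y: "0 \<le> y" "y \<le> s *\<^sub>R a" for y
  proof -
    have "(1 / s) *\<^sub>R y \<le> (1 / s) *\<^sub>R (s *\<^sub>R a)" using y s by (intro scaleR_left_mono) auto
    then have "(1 / s) *\<^sub>R y \<le> a" using s by simp
    moreover have "0 \<le> (1 / s) *\<^sub>R y" using y s by (intro scaleR_nonneg_nonneg) auto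
    ultimately obtain c where "(1 / s) *\<^sub>R y = c *\<^sub>R a" using assms by (auto simp: lattice_atom_def)
    then have "s *\<^sub>R ((1 / s) *\<^sub>R y) = c *\<^sub>R (s *\<^sub>R a)" by simp
    then show ?thesis using s by auto
  qed
  moreover have "0 < s *\<^sub>R a" using a s scaleR_nonneg_nonneg[of s a] by (simp add: less_le)
  moreover have "norm (s *\<^sub>R a) = 1" using a by (simp add: s_def)
  ultimately show ?thesis by (simp add: atoms_def lattice_atom_def s_def)
qed

lemma coord_bounded_linear: "a \<in> atoms \<Longrightarrow> bounded_linear (coord a)"
  using abs_coord_le_norm[of a]
  by (intro bounded_linear_intro[of _ 1]) (auto simp: coord_add coord_scaleR)

text \<open>Order continuity makes the finite partial sums Cauchy. The limit has the coordinates of \<open>x\<close>,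
  and a positive element without nonzero coordinates vanishes because no atom lies below it.\<close>

lemma atomic_expansion_pos:
  fixes x :: "'a::banach_lattice"
  assumes oc: "disjoint_null TYPE('a)" and disc: "discrete_lattice TYPE('a)"
    and x: "0 \<le> x" and e: "0 < e"
  shows "\<exists>F. finite F \<and> F \<subseteq> atoms \<and> norm (x - proj F x) < e"
proof -
  have tail: "\<exists>F. finite F \<and> F \<subseteq> atoms \<and>
      (\<forall>G. finite G \<and> G \<subseteq> atoms \<and> G \<inter> F = {} \<longrightarrow> norm (proj G x) < d)" if d: "0 < d" for d
  proof (rule ccontr)
    assume neg: "\<not> ?thesis"
    have "\<exists>G y::unit. finite G \<and> G \<subseteq> atoms \<and> G \<inter> F = {} \<and> d \<le> norm (proj G x)"
      if "finite F" "F \<subseteq> atoms" for F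
      using neg that by (auto simp: not_less)
    then obtain G where G: "\<And>n::nat. finite (G n)" "\<And>n. G n \<subseteq> atoms" "\<And>n. d \<le> norm (proj (G n) x)"
        "\<And>m n. m \<noteq> n \<Longrightarrow> G m \<inter> G n = {}"
      using disjoint_sequence_choice[of atoms "\<lambda>G y. d \<le> norm (proj G x)"] by metis
    have "(\<lambda>n. norm (proj (G n) x)) \<longlonglongrightarrow> 0"
      using proj_null[OF oc G(1,2,4)] by (simp add: tendsto_norm_zero_iff)
    then have "d \<le> 0" using G(3) by (intro LIMSEQ_le_const) auto
    then show False using d by simp
  qed
  define \<epsilon> where "\<epsilon> n = inverse (real (Suc n))" for n
  have \<epsilon>: "0 < \<epsilon> n" "\<epsilon> \<longlonglongrightarrow> 0" for n
    unfolding \<epsilon>_def using LIMSEQ_inverse_real_of_nat by auto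
  obtain F where F: "\<And>n. finite (F n) \<and> F n \<subseteq> atoms \<and>
      (\<forall>G. finite G \<and> G \<subseteq> atoms \<and> G \<inter> F n = {} \<longrightarrow> norm (proj G x) < \<epsilon> n)"
    using tail[OF \<epsilon>(1)] by metis
  define H where "H n = (\<Union>k\<le>n. F k)" for n
  have H: "finite (H n)" "H n \<subseteq> atoms" "F n \<subseteq> H n" for n using F by (auto simp: H_def)
  have Hmono: "H m \<subseteq> H n" if "m \<le> n" for m n using that by (fastforce simp: H_def)
  have step: "norm (proj (H m) x - proj (H n) x) < \<epsilon> n" if "n \<le> m" for m n
  proof -
    have "finite (H m - H n) \<and> H m - H n \<subseteq> atoms \<and> (H m - H n) \<inter> F n = {}" using H by blast
    then have "norm (proj (H m - H n) x) < \<epsilon> n" using F by blast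
    then show ?thesis by (simp add: proj_diff_subset[OF H(1) Hmono[OF that]])
  qed
  have "Cauchy (\<lambda>n. proj (H n) x)"
  proof (rule metric_CauchyI)
    fix d :: real assume "0 < d"
    then have "\<forall>\<^sub>F n in sequentially. \<epsilon> n < d / 2" using \<epsilon>(2) by (intro order_tendstoD) auto
    then obtain N where N: "\<epsilon> N < d / 2" by (auto simp: eventually_sequentially)
    have "dist (proj (H m) x) (proj (H n) x) < d" if "N \<le> m" "N \<le> n" for m n
      using step[OF that(1)] step[OF that(2)] N
        dist_triangle2[of "proj (H m) x" "proj (H n) x" "proj (H N) x"] by (simp add: dist_norm)
    then show "\<exists>M. \<forall>m\<ge>M. \<forall>n\<ge>M. dist (proj (H m) x) (proj (H n) x) < d" by blast
  qed
  then obtain y where y: "(\<lambda>n. proj (H n) x) \<longlonglongrightarrow> y" using Cauchy_convergent convergent_def by blast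
  have yx: "y \<le> x"
    by (rule tendsto_le_banach_lattice[OF y tendsto_const]) (intro proj_le H x)
  have coord_eq: "coord b y = coord b x" if b: "b \<in> atoms" for b
  proof -
    have "\<bar>coord b x - coord b (proj (H n) x)\<bar> \<le> \<epsilon> n" for n
    proof (cases "b \<in> H n")
      case True
      then show ?thesis using coord_proj[OF H(1,2) b, of n] \<epsilon>(1)[of n] by simp
    next
      case False
      then have "norm (proj {b} x) < \<epsilon> n" using F[of n] H(3)[of n] b by auto
      then show ?thesis
        using False coord_proj[OF H(1,2) b, of n] atoms_norm[OF b] by (simp add: proj_def)
    qed
    then have "(\<lambda>n. coord b x - coord b (proj (H n) x)) \<longlonglongrightarrow> 0"
      by (intro Lim_null_comparison[OF always_eventually \<epsilon>(2)]) simp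
    moreover have "(\<lambda>n. coord b x - coord b (proj (H n) x)) \<longlonglongrightarrow> coord b x - coord b y"
      by (intro tendsto_intros bounded_linear.tendsto[OF coord_bounded_linear[OF b]] y)
    ultimately show ?thesis using LIMSEQ_unique by fastforce
  qed
  have "x = y"
  proof (rule ccontr)
    assume "x \<noteq> y"
    then have "0 < x - y" using yx by simp
    then obtain a where a: "lattice_atom a" "a \<le> x - y" using disc unfolding discrete_lattice_def by blast
    define b where "b = (1 / norm a) *\<^sub>R a"
    have b: "b \<in> atoms" using normalized_atom[OF a(1)] by (simp add: b_def)
    have na: "0 < norm a" using a(1) by (auto simp: lattice_atom_def)
    have ab: "a = norm a *\<^sub>R b" using na by (simp add: b_def)
    have "norm a = coord b a" by (subst (2) ab) (simp add: coord_scaleR coord_atom b)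
    also have "\<dots> \<le> coord b (x - y)" by (rule coord_mono[OF b a(2)])
    also have "\<dots> = 0" using coord_eq[OF b] linear_diff[OF linear_coord[OF b]] by simp
    finally show False using na by simp
  qed
  then have "(\<lambda>n. norm (x - proj (H n) x)) \<longlonglongrightarrow> norm (x - x)" using y by (intro tendsto_intros) auto
  then have "\<forall>\<^sub>F n in sequentially. norm (x - proj (H n) x) < e" using e by (intro order_tendstoD) auto
  then obtain N where "norm (x - proj (H N) x) < e" by (auto simp: eventually_sequentially)
  then show ?thesis using H by blast
qed

lemma atomic_expansion:
  fixes x :: "'a::banach_lattice"
  assumes oc: "disjoint_null TYPE('a)" and disc: "discrete_lattice TYPE('a)" and e: "0 < e"
  shows "\<exists>F. finite F \<and> F \<subseteq> atoms \<and> norm (x - proj F x) < e"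
proof -
  obtain F where F: "finite F" "F \<subseteq> atoms" "norm (pprt x - proj F (pprt x)) < e / 2"
    using atomic_expansion_pos[OF oc disc, of "pprt x" "e / 2"] e by auto
  obtain G where G: "finite G" "G \<subseteq> atoms" "norm (- nprt x - proj G (- nprt x)) < e / 2"
    using atomic_expansion_pos[OF oc disc, of "- nprt x" "e / 2"] e by auto
  have FG: "finite (F \<union> G)" "F \<union> G \<subseteq> atoms" using F G by auto
  have "proj (F \<union> G) x = proj (F \<union> G) (pprt x) - proj (F \<union> G) (- nprt x)"
    using linear_diff[OF linear_proj[OF FG(2)], of "pprt x" "- nprt x"] prts[of x] by simp
  then have "x - proj (F \<union> G) x
      = (pprt x - proj (F \<union> G) (pprt x)) - (- nprt x - proj (F \<union> G) (- nprt x))"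
    using prts[of x] by (simp add: algebra_simps)
  then have "norm (x - proj (F \<union> G) x)
      \<le> norm (pprt x - proj (F \<union> G) (pprt x)) + norm (- nprt x - proj (F \<union> G) (- nprt x))"
    by (metis norm_triangle_ineq4)
  also have "\<dots> < e / 2 + e / 2"
    using F(3) G(3) norm_remainder_antimono[OF FG, of F "pprt x"]
      norm_remainder_antimono[OF FG, of G "- nprt x"] by (intro add_strict_mono) auto
  finally show ?thesis using FG by auto
qed

section \<open>Functionals supported on finitely many atoms\<close>

definition projL :: "'a::banach_lattice set \<Rightarrow> 'a \<Rightarrow>\<^sub>L 'a" where
  "projL F = Blinfun (proj F)"

lemma projL_apply: "finite F \<Longrightarrow> F \<subseteq> atoms \<Longrightarrow> blinfun_apply (projL F) x = proj F x"
  unfolding projL_def by (simp add: bounded_linear_Blinfun_apply bounded_linear_proj)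

definition restr :: "'a::banach_lattice set \<Rightarrow> 'a dual \<Rightarrow> 'a dual" where
  "restr F g = g o\<^sub>L projL F"

lemma restr_apply: "finite F \<Longrightarrow> F \<subseteq> atoms \<Longrightarrow> blinfun_apply (restr F g) x = blinfun_apply g (proj F x)"
  by (simp add: restr_def projL_apply)

lemma blinfun_proj: "blinfun_apply g (proj F x) = (\<Sum>a\<in>F. coord a x * blinfun_apply g a)"
  by (simp add: proj_def blinfun.sum_right blinfun.scaleR_right)

definition restr_modulus :: "'a::banach_lattice set \<Rightarrow> 'a dual \<Rightarrow> 'a dual" where
  "restr_modulus F g = Blinfun (\<lambda>x. \<Sum>a\<in>F. coord a x * \<bar>blinfun_apply g a\<bar>)"

lemma restr_modulus_apply:
  assumes "F \<subseteq> atoms"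
  shows "blinfun_apply (restr_modulus F g) x = (\<Sum>a\<in>F. coord a x * \<bar>blinfun_apply g a\<bar>)"
proof -
  have "bounded_linear (\<lambda>x. \<Sum>a\<in>F. coord a x * \<bar>blinfun_apply g a\<bar>)"
    using assms by (intro bounded_linear_sum bounded_linear_mult_const coord_bounded_linear) auto
  then show ?thesis by (simp add: restr_modulus_def bounded_linear_Blinfun_apply)
qed

text \<open>An upper bound \<open>k\<close> of a functional and its negative is positive, so that
  \<open>k x \<ge> k (P\<^sub>F x)\<close> for \<open>x \<ge> 0\<close>, and on the atoms \<open>k\<close> dominates the absolute values.\<close>

lemma restr_modulus_is_sup:
  assumes F: "finite F" "F \<subseteq> atoms"
  shows "dual_is_sup (restr F g) (- restr F g) (restr_modulus F g)"
  unfolding dual_is_sup_def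
proof (intro conjI allI impI)
  have le: "\<bar>blinfun_apply (restr F g) x\<bar> \<le> blinfun_apply (restr_modulus F g) x" if "0 \<le> x" for x
  proof -
    have "\<bar>blinfun_apply (restr F g) x\<bar> \<le> (\<Sum>a\<in>F. \<bar>coord a x * blinfun_apply g a\<bar>)"
      by (simp add: restr_apply[OF F] blinfun_proj sum_abs)
    also have "\<dots> = blinfun_apply (restr_modulus F g) x"
      using coord_nonneg[OF _ that] F by (auto simp: restr_modulus_apply abs_mult intro!: sum.cong)
    finally show ?thesis .
  qed
  show "dual_le (restr F g) (restr_modulus F g)" "dual_le (- restr F g) (restr_modulus F g)"
    using le by (fastforce simp: dual_le_def blinfun.minus_left)+
  fix k assume "dual_le (restr F g) k \<and> dual_le (- restr F g) k"
  then have k: "\<bar>blinfun_apply (restr F g) x\<bar> \<le> blinfun_apply k x" if "0 \<le> x" for x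
    using that by (auto simp: dual_le_def blinfun.minus_left abs_le_iff)
  show "dual_le (restr_modulus F g) k"
    unfolding dual_le_def
  proof (intro allI impI)
    fix x :: 'a assume x: "0 \<le> x"
    have "blinfun_apply (restr_modulus F g) x = (\<Sum>a\<in>F. coord a x * \<bar>blinfun_apply g a\<bar>)"
      by (rule restr_modulus_apply[OF F(2)])
    also have "\<dots> \<le> (\<Sum>a\<in>F. coord a x * blinfun_apply k a)"
    proof (intro sum_mono mult_left_mono)
      fix a assume a: "a \<in> F"
      then have aa: "a \<in> atoms" using F by auto
      have "proj F a = (\<Sum>b\<in>F. if b = a then a else 0)"
        unfolding proj_def using F aa by (intro sum.cong) (auto simp: coord_atom subset_iff)
      then have "proj F a = a" using a F(1) by simp
      then show "\<bar>blinfun_apply g a\<bar> \<le> blinfun_apply k a"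
        using k[of a] atoms_pos[OF aa] by (simp add: restr_apply[OF F] less_imp_le)
      show "0 \<le> coord a x" by (rule coord_nonneg[OF aa x])
    qed
    also have "\<dots> = blinfun_apply k (proj F x)" by (simp add: blinfun_proj)
    also have "\<dots> \<le> blinfun_apply k x"
      using k[of "x - proj F x"] proj_le[OF F x] by (simp add: blinfun.diff_right)
    finally show "blinfun_apply (restr_modulus F g) x \<le> blinfun_apply k x" .
  qed
qed

text \<open>A lower bound \<open>k\<close> of both moduli satisfies, for \<open>x \<ge> 0\<close>,
  \<open>k x = k (x - P\<^sub>F x) + k (P\<^sub>F x) \<le> 0\<close>: the modulus supported on \<open>F\<close> vanishes at the first vector,
  the one supported on \<open>G\<close> at the second.\<close>

lemma dual_disjoint_restr:
  assumes F: "finite F" "F \<subseteq> atoms" and G: "finite G" "G \<subseteq> atoms" and FG: "F \<inter> G = {}"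
  shows "dual_disjoint (restr F g) (restr G h)"
  unfolding dual_disjoint_def
proof (intro exI conjI)
  show "dual_is_sup (restr F g) (- restr F g) (restr_modulus F g)"
    "dual_is_sup (restr G h) (- restr G h) (restr_modulus G h)"
    by (intro restr_modulus_is_sup F G)+
  have nonneg: "0 \<le> blinfun_apply (restr_modulus H g) x" if "H \<subseteq> atoms" "0 \<le> x" for H g and x :: 'a
    using that coord_nonneg[of _ x] by (auto simp: restr_modulus_apply intro!: sum_nonneg)
  show "dual_is_inf (restr_modulus F g) (restr_modulus G h) 0"
    unfolding dual_is_inf_def
  proof (intro conjI allI impI)
    show "dual_le 0 (restr_modulus F g)" "dual_le 0 (restr_modulus G h)"
      using nonneg F G by (auto simp: dual_le_def)
    fix k assume k: "dual_le k (restr_modulus F g) \<and> dual_le k (restr_modulus G h)"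
    show "dual_le k 0"
      unfolding dual_le_def
    proof (intro allI impI)
      fix x :: 'a assume x: "0 \<le> x"
      have "blinfun_apply k (x - proj F x) \<le> blinfun_apply (restr_modulus F g) (x - proj F x)"
        using k proj_le[OF F x] by (simp add: dual_le_def)
      also have "\<dots> = (\<Sum>a\<in>F. 0)"
        unfolding restr_modulus_apply[OF F(2)]
      proof (rule sum.cong)
        fix a assume a: "a \<in> F"
        then have aa: "a \<in> atoms" using F by auto
        have "coord a (x - proj F x) = 0"
          using a coord_proj[OF F aa] linear_diff[OF linear_coord[OF aa]] by simp
        then show "coord a (x - proj F x) * \<bar>blinfun_apply g a\<bar> = 0" by simp
      qed simp
      finally have 1: "blinfun_apply k (x - proj F x) \<le> 0" by simp
      have "blinfun_apply k (proj F x) \<le> blinfun_apply (restr_modulus G h) (proj F x)"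
        using k proj_nonneg[OF F(2) x] by (simp add: dual_le_def)
      also have "\<dots> = (\<Sum>a\<in>G. 0)"
        unfolding restr_modulus_apply[OF G(2)]
      proof (rule sum.cong)
        fix a assume a: "a \<in> G"
        then have "a \<in> atoms" "a \<notin> F" using G FG by auto
        then show "coord a (proj F x) * \<bar>blinfun_apply h a\<bar> = 0" using coord_proj[OF F] by simp
      qed simp
      finally show "blinfun_apply k x \<le> blinfun_apply 0 x"
        using 1 by (simp add: blinfun.diff_right)
    qed
  qed
qed

section \<open>Compactness criteria\<close>

lemma compact_box:
  fixes v :: "'i \<Rightarrow> 'b::real_normed_vector"
  assumes "finite I"
  shows "compact {\<Sum>i\<in>I. t i *\<^sub>R v i | t. \<forall>i\<in>I. \<bar>t i\<bar> \<le> M i}"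
  using assms
proof (induction I rule: finite_induct)
  case (insert i I)
  let ?B = "\<lambda>I. {\<Sum>i\<in>I. t i *\<^sub>R v i | t. \<forall>i\<in>I. \<bar>t i\<bar> \<le> M i}"
  have "compact ((\<lambda>s. s *\<^sub>R v i) ` {- M i..M i})"
    by (intro compact_continuous_image continuous_intros) auto
  then have "compact {x + y | x y. x \<in> (\<lambda>s. s *\<^sub>R v i) ` {- M i..M i} \<and> y \<in> ?B I}"
    using insert.IH by (rule compact_sums)
  moreover have "{x + y | x y. x \<in> (\<lambda>s. s *\<^sub>R v i) ` {- M i..M i} \<and> y \<in> ?B I} = ?B (insert i I)"
  proof (intro set_eqI iffI)
    fix z assume "z \<in> {x + y | x y. x \<in> (\<lambda>s. s *\<^sub>R v i) ` {- M i..M i} \<and> y \<in> ?B I}"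
    then obtain s t where st: "z = s *\<^sub>R v i + (\<Sum>i\<in>I. t i *\<^sub>R v i)" "\<bar>s\<bar> \<le> M i" "\<forall>i\<in>I. \<bar>t i\<bar> \<le> M i"
      by (auto simp: abs_le_iff)
    have "(\<Sum>j\<in>I. (t(i := s)) j *\<^sub>R v j) = (\<Sum>j\<in>I. t j *\<^sub>R v j)"
      using insert.hyps by (intro sum.cong) auto
    then have "z = (\<Sum>j\<in>insert i I. (t(i := s)) j *\<^sub>R v j)" using insert.hyps st by simp
    moreover have "\<forall>j\<in>insert i I. \<bar>(t(i := s)) j\<bar> \<le> M j" using st by auto
    ultimately show "z \<in> ?B (insert i I)" by blast
  next
    fix z assume "z \<in> ?B (insert i I)"
    then obtain t where t: "z = t i *\<^sub>R v i + (\<Sum>j\<in>I. t j *\<^sub>R v j)" "\<forall>j\<in>insert i I. \<bar>t j\<bar> \<le> M j"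
      using insert.hyps by auto
    have "t i *\<^sub>R v i \<in> (\<lambda>s. s *\<^sub>R v i) ` {- M i..M i}" using t(2) by (auto simp: abs_le_iff)
    moreover have "(\<Sum>j\<in>I. t j *\<^sub>R v j) \<in> ?B I" using t(2) by auto
    ultimately show "z \<in> {x + y | x y. x \<in> (\<lambda>s. s *\<^sub>R v i) ` {- M i..M i} \<and> y \<in> ?B I}"
      using t(1) by blast
  qed
  ultimately show ?case by simp
qed simp

lemma relatively_compactI:
  fixes A :: "'b::banach set"
  assumes "\<And>e. 0 < e \<Longrightarrow> \<exists>K. compact K \<and> (\<forall>x\<in>A. \<exists>y\<in>K. norm (x - y) < e)"
  shows "relatively_compact A"
  unfolding relatively_compact_def compact_eq_totally_bounded
proof (intro conjI allI impI)
  show "complete (closure A)" by (simp add: complete_eq_closed)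
  fix e :: real assume e: "0 < e"
  obtain K where K: "compact K" "\<And>x. x \<in> A \<Longrightarrow> \<exists>y\<in>K. norm (x - y) < e / 3"
    using assms[of "e / 3"] e by auto
  obtain k where k: "finite k" "K \<subseteq> (\<Union>x\<in>k. ball x (e / 3))"
    using K(1) e unfolding compact_eq_totally_bounded by (meson divide_pos_pos zero_less_numeral)
  have "A \<subseteq> (\<Union>x\<in>k. cball x (2 * e / 3))"
  proof
    fix x assume "x \<in> A"
    then obtain y where y: "y \<in> K" "dist x y < e / 3" using K(2) by (auto simp: dist_norm)
    then obtain z where z: "z \<in> k" "dist z y < e / 3" using k(2) by auto
    have "dist z x \<le> 2 * e / 3" using y(2) z(2) dist_triangle2[of z x y] by simp
    then show "x \<in> (\<Union>x\<in>k. cball x (2 * e / 3))" using z(1) by auto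
  qed
  then have "closure A \<subseteq> (\<Union>x\<in>k. cball x (2 * e / 3))"
    using k(1) by (intro closure_minimal) auto
  also have "\<dots> \<subseteq> (\<Union>x\<in>k. ball x e)" using e by fastforce
  finally show "\<exists>k. finite k \<and> closure A \<subseteq> (\<Union>x\<in>k. ball x e)" using k(1) by blast
qed

lemma relatively_compact_atomic:
  fixes A :: "'a::banach_lattice set"
  assumes tail: "\<And>e. 0 < e \<Longrightarrow> \<exists>F. finite F \<and> F \<subseteq> atoms \<and> (\<forall>x\<in>A. norm (x - proj F x) < e)"
    and coords: "\<And>a. a \<in> atoms \<Longrightarrow> \<exists>C. \<forall>x\<in>A. \<bar>coord a x\<bar> \<le> C"
  shows "relatively_compact A"
proof (rule relatively_compactI)
  fix e :: real assume "0 < e"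
  then obtain F where F: "finite F" "F \<subseteq> atoms" "\<forall>x\<in>A. norm (x - proj F x) < e" using tail by blast
  obtain M where M: "\<And>a x. a \<in> atoms \<Longrightarrow> x \<in> A \<Longrightarrow> \<bar>coord a x\<bar> \<le> M a" using coords by metis
  have "\<exists>y\<in>{\<Sum>a\<in>F. t a *\<^sub>R a | t. \<forall>a\<in>F. \<bar>t a\<bar> \<le> M a}. norm (x - y) < e" if "x \<in> A" for x
  proof
    show "norm (x - proj F x) < e" using F that by blast
    show "proj F x \<in> {\<Sum>a\<in>F. t a *\<^sub>R a | t. \<forall>a\<in>F. \<bar>t a\<bar> \<le> M a}"
      unfolding proj_def mem_Collect_eq
      by (rule exI[of _ "\<lambda>a. coord a x"]) (use F M that in auto)
  qed
  then show "\<exists>K. compact K \<and> (\<forall>x\<in>A. \<exists>y\<in>K. norm (x - y) < e)"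
    using compact_box[OF F(1), of "\<lambda>a. a" M] by blast
qed

section \<open>Powers with a real exponent\<close>

lemma powr_convex_nonneg:
  fixes p s t u v :: real
  assumes p: "1 \<le> p" and "0 \<le> s" "0 \<le> t" "0 \<le> u" "0 \<le> v" "u + v = 1"
  shows "(u * s + v * t) powr p \<le> u * s powr p + v * t powr p"
proof (cases "0 < s \<and> 0 < t")
  case True
  then show ?thesis using convex_onD[OF powr_convex[OF p], of v s t] assms
    by (simp add: add_eq_0_iff eq_diff_eq[symmetric])
next
  case False
  have le: "(w * z) powr p \<le> w * z powr p" if "0 \<le> w" "w \<le> 1" "0 \<le> z" for w z :: real
  proof (cases "w = 0")
    case False
    then have "w powr p \<le> w powr 1" using that p by (intro powr_mono') auto
    then show ?thesis using that by (simp add: powr_mult mult_right_mono)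
  qed simp
  show ?thesis using False le[of u s] le[of v t] assms by auto
qed

lemma powr_superadd:
  fixes s t r :: real
  assumes "1 \<le> r" "0 \<le> s" "0 \<le> t"
  shows "s powr r + t powr r \<le> (s + t) powr r"
proof (cases "s = 0 \<or> t = 0")
  case False
  have *: "z powr r = z * z powr (r - 1)" if "0 < z" for z :: real
    using that powr_mult_base[of z "r - 1"] by simp
  have "s powr (r - 1) \<le> (s + t) powr (r - 1)" "t powr (r - 1) \<le> (s + t) powr (r - 1)"
    using assms by (auto intro!: powr_mono2)
  then have "s * s powr (r - 1) + t * t powr (r - 1) \<le> s * (s + t) powr (r - 1) + t * (s + t) powr (r - 1)"
    using assms by (intro add_mono mult_left_mono) auto
  then show ?thesis using *[of s] *[of t] *[of "s + t"] False assms by (simp add: distrib_right)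
qed (use assms in auto)

lemma powr_add_le:
  fixes a b p :: real
  assumes "1 \<le> p"
  shows "\<bar>a + b\<bar> powr p \<le> 2 powr p * (\<bar>a\<bar> powr p + \<bar>b\<bar> powr p)"
proof -
  have "\<bar>a + b\<bar> \<le> 2 * max \<bar>a\<bar> \<bar>b\<bar>" by auto
  then have "\<bar>a + b\<bar> powr p \<le> (2 * max \<bar>a\<bar> \<bar>b\<bar>) powr p" using assms by (intro powr_mono2) auto
  also have "\<dots> = 2 powr p * max \<bar>a\<bar> \<bar>b\<bar> powr p" by (simp add: powr_mult)
  also have "\<dots> \<le> 2 powr p * (\<bar>a\<bar> powr p + \<bar>b\<bar> powr p)"
    by (intro mult_left_mono) (auto simp: max_def)
  finally show ?thesis .
qed

text \<open>Clarkson's inequality for \<open>p \<ge> 2\<close>. Convexity of \<open>t\<^sup>p\<^sup>/\<^sup>2\<close> bounds the right side below by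
  \<open>2 (a\<^sup>2 + b\<^sup>2)\<^sup>p\<^sup>/\<^sup>2\<close>, and \<open>t\<^sup>p\<^sup>/\<^sup>2\<close> is superadditive.\<close>

lemma clarkson:
  fixes a b p :: real
  assumes p: "2 \<le> p"
  shows "2 * (\<bar>a\<bar> powr p + \<bar>b\<bar> powr p) \<le> \<bar>a + b\<bar> powr p + \<bar>a - b\<bar> powr p"
proof -
  have sq: "\<bar>x\<bar> powr p = (x\<^sup>2) powr (p / 2)" for x :: real
  proof -
    have "x\<^sup>2 = \<bar>x\<bar> powr 2" by (simp add: powr_numeral)
    then show ?thesis by (simp only: powr_powr) simp
  qed
  have "\<bar>a\<bar> powr p + \<bar>b\<bar> powr p \<le> (a\<^sup>2 + b\<^sup>2) powr (p / 2)"
    unfolding sq using p by (intro powr_superadd) auto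
  also have "a\<^sup>2 + b\<^sup>2 = (1/2) * (a + b)\<^sup>2 + (1/2) * (a - b)\<^sup>2"
    by (simp add: power2_eq_square algebra_simps)
  also have "\<dots> powr (p / 2) \<le> (1/2) * ((a + b)\<^sup>2) powr (p / 2) + (1/2) * ((a - b)\<^sup>2) powr (p / 2)"
    using p by (intro powr_convex_nonneg) auto
  finally show ?thesis unfolding sq by simp
qed

text \<open>Averaging over signs shows that \<open>\<ell>\<^sub>p\<close> has cotype \<open>p\<close> with constant \<open>1\<close>; choosing the better
  sign in every step keeps the average out of the statement.\<close>

lemma exists_signs:
  fixes c :: "nat \<Rightarrow> nat \<Rightarrow> real"
  assumes p: "2 \<le> p"
  shows "\<exists>\<epsilon>. (\<forall>n. \<bar>\<epsilon> n\<bar> = 1) \<and>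
    (\<Sum>k<m. \<Sum>n<N. \<bar>c k n\<bar> powr p) \<le> (\<Sum>k<m. \<bar>\<Sum>n<N. \<epsilon> n * c k n\<bar> powr p)"
proof (induction N)
  case 0
  show ?case by (rule exI[of _ "\<lambda>_. 1"]) simp
next
  case (Suc N)
  then obtain \<epsilon> where \<epsilon>: "\<And>n. \<bar>\<epsilon> n\<bar> = 1"
    "(\<Sum>k<m. \<Sum>n<N. \<bar>c k n\<bar> powr p) \<le> (\<Sum>k<m. \<bar>\<Sum>n<N. \<epsilon> n * c k n\<bar> powr p)" by blast
  define S where "S k = (\<Sum>n<N. \<epsilon> n * c k n)" for k
  have eq: "(\<Sum>n<Suc N. (\<epsilon>(N := s)) n * c k n) = S k + s * c k N" for s k
    by (simp add: S_def)
  have "2 * (\<Sum>k<m. \<Sum>n<Suc N. \<bar>c k n\<bar> powr p)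
      = 2 * ((\<Sum>k<m. \<Sum>n<N. \<bar>c k n\<bar> powr p) + (\<Sum>k<m. \<bar>c k N\<bar> powr p))"
    by (simp add: sum.distrib)
  also have "\<dots> \<le> 2 * ((\<Sum>k<m. \<bar>S k\<bar> powr p) + (\<Sum>k<m. \<bar>c k N\<bar> powr p))"
    using \<epsilon>(2) by (simp add: S_def)
  also have "\<dots> = (\<Sum>k<m. 2 * (\<bar>S k\<bar> powr p + \<bar>c k N\<bar> powr p))"
    by (simp add: sum_distrib_left[symmetric] sum.distrib)
  also have "\<dots> \<le> (\<Sum>k<m. \<bar>S k + c k N\<bar> powr p + \<bar>S k - c k N\<bar> powr p)"
    by (intro sum_mono clarkson p)
  also have "\<dots> = (\<Sum>k<m. \<bar>S k + c k N\<bar> powr p) + (\<Sum>k<m. \<bar>S k - c k N\<bar> powr p)"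
    by (rule sum.distrib)
  finally have "(\<Sum>k<m. \<Sum>n<Suc N. \<bar>c k n\<bar> powr p) \<le> (\<Sum>k<m. \<bar>S k + 1 * c k N\<bar> powr p) \<or>
    (\<Sum>k<m. \<Sum>n<Suc N. \<bar>c k n\<bar> powr p) \<le> (\<Sum>k<m. \<bar>S k + (- 1) * c k N\<bar> powr p)"
    unfolding mult_1 mult_minus1 diff_conv_add_uminus[symmetric] by linarith
  then show ?case
  proof
    assume "(\<Sum>k<m. \<Sum>n<Suc N. \<bar>c k n\<bar> powr p) \<le> (\<Sum>k<m. \<bar>S k + 1 * c k N\<bar> powr p)"
    then show ?thesis using \<epsilon>(1) unfolding eq[symmetric]
      by (intro exI[of _ "\<epsilon>(N := 1)"]) (auto simp del: sum.lessThan_Suc)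
  next
    assume "(\<Sum>k<m. \<Sum>n<Suc N. \<bar>c k n\<bar> powr p) \<le> (\<Sum>k<m. \<bar>S k + (- 1) * c k N\<bar> powr p)"
    then show ?thesis using \<epsilon>(1) unfolding eq[symmetric]
      by (intro exI[of _ "\<epsilon>(N := - 1)"]) (auto simp del: sum.lessThan_Suc)
  qed
qed

section \<open>Order continuity is necessary\<close>

text \<open>The sets of points at which all partial sums stay below \<open>C\<close> are closed and cover the space. By
  Baire's theorem one of them contains a ball, which is moved to the origin by differences.\<close>

lemma weak_star_p_summable_bounded:
  fixes f :: "nat \<Rightarrow> 'b::banach dual"
  assumes p: "1 \<le> p" and f: "weak_star_p_summable p f"
  shows "\<exists>C. \<forall>y m. norm y \<le> 1 \<longrightarrow> (\<Sum>k<m. \<bar>blinfun_apply (f k) y\<bar> powr p) \<le> C"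
proof -
  define B where "B C = {y. \<forall>m. (\<Sum>k<m. \<bar>blinfun_apply (f k) y\<bar> powr p) \<le> real C}" for C :: nat
  have "continuous_on UNIV (\<lambda>y. \<bar>blinfun_apply (f k) y\<bar> powr p)" for k
    using p by (intro continuous_on_powr' continuous_intros) auto
  then have closed: "closed (B C)" for C
    unfolding B_def Collect_all_eq
    by (intro closed_INT ballI closed_Collect_le continuous_on_sum continuous_on_const)
  have "y \<in> (\<Union>C. B C)" for y
  proof -
    have s: "summable (\<lambda>k. \<bar>blinfun_apply (f k) y\<bar> powr p)"
      using f by (simp add: weak_star_p_summable_def ell_def)
    obtain C where C: "(\<Sum>k. \<bar>blinfun_apply (f k) y\<bar> powr p) \<le> real C" using real_arch_simple by blast
    have "(\<Sum>k<m. \<bar>blinfun_apply (f k) y\<bar> powr p) \<le> real C" for m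
      using sum_le_suminf[OF s, of "{..<m}"] C by auto
    then show ?thesis by (auto simp: B_def)
  qed
  then have un: "(\<Union>C. B C) = UNIV" by blast
  have "\<exists>C. interior (B C) \<noteq> {}"
  proof (rule ccontr)
    assume "\<not> ?thesis"
    then have "euclidean interior_of \<Union> (range B) = {}"
      using closed by (intro Baire_category_alt) (auto simp: completely_metrizable_space_euclidean)
    then show False using un by simp
  qed
  then obtain C y0 where "y0 \<in> interior (B C)" by blast
  then obtain r where r: "0 < r" "ball y0 r \<subseteq> B C" by (auto simp: mem_interior)
  define M where "M = (2 / r) powr p * (2 powr p * (2 * real C))"
  have "(\<Sum>k<m. \<bar>blinfun_apply (f k) y\<bar> powr p) \<le> M" if y: "norm y \<le> 1" for y m
  proof -
    define z where "z = y0 + (r / 2) *\<^sub>R y"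
    have "norm ((r / 2) *\<^sub>R y) \<le> r / 2 * 1" unfolding norm_scaleR using y r by (intro mult_mono) auto
    then have "z \<in> ball y0 r" "y0 \<in> ball y0 r" using r(1) by (auto simp: z_def dist_norm)
    then have B: "z \<in> B C" "y0 \<in> B C" using r by auto
    have "\<bar>blinfun_apply (f k) y\<bar> powr p
        \<le> (2 / r) powr p * (2 powr p * (\<bar>blinfun_apply (f k) z\<bar> powr p + \<bar>blinfun_apply (f k) y0\<bar> powr p))" for k
    proof -
      have eq: "blinfun_apply (f k) y = (2 / r) * (blinfun_apply (f k) z + - blinfun_apply (f k) y0)"
        using r(1) by (simp add: z_def blinfun.add_right blinfun.scaleR_right)
      then have "\<bar>blinfun_apply (f k) y\<bar> powr p
          = (2 / r) powr p * \<bar>blinfun_apply (f k) z + - blinfun_apply (f k) y0\<bar> powr p"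
        unfolding eq abs_mult powr_mult using r(1) by simp
      also have "\<dots> \<le> (2 / r) powr p * (2 powr p * (\<bar>blinfun_apply (f k) z\<bar> powr p + \<bar>- blinfun_apply (f k) y0\<bar> powr p))"
        by (intro mult_left_mono powr_add_le p) simp
      finally show ?thesis by simp
    qed
    then have "(\<Sum>k<m. \<bar>blinfun_apply (f k) y\<bar> powr p) \<le> (\<Sum>k<m. (2 / r) powr p * (2 powr p *
        (\<bar>blinfun_apply (f k) z\<bar> powr p + \<bar>blinfun_apply (f k) y0\<bar> powr p)))" by (intro sum_mono)
    also have "\<dots> = (2 / r) powr p * (2 powr p *
        ((\<Sum>k<m. \<bar>blinfun_apply (f k) z\<bar> powr p) + (\<Sum>k<m. \<bar>blinfun_apply (f k) y0\<bar> powr p)))"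
      by (simp add: sum_distrib_left[symmetric] sum.distrib)
    also have "\<dots> \<le> (2 / r) powr p * (2 powr p * (real C + real C))"
      using B by (intro mult_left_mono add_mono) (auto simp: B_def)
    finally show ?thesis by (simp add: M_def)
  qed
  then show ?thesis by blast
qed

lemma disjoint_signed_sum_norm_le:
  fixes u :: "nat \<Rightarrow> 'a::banach_lattice"
  assumes u: "\<And>n. 0 \<le> u n \<and> u n \<le> x" "\<And>m n. m \<noteq> n \<Longrightarrow> disjoint_elems (u m) (u n)" and \<epsilon>: "\<And>n. \<bar>\<epsilon> n\<bar> = 1"
  shows "norm (\<Sum>n<N. \<epsilon> n *\<^sub>R u n) \<le> norm x"
proof -
  have x: "0 \<le> x" using u(1)[of 0] by (meson order_trans)
  have "\<bar>\<Sum>n<N. \<epsilon> n *\<^sub>R u n\<bar> = (\<Sum>n<N. \<bar>\<epsilon> n *\<^sub>R u n\<bar>)"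
  proof (rule abs_sum_disj)
    fix i j :: nat assume "i \<noteq> j"
    then have "disjoint_elems (\<epsilon> j *\<^sub>R u j) (u i)" by (intro disj_scaleR u(2)) simp
    then have "disjoint_elems (u i) (\<epsilon> j *\<^sub>R u j)" by (simp add: disj_sym)
    then show "disjoint_elems (\<epsilon> i *\<^sub>R u i) (\<epsilon> j *\<^sub>R u j)" by (rule disj_scaleR)
  qed simp
  also have "\<dots> = (\<Sum>n<N. u n)" using u(1) \<epsilon> by (simp add: abs_scaleR_lattice abs_of_nonneg)
  also have "\<dots> \<le> x" by (intro disj_sum_le) (use u x in auto)
  finally show ?thesis by (rule norm_le_of_abs_le)
qed

text \<open>An operator into \<open>\<ell>\<^sub>p\<close> maps a disjoint order bounded sequence, whose signed sums are bounded,
  to a sequence with \<open>p\<close>-summable norms, because \<open>\<ell>\<^sub>p\<close> has cotype \<open>p\<close> for \<open>p \<ge> 2\<close>. Summing over both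
  indices in the other order gives \<open>p\<close>-limitedness.\<close>

lemma p_limited_disjoint_order_bounded:
  fixes u :: "nat \<Rightarrow> 'a::banach_lattice"
  assumes p: "2 \<le> p" and u: "\<And>n. 0 \<le> u n \<and> u n \<le> x" "\<And>m n. m \<noteq> n \<Longrightarrow> disjoint_elems (u m) (u n)"
  shows "p_limited p (range u)"
  unfolding p_limited_def
proof (intro allI impI)
  fix f :: "nat \<Rightarrow> 'a dual" assume f: "weak_star_p_summable p f"
  obtain C where C: "\<And>y m. norm y \<le> 1 \<Longrightarrow> (\<Sum>k<m. \<bar>blinfun_apply (f k) y\<bar> powr p) \<le> C"
    using weak_star_p_summable_bounded[OF _ f] p by auto
  define D where "D = (norm x + 1) powr p * C"
  have bound: "(\<Sum>k<m. \<Sum>n<N. \<bar>blinfun_apply (f k) (u n)\<bar> powr p) \<le> D" for m N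
  proof -
    obtain \<epsilon> where \<epsilon>: "\<And>n. \<bar>\<epsilon> n\<bar> = 1" "(\<Sum>k<m. \<Sum>n<N. \<bar>blinfun_apply (f k) (u n)\<bar> powr p)
        \<le> (\<Sum>k<m. \<bar>\<Sum>n<N. \<epsilon> n * blinfun_apply (f k) (u n)\<bar> powr p)"
      using exists_signs[OF p, where m = m and N = N and c = "\<lambda>k n. blinfun_apply (f k) (u n)"] by blast
    define y where "y = (1 / (norm x + 1)) *\<^sub>R (\<Sum>n<N. \<epsilon> n *\<^sub>R u n)"
    have n1: "0 < norm x + 1" by (simp add: add_nonneg_pos)
    have "norm (\<Sum>n<N. \<epsilon> n *\<^sub>R u n) \<le> norm x" by (rule disjoint_signed_sum_norm_le[OF u \<epsilon>(1)])
    then have "norm y \<le> 1" using n1 by (simp add: y_def field_simps)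
    have "\<bar>\<Sum>n<N. \<epsilon> n * blinfun_apply (f k) (u n)\<bar> powr p
        = (norm x + 1) powr p * \<bar>blinfun_apply (f k) y\<bar> powr p" for k
    proof -
      have "(\<Sum>n<N. \<epsilon> n * blinfun_apply (f k) (u n)) = (norm x + 1) * blinfun_apply (f k) y"
        using n1 by (simp add: y_def blinfun.scaleR_right blinfun.sum_right)
      then show ?thesis using n1 by (simp add: abs_mult powr_mult)
    qed
    then have "(\<Sum>k<m. \<bar>\<Sum>n<N. \<epsilon> n * blinfun_apply (f k) (u n)\<bar> powr p)
        = (norm x + 1) powr p * (\<Sum>k<m. \<bar>blinfun_apply (f k) y\<bar> powr p)"
      by (simp add: sum_distrib_left)
    also have "\<dots> \<le> D" unfolding D_def by (intro mult_left_mono C \<open>norm y \<le> 1\<close>) simp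
    finally show ?thesis using \<epsilon>(2) by simp
  qed
  have "\<exists>n0. \<forall>n. \<bar>blinfun_apply (f k) (u n)\<bar> \<le> 2 * \<bar>blinfun_apply (f k) (u n0)\<bar>" for k
  proof (cases "\<forall>n. blinfun_apply (f k) (u n) = 0")
    case False
    then obtain n1 where n1: "blinfun_apply (f k) (u n1) \<noteq> 0" by blast
    define s where "s = (SUP n. \<bar>blinfun_apply (f k) (u n)\<bar>)"
    have "\<bar>blinfun_apply (f k) (u n)\<bar> \<le> norm (f k) * norm x" for n
    proof -
      have "\<bar>blinfun_apply (f k) (u n)\<bar> \<le> norm (f k) * norm (u n)" using norm_blinfun[of "f k" "u n"] by simp
      also have "\<dots> \<le> norm (f k) * norm x" using u(1) by (intro mult_left_mono norm_mono_pos) auto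
      finally show ?thesis .
    qed
    then have bdd: "bdd_above (range (\<lambda>n. \<bar>blinfun_apply (f k) (u n)\<bar>))" by (intro bdd_aboveI2)
    have le: "\<bar>blinfun_apply (f k) (u n)\<bar> \<le> s" for n unfolding s_def using bdd by (intro cSUP_upper) auto
    have "0 < \<bar>blinfun_apply (f k) (u n1)\<bar>" using n1 by simp
    then have "s / 2 < s" using le[of n1] by linarith
    then obtain n0 where "s / 2 < \<bar>blinfun_apply (f k) (u n0)\<bar>"
      unfolding s_def less_cSUP_iff[OF UNIV_not_empty bdd] by blast
    then have "\<bar>blinfun_apply (f k) (u n)\<bar> \<le> 2 * \<bar>blinfun_apply (f k) (u n0)\<bar>" for n
      using le[of n] by simp
    then show ?thesis by blast
  qed simp
  then obtain \<nu> where \<nu>: "\<And>k n. \<bar>blinfun_apply (f k) (u n)\<bar> \<le> 2 * \<bar>blinfun_apply (f k) (u (\<nu> k))\<bar>" by metis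
  define a where "a k = 2 * \<bar>blinfun_apply (f k) (u (\<nu> k))\<bar>" for k
  have "(\<Sum>k<m. \<bar>a k\<bar> powr p) \<le> 2 powr p * D" for m
  proof -
    obtain N where N: "\<And>k. k < m \<Longrightarrow> \<nu> k < N"
      using finite_nat_set_iff_bounded[of "\<nu> ` {..<m}"] by auto
    have "(\<Sum>k<m. \<bar>a k\<bar> powr p) = 2 powr p * (\<Sum>k<m. \<bar>blinfun_apply (f k) (u (\<nu> k))\<bar> powr p)"
      by (simp add: a_def abs_mult powr_mult sum_distrib_left)
    also have "\<dots> \<le> 2 powr p * (\<Sum>k<m. \<Sum>n<N. \<bar>blinfun_apply (f k) (u n)\<bar> powr p)"
    proof (intro mult_left_mono sum_mono)
      fix k assume "k \<in> {..<m}"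
      then show "\<bar>blinfun_apply (f k) (u (\<nu> k))\<bar> powr p \<le> (\<Sum>n<N. \<bar>blinfun_apply (f k) (u n)\<bar> powr p)"
        using N by (intro member_le_sum[of "\<nu> k"]) auto
    qed simp
    also have "\<dots> \<le> 2 powr p * D" using bound by (intro mult_left_mono) auto
    finally show ?thesis .
  qed
  then have "summable (\<lambda>k. \<bar>a k\<bar> powr p)" by (intro summableI_nonneg_bounded) auto
  then have "a \<in> ell p" by (simp add: ell_def)
  then show "\<exists>a\<in>ell p. \<forall>x\<in>range u. \<forall>n. \<bar>blinfun_apply (f n) x\<bar> \<le> a n"
    using \<nu> by (intro bexI[of _ a]) (auto simp: a_def)
qed

lemma bidual_series:
  fixes u :: "nat \<Rightarrow> 'b::real_normed_vector"
  assumes C: "\<And>g N. (\<Sum>n<N. \<bar>blinfun_apply (g :: 'b dual) (u n)\<bar>) \<le> norm g * C" and w: "\<And>n. \<bar>w n\<bar> \<le> 1"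
  shows "summable (\<lambda>n. \<bar>blinfun_apply (g :: 'b dual) (u n)\<bar>)"
    and "\<exists>\<Phi> :: 'b dual dual. \<forall>g. (\<lambda>n. w n * blinfun_apply g (u n)) sums blinfun_apply \<Phi> g"
proof -
  show s: "summable (\<lambda>n. \<bar>blinfun_apply g (u n)\<bar>)" for g :: "'b dual"
    using C[of g] by (intro summableI_nonneg_bounded) auto
  have le: "norm (w n * blinfun_apply g (u n)) \<le> \<bar>blinfun_apply g (u n)\<bar>" for n and g :: "'b dual"
    using mult_right_mono[OF w[of n], of "\<bar>blinfun_apply g (u n)\<bar>"] by (simp add: abs_mult)
  have sw: "summable (\<lambda>n. w n * blinfun_apply g (u n))" for g :: "'b dual"
    by (rule summable_comparison_test'[OF s le])
  define \<phi> where "\<phi> g = (\<Sum>n. w n * blinfun_apply g (u n))" for g :: "'b dual"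
  have "bounded_linear \<phi>"
  proof (rule bounded_linear_intro[of _ C])
    show "\<phi> (g + h) = \<phi> g + \<phi> h" for g h
      unfolding \<phi>_def blinfun.add_left distrib_left by (rule suminf_add[symmetric]) (rule sw)+
    show "\<phi> (c *\<^sub>R g) = c *\<^sub>R \<phi> g" for c g
      unfolding \<phi>_def blinfun.scaleR_left real_scaleR_def
      by (subst suminf_mult[OF sw, symmetric]) (simp add: mult.left_commute)
    show "norm (\<phi> g) \<le> norm g * C" for g
    proof -
      have "norm (\<phi> g) \<le> (\<Sum>n. \<bar>blinfun_apply g (u n)\<bar>)"
        unfolding \<phi>_def by (rule norm_suminf_le) (use s le in auto)
      also have "\<dots> \<le> norm g * C" using C[of g] s by (intro suminf_le_const) auto
      finally show ?thesis .
    qed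
  qed
  then have "\<forall>g. (\<lambda>n. w n * blinfun_apply g (u n)) sums blinfun_apply (Blinfun \<phi>) g"
    using sw by (auto simp: bounded_linear_Blinfun_apply \<phi>_def)
  then show "\<exists>\<Phi> :: 'b dual dual. \<forall>g. (\<lambda>n. w n * blinfun_apply g (u n)) sums blinfun_apply \<Phi> g" by blast
qed

text \<open>The map \<open>g \<mapsto> (g (u n))\<^sub>n\<close> sends the dual space to \<open>\<ell>\<^sub>1\<close>. In a Grothendieck space a weak* null
  sequence is weakly null, and weakly null sequences of \<open>\<ell>\<^sub>1\<close> converge in norm by Schur's gliding hump
  argument, which is carried out for the coordinates \<open>g (u n)\<close>: \<open>S\<close> collects one hump position from
  each block \<open>[N, N')\<close>.\<close>

lemma limited_disjoint_order_bounded: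
  fixes u :: "nat \<Rightarrow> 'a::banach_lattice"
  assumes gr: "grothendieck TYPE('a)"
    and u: "\<And>n. 0 \<le> u n \<and> u n \<le> x" "\<And>m n. m \<noteq> n \<Longrightarrow> disjoint_elems (u m) (u n)"
  shows "limited (range u)"
  unfolding limited_def
proof (intro conjI allI impI)
  show "bounded (range u)" using u(1) by (auto simp: bounded_iff intro!: exI[of _ "norm x"] norm_mono_pos)
  have x: "0 \<le> x" using u(1)[of 0] by (meson order_trans)
  have C: "(\<Sum>n<N. \<bar>blinfun_apply (g :: 'a dual) (u n)\<bar>) \<le> norm g * norm x" for g N
  proof -
    have "(\<Sum>n<N. \<bar>blinfun_apply g (u n)\<bar>) \<le> norm g * norm (\<Sum>n<N. u n)"
      by (intro blinfun_sum_abs_le) (use u in auto)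
    also have "\<dots> \<le> norm g * norm x"
      by (intro mult_left_mono norm_mono_pos disj_sum_le sum_nonneg) (use u x in auto)
    finally show ?thesis .
  qed
  fix f :: "nat \<Rightarrow> 'a dual" assume f: "weak_star_null f"
  then have wn: "weakly_null f" using gr by (simp add: grothendieck_def)
  show "uniform_limit (range u) (\<lambda>n. blinfun_apply (f n)) (\<lambda>_. 0) sequentially"
  proof (rule ccontr)
    assume "\<not> ?thesis"
    then obtain e where e: "0 < e" "\<And>K. \<exists>k\<ge>K. \<exists>n. e \<le> \<bar>blinfun_apply (f k) (u n)\<bar>"
      by (auto simp: uniform_limit_iff eventually_sequentially not_less dist_norm)
    have "\<exists>k n N'. N \<le> k \<and> N \<le> n \<and> n < N' \<and> e \<le> \<bar>blinfun_apply (f k) (u n)\<bar> \<and>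
        (\<Sum>i<N. \<bar>blinfun_apply (f k) (u i)\<bar>) < e / 4 \<and> (\<Sum>i. \<bar>blinfun_apply (f k) (u (i + N'))\<bar>) < e / 4" for N
    proof -
      have "(\<lambda>k. \<Sum>i<N. \<bar>blinfun_apply (f k) (u i)\<bar>) \<longlonglongrightarrow> (\<Sum>i<N. \<bar>0\<bar>)"
        using f by (intro tendsto_intros) (auto simp: weak_star_null_def)
      then have "\<forall>\<^sub>F k in sequentially. (\<Sum>i<N. \<bar>blinfun_apply (f k) (u i)\<bar>) < e / 4"
        using e(1) by (intro order_tendstoD) auto
      then obtain K where K: "\<And>k. K \<le> k \<Longrightarrow> (\<Sum>i<N. \<bar>blinfun_apply (f k) (u i)\<bar>) < e / 4"
        by (auto simp: eventually_sequentially)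
      obtain k n where kn: "max K N \<le> k" "e \<le> \<bar>blinfun_apply (f k) (u n)\<bar>" using e(2) by blast
      have "N \<le> n"
      proof (rule ccontr)
        assume "\<not> N \<le> n"
        then have "\<bar>blinfun_apply (f k) (u n)\<bar> \<le> (\<Sum>i<N. \<bar>blinfun_apply (f k) (u i)\<bar>)"
          by (intro member_le_sum[of n]) auto
        then show False using K[of k] kn e(1) by auto
      qed
      have "(\<lambda>N'. \<Sum>i. \<bar>blinfun_apply (f k) (u (i + N'))\<bar>) \<longlonglongrightarrow> 0"
        using bidual_series(1)[OF C, of "\<lambda>_. 0"] by (intro suminf_exist_split2) auto
      then have "\<forall>\<^sub>F N' in sequentially. (\<Sum>i. \<bar>blinfun_apply (f k) (u (i + N'))\<bar>) < e / 4"
        using e(1) by (intro order_tendstoD) auto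
      then obtain N0 where N0: "\<And>N'. N0 \<le> N' \<Longrightarrow> (\<Sum>i. \<bar>blinfun_apply (f k) (u (i + N'))\<bar>) < e / 4"
        by (auto simp: eventually_sequentially)
      show ?thesis
        using kn \<open>N \<le> n\<close> K[of k] N0[of "max N0 (Suc n)"]
        by (intro exI[of _ k] exI[of _ n] exI[of _ "max N0 (Suc n)"]) auto
    qed
    then obtain \<kappa> \<nu> \<tau> where step: "\<And>N. N \<le> \<kappa> N \<and> N \<le> \<nu> N \<and> \<nu> N < \<tau> N \<and>
        e \<le> \<bar>blinfun_apply (f (\<kappa> N)) (u (\<nu> N))\<bar> \<and>
        (\<Sum>i<N. \<bar>blinfun_apply (f (\<kappa> N)) (u i)\<bar>) < e / 4 \<and>
        (\<Sum>i. \<bar>blinfun_apply (f (\<kappa> N)) (u (i + \<tau> N))\<bar>) < e / 4" by metis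
    define T where "T = rec_nat 0 (\<lambda>_. \<tau>)"
    have T: "T (Suc j) = \<tau> (T j)" for j by (simp add: T_def)
    have Tlt: "T j < T (Suc j)" for j using step[of "T j"] by (auto simp: T)
    then have Tmono: "strict_mono T" by (simp add: strict_mono_Suc_iff)
    define S where "S = range (\<lambda>j. \<nu> (T j))"
    have S: "{n \<in> S. T j \<le> n \<and> n < T (Suc j)} = {\<nu> (T j)}" for j
    proof -
      have "i = j" if "T j \<le> \<nu> (T i)" "\<nu> (T i) < T (Suc j)" for i
      proof (rule ccontr)
        assume "i \<noteq> j"
        then have "i < j \<or> j < i" by auto
        moreover have "T (Suc i) \<le> T j" if "i < j" using that strict_mono_less_eq[OF Tmono] by simp
        moreover have "T (Suc j) \<le> T i" if "j < i" using that strict_mono_less_eq[OF Tmono] by simp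
        ultimately show False using that step[of "T i"] T[of i] by fastforce
      qed
      then show ?thesis using step[of "T j"] T[of j] by (auto simp: S_def)
    qed
    obtain \<Phi> :: "'a dual dual" where \<Phi>: "\<And>g. (\<lambda>n. indicator S n * blinfun_apply g (u n)) sums blinfun_apply \<Phi> g"
      using bidual_series(2)[OF C, of "indicator S"] by (auto simp: indicator_def)
    have big: "e / 2 \<le> \<bar>blinfun_apply \<Phi> (f (\<kappa> (T j)))\<bar>" for j
    proof -
      define g where "g = f (\<kappa> (T j))"
      define h where "h n = indicator S n * blinfun_apply g (u n)" for n
      have habs: "\<bar>h n\<bar> \<le> \<bar>blinfun_apply g (u n)\<bar>" for n by (simp add: h_def indicator_def)
      have hs: "h sums blinfun_apply \<Phi> g" using \<Phi>[of g] by (simp add: h_def[abs_def])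
      have sg: "summable (\<lambda>n. \<bar>blinfun_apply g (u n)\<bar>)" using bidual_series(1)[OF C, of "\<lambda>_. 0"] by simp
      have sg': "summable (\<lambda>n. \<bar>blinfun_apply g (u (n + T (Suc j)))\<bar>)"
        using sg by (subst summable_iff_shift[of "\<lambda>n. \<bar>blinfun_apply g (u n)\<bar>"])
      have "(\<Sum>n. h (n + T (Suc j))) + (\<Sum>n<T (Suc j). h n) = blinfun_apply \<Phi> g"
        using suminf_split_initial_segment[of h "T (Suc j)"] hs by (simp add: sums_iff)
      moreover have "(\<Sum>n<T (Suc j). h n) = (\<Sum>n<T j. h n) + blinfun_apply g (u (\<nu> (T j)))"
      proof -
        have "(\<Sum>n<T (Suc j). h n) = (\<Sum>n<T j. h n) + (\<Sum>n\<in>{T j..<T (Suc j)}. h n)"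
          using sum.atLeastLessThan_concat[of 0 "T j" "T (Suc j)" h] Tlt[of j]
          by (simp add: atLeast0LessThan)
        also have "(\<Sum>n\<in>{T j..<T (Suc j)}. h n) = (\<Sum>n\<in>{n \<in> S. T j \<le> n \<and> n < T (Suc j)}. h n)"
          by (intro sum.mono_neutral_right) (auto simp: h_def indicator_def split: if_splits)
        also have "\<dots> = blinfun_apply g (u (\<nu> (T j)))" unfolding S by (simp add: h_def S_def)
        finally show ?thesis .
      qed
      moreover have "\<bar>\<Sum>n<T j. h n\<bar> < e / 4"
      proof -
        have "\<bar>\<Sum>n<T j. h n\<bar> \<le> (\<Sum>n<T j. \<bar>blinfun_apply g (u n)\<bar>)"
          by (rule order_trans[OF sum_abs sum_mono]) (rule habs)
        then show ?thesis using step[of "T j"] by (simp add: g_def)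
      qed
      moreover have "\<bar>\<Sum>n. h (n + T (Suc j))\<bar> < e / 4"
      proof -
        have "\<bar>\<Sum>n. h (n + T (Suc j))\<bar> \<le> (\<Sum>n. \<bar>blinfun_apply g (u (n + T (Suc j)))\<bar>)"
          using norm_suminf_le[OF _ sg', of "\<lambda>n. h (n + T (Suc j))"] habs by simp
        then show ?thesis using step[of "T j"] by (simp add: g_def T)
      qed
      moreover have "e \<le> \<bar>blinfun_apply g (u (\<nu> (T j)))\<bar>" using step[of "T j"] by (simp add: g_def)
      ultimately show ?thesis unfolding g_def by linarith
    qed
    have "filterlim (\<lambda>j. \<kappa> (T j)) at_top sequentially"
    proof (rule filterlim_at_top_mono)
      show "filterlim (\<lambda>j::nat. j) at_top sequentially" by (rule filterlim_ident)
      show "\<forall>\<^sub>F j in sequentially. j \<le> \<kappa> (T j)"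
        using step strict_mono_imp_increasing[OF Tmono] by (intro always_eventually allI) (meson order_trans)
    qed
    then have "(\<lambda>j. blinfun_apply \<Phi> (f (\<kappa> (T j)))) \<longlonglongrightarrow> 0"
      by (rule filterlim_compose[OF wn[unfolded weakly_null_def, rule_format, of \<Phi>]])
    then have "(\<lambda>j. \<bar>blinfun_apply \<Phi> (f (\<kappa> (T j)))\<bar>) \<longlonglongrightarrow> 0" by (simp add: tendsto_rabs_zero_iff)
    then have "e / 2 \<le> 0" using big by (intro LIMSEQ_le_const) auto
    then show False using e(1) by simp
  qed
qed

lemma not_disjoint_null_obtain:
  assumes "\<not> disjoint_null TYPE('a::banach_lattice)"
  obtains x :: "'a::banach_lattice" and u e where "0 < e" "\<And>n::nat. 0 \<le> u n \<and> u n \<le> x"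
    "\<And>m n. m \<noteq> n \<Longrightarrow> disjoint_elems (u m) (u n)" "\<And>n. e \<le> norm (u n)"
proof -
  obtain x :: 'a and v where v: "\<And>n::nat. 0 \<le> v n \<and> v n \<le> x"
    "\<And>m n. m \<noteq> n \<Longrightarrow> disjoint_elems (v m) (v n)" and nl: "\<not> v \<longlonglongrightarrow> 0"
    using assms unfolding disjoint_null_def by blast
  then obtain e where e: "0 < e" "\<And>N. \<exists>n\<ge>N. e \<le> norm (v n)"
    by (auto simp: LIMSEQ_iff not_less)
  define S where "S = {n. e \<le> norm (v n)}"
  have "infinite S" unfolding infinite_nat_iff_unbounded_le using e(2) by (auto simp: S_def)
  then have r: "strict_mono (enumerate S)" "\<And>n. enumerate S n \<in> S"
    using strict_mono_enumerate enumerate_in_set by auto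
  have "e \<le> norm (v (enumerate S n))" for n using r(2)[of n] by (simp add: S_def)
  moreover have "disjoint_elems (v (enumerate S m)) (v (enumerate S n))" if "m \<noteq> n" for m n
    using v(2) that strict_mono_eq[OF r(1)] by simp
  ultimately show thesis using that[of e "v \<circ> enumerate S" x] e(1) v(1) by auto
qed

text \<open>Disjointness gives \<open>\<bar>u m - u n\<bar> \<ge> \<bar>u m\<bar>\<close>, so that the sequence has no Cauchy subsequence.\<close>

lemma not_relatively_compact_disjoint:
  fixes u :: "nat \<Rightarrow> 'a::banach_lattice"
  assumes e: "0 < e" and u: "\<And>m n. m \<noteq> n \<Longrightarrow> disjoint_elems (u m) (u n)" "\<And>n. e \<le> norm (u n)"
  shows "\<not> relatively_compact (range u)"
proof
  assume "relatively_compact (range u)"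
  then have "seq_compact (closure (range u))"
    by (simp add: relatively_compact_def compact_imp_seq_compact)
  moreover have "\<forall>n. u n \<in> closure (range u)" by (intro allI subsetD[OF closure_subset] rangeI)
  ultimately obtain l r where "strict_mono r" "(u \<circ> r) \<longlonglongrightarrow> l"
    unfolding seq_compact_def by blast
  then have "Cauchy (u \<circ> r)" using LIMSEQ_imp_Cauchy by blast
  then obtain M where M: "\<And>m n. M \<le> m \<Longrightarrow> M \<le> n \<Longrightarrow> norm (u (r m) - u (r n)) < e"
    using e unfolding Cauchy_def dist_norm comp_apply by blast
  have ne: "r M \<noteq> r (Suc M)" using strict_mono_eq[OF \<open>strict_mono r\<close>] by simp
  have "\<bar>u (r M) + - u (r (Suc M))\<bar> = \<bar>u (r M)\<bar> + \<bar>- u (r (Suc M))\<bar>"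
    using u(1)[OF ne] by (intro abs_add_disj) (simp add: disj_sym[of "u (r M)"])
  then have "norm (u (r M)) \<le> norm (u (r M) - u (r (Suc M)))" by (intro norm_mono_abs) simp
  then show False using M[of M "Suc M"] u(2)[of "r M"] by simp
qed

lemma weak_p_GP_imp_disjoint_null:
  assumes "2 \<le> p" "weak_p_GP_property p TYPE('a::banach_lattice)"
  shows "disjoint_null TYPE('a)"
proof (rule ccontr)
  assume "\<not> disjoint_null TYPE('a)"
  then obtain x :: 'a and u e where u: "0 < e" "\<And>n::nat. 0 \<le> u n \<and> u n \<le> x"
    "\<And>m n. m \<noteq> n \<Longrightarrow> disjoint_elems (u m) (u n)" "\<And>n. e \<le> norm (u n)"
    by (rule not_disjoint_null_obtain) (rule that)
  have "p_limited p (range u)" by (rule p_limited_disjoint_order_bounded[OF assms(1) u(2,3)])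
  then have "relatively_compact (range u)" using assms(2) by (simp add: weak_p_GP_property_def)
  then show False using not_relatively_compact_disjoint[OF u(1,3,4)] by simp
qed

lemma GP_imp_disjoint_null:
  assumes "grothendieck TYPE('a::banach_lattice)" "GP_property TYPE('a)"
  shows "disjoint_null TYPE('a)"
proof (rule ccontr)
  assume "\<not> disjoint_null TYPE('a)"
  then obtain x :: 'a and u e where u: "0 < e" "\<And>n::nat. 0 \<le> u n \<and> u n \<le> x"
    "\<And>m n. m \<noteq> n \<Longrightarrow> disjoint_elems (u m) (u n)" "\<And>n. e \<le> norm (u n)"
    by (rule not_disjoint_null_obtain) (rule that)
  have "limited (range u)" by (rule limited_disjoint_order_bounded[OF assms(1) u(2,3)])
  then have "relatively_compact (range u)" using assms(2) by (simp add: GP_property_def)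
  then show False using not_relatively_compact_disjoint[OF u(1,3,4)] by simp
qed

section \<open>Convex combinations of pointwise null sequences of continuous functions\<close>

text \<open>The convex hull of the functions \<open>\<phi> k\<close> with \<open>k \<ge> n\<close>.\<close>

definition conv_tails :: "(nat \<Rightarrow> 'b \<Rightarrow> real) \<Rightarrow> nat \<Rightarrow> ('b \<Rightarrow> real) set" where
  "conv_tails \<phi> n = {g. \<exists>l N. (\<forall>k. 0 \<le> l k) \<and> (\<forall>k. l k \<noteq> 0 \<longrightarrow> n \<le> k \<and> k < N) \<and>
     (\<Sum>k<N. l k) = 1 \<and> g = (\<lambda>x. \<Sum>k<N. l k * \<phi> k x)}"

lemma conv_tails_single: "\<phi> n \<in> conv_tails \<phi> n"
  unfolding conv_tails_def mem_Collect_eq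
  by (rule exI[of _ "\<lambda>k. if k = n then 1 else 0"], rule exI[of _ "Suc n"])
     (auto simp: if_distrib[of "\<lambda>c. c * _"] cong: if_cong)

lemma conv_tails_antimono: "m \<le> n \<Longrightarrow> conv_tails \<phi> n \<subseteq> conv_tails \<phi> m"
  unfolding conv_tails_def by (intro Collect_mono ex_mono conj_mono all_mono imp_mono impI) auto

lemma conv_tails_midpoint:
  assumes "g \<in> conv_tails \<phi> n" "h \<in> conv_tails \<phi> n"
  shows "(\<lambda>x. (g x + h x) / 2) \<in> conv_tails \<phi> n"
proof -
  obtain l N where l: "\<And>k. 0 \<le> l k" "\<And>k. l k \<noteq> 0 \<Longrightarrow> n \<le> k \<and> k < N" "(\<Sum>k<N. l k) = 1"
    "g = (\<lambda>x. \<Sum>k<N. l k * \<phi> k x)" using assms(1) by (auto simp: conv_tails_def)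
  obtain l' N' where l': "\<And>k. 0 \<le> l' k" "\<And>k. l' k \<noteq> 0 \<Longrightarrow> n \<le> k \<and> k < N'" "(\<Sum>k<N'. l' k) = 1"
    "h = (\<lambda>x. \<Sum>k<N'. l' k * \<phi> k x)" using assms(2) by (auto simp: conv_tails_def)
  define M where "M = max N N'"
  have ext: "(\<Sum>k<N. l k * c k) = (\<Sum>k<M. l k * c k)" "(\<Sum>k<N'. l' k * c k) = (\<Sum>k<M. l' k * c k)"
    for c :: "nat \<Rightarrow> real"
    using l(2) l'(2) by (auto intro!: sum.mono_neutral_left simp: M_def)
  have eq: "(\<Sum>k<M. (l k + l' k) / 2 * c k) = ((\<Sum>k<N. l k * c k) + (\<Sum>k<N'. l' k * c k)) / 2"
    for c :: "nat \<Rightarrow> real"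
    unfolding ext by (simp add: sum.distrib[symmetric] sum_divide_distrib distrib_right)
  show ?thesis
    unfolding conv_tails_def mem_Collect_eq
  proof (intro exI conjI allI impI)
    show "0 \<le> (l k + l' k) / 2" for k using l(1)[of k] l'(1)[of k] by simp
    show "n \<le> k" "k < M" if "(l k + l' k) / 2 \<noteq> 0" for k
      using that l(2)[of k] l'(2)[of k] by (fastforce simp: M_def)+
    show "(\<Sum>k<M. (l k + l' k) / 2) = 1" using eq[of "\<lambda>_. 1"] l(3) l'(3) by simp
    show "(\<lambda>x. (g x + h x) / 2) = (\<lambda>x. \<Sum>k<M. (l k + l' k) / 2 * \<phi> k x)"
      unfolding eq using l(4) l'(4) by simp
  qed
qed

lemma conv_tails_bounds:
  assumes "g \<in> conv_tails \<phi> n" "\<And>k. n \<le> k \<Longrightarrow> 0 \<le> \<phi> k x \<and> \<phi> k x \<le> c"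
  shows "0 \<le> g x \<and> g x \<le> c"
proof -
  obtain l N where l: "\<And>k. 0 \<le> l k" "\<And>k. l k \<noteq> 0 \<Longrightarrow> n \<le> k \<and> k < N" "(\<Sum>k<N. l k) = 1"
    "g = (\<lambda>x. \<Sum>k<N. l k * \<phi> k x)" using assms(1) by (auto simp: conv_tails_def)
  have t: "0 \<le> l k * \<phi> k x \<and> l k * \<phi> k x \<le> l k * c" for k
    using l(1,2)[of k] assms(2)[of k] by (cases "l k = 0") (auto intro: mult_left_mono)
  have "g x \<le> (\<Sum>k<N. l k * c)" unfolding l(4) using t by (intro sum_mono) auto
  also have "\<dots> = c" using l(3) by (simp add: sum_distrib_right[symmetric])
  finally show ?thesis unfolding l(4) using t by (auto intro: sum_nonneg)
qed

lemma conv_tails_continuous: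
  "g \<in> conv_tails \<phi> n \<Longrightarrow> (\<And>k. continuous_on K (\<phi> k)) \<Longrightarrow> continuous_on K g"
  by (auto simp: conv_tails_def intro!: continuous_intros)

text \<open>The proof follows Simons. Suppose all convex combinations of the tail have supremum above
  \<open>\<delta>\<close>. The \<open>g n\<close> are chosen greedily, so that \<open>w n + 2\<^sup>-\<^sup>n g n\<close> has almost the least possible
  supremum, where \<open>w n = (\<Sum>k<n. 2\<^sup>-\<^sup>k\<^sup>-\<^sup>1 g k)\<close>. The limit \<open>w\<close> of the \<open>w n\<close> competes in this
  minimisation and attains its supremum at some \<open>y\<close>, by compactness. Comparing at \<open>y\<close> gives
  \<open>g n y \<le> r n\<close> up to a small error, where \<open>r n\<close> is the average of the \<open>g k y\<close> for \<open>k \<ge> n\<close>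
  with weights \<open>2\<^sup>n\<^sup>-\<^sup>k\<^sup>-\<^sup>1\<close>. Hence \<open>r\<close> is almost increasing, and \<open>r 0 = w y \<ge> \<delta>\<close> contradicts \<open>\<phi> k y \<longlonglongrightarrow> 0\<close>.\<close>

lemma convex_combination_uniformly_small:
  fixes \<phi> :: "nat \<Rightarrow> 'b::topological_space \<Rightarrow> real"
  assumes K: "compact K" and cont: "\<And>k. continuous_on K (\<phi> k)"
    and bd: "\<And>k x. x \<in> K \<Longrightarrow> 0 \<le> \<phi> k x \<and> \<phi> k x \<le> 1"
    and null: "\<And>x. x \<in> K \<Longrightarrow> (\<lambda>k. \<phi> k x) \<longlonglongrightarrow> 0" and \<delta>: "0 < \<delta>"
  shows "\<exists>g\<in>conv_tails \<phi> m. \<forall>x\<in>K. g x \<le> \<delta>"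
proof (rule ccontr)
  assume "\<not> ?thesis"
  then have big: "\<exists>x\<in>K. \<delta> < g x" if "g \<in> conv_tails \<phi> m" for g
    using that by (meson not_le)
  define co where "co n = conv_tails \<phi> (m + n)" for n
  have co0: "co n \<subseteq> conv_tails \<phi> m" for n unfolding co_def by (rule conv_tails_antimono) simp
  have co_bd: "0 \<le> g x \<and> g x \<le> 1" if "g \<in> co n" "x \<in> K" for g n x
    using conv_tails_bounds[of g \<phi> "m + n" x 1] that bd by (simp add: co_def)
  have Kne: "K \<noteq> {}" using big[OF conv_tails_single] by blast
  define S where "S h = (SUP x\<in>K. h x)" for h :: "'b \<Rightarrow> real"
  have Sle: "S h \<le> c" if "\<And>x. x \<in> K \<Longrightarrow> h x \<le> c" for h c
    unfolding S_def using Kne that by (intro cSUP_least) auto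
  have leS: "h x \<le> S h" if "x \<in> K" "\<And>x. x \<in> K \<Longrightarrow> h x \<le> c" for h x c
    unfolding S_def using that by (intro cSUP_upper bdd_aboveI2[of K h c]) auto
  define \<eta> where "\<eta> n = \<delta> / 4 * (1/4) ^ n" for n
  have \<eta>: "0 < \<eta> n" for n using \<delta> by (simp add: \<eta>_def)
  have greedy: "\<exists>g\<in>co n. \<forall>g'\<in>co n. S (\<lambda>x. w x + (1/2) ^ n * g x) \<le> S (\<lambda>x. w x + (1/2) ^ n * g' x) + \<eta> n"
    if w: "\<And>x. x \<in> K \<Longrightarrow> 0 \<le> w x \<and> w x \<le> 1" for w n
  proof -
    define X where "X = (\<lambda>g. S (\<lambda>x. w x + (1/2) ^ n * g x)) ` co n"
    have Xne: "X \<noteq> {}" using conv_tails_single[of \<phi> "m + n"] by (auto simp: X_def co_def)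
    obtain x0 where x0: "x0 \<in> K" using Kne by blast
    have "0 \<le> S (\<lambda>x. w x + (1/2) ^ n * g x)" if g: "g \<in> co n" for g
    proof -
      have "w x + (1/2) ^ n * g x \<le> 2" if "x \<in> K" for x
      proof -
        have "(1/2) ^ n * g x \<le> 1 * 1" using co_bd[OF g that] by (intro mult_mono power_le_one) auto
        then show ?thesis using w[OF that] by simp
      qed
      then have "w x0 + (1/2) ^ n * g x0 \<le> S (\<lambda>x. w x + (1/2) ^ n * g x)" by (rule leS[OF x0])
      moreover have "0 \<le> w x0 + (1/2) ^ n * g x0" using w[OF x0] co_bd[OF g x0] by simp
      ultimately show ?thesis by linarith
    qed
    then have Xbd: "bdd_below X" by (auto simp: X_def intro!: bdd_belowI2[of _ 0])
    have "Inf X < Inf X + \<eta> n" using \<eta> by simp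
    then obtain s where s: "s \<in> X" "s < Inf X + \<eta> n" using cInf_lessD[OF Xne] by blast
    have "s \<le> s' + \<eta> n" if "s' \<in> X" for s' using cInf_lower[OF that Xbd] s(2) by simp
    then show ?thesis using s(1) unfolding X_def by auto
  qed
  define best where "best n w g \<longleftrightarrow> g \<in> co n \<and> (\<forall>g'\<in>co n.
      S (\<lambda>x. w x + (1/2) ^ n * g x) \<le> S (\<lambda>x. w x + (1/2) ^ n * g' x) + \<eta> n)" for n w g
  define step where "step n w = (SOME g. best n w g)" for n w
  define w where "w = rec_nat (\<lambda>_. 0) (\<lambda>n w x. w x + (1/2) ^ Suc n * step n w x)"
  define g where "g n = step n (w n)" for n
  have w0: "w 0 x = 0" and wS: "w (Suc n) x = w n x + (1/2) ^ Suc n * g n x" for n x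
    by (simp_all add: w_def g_def)
  have stepI: "best n (w n) (g n)" if "\<And>x. x \<in> K \<Longrightarrow> 0 \<le> w n x \<and> w n x \<le> 1" for n
  proof -
    have "\<exists>g. best n (w n) g"
      using greedy[where w = "w n" and n = n, OF that] unfolding best_def Bex_def by simp
    then show ?thesis unfolding g_def step_def by (rule someI_ex)
  qed
  have w_bd: "0 \<le> w n x \<and> w n x \<le> 1 - (1/2) ^ n" if "x \<in> K" for n x
    using that
  proof (induction n arbitrary: x)
    case (Suc n)
    have "0 \<le> w n x \<and> w n x \<le> 1" if "x \<in> K" for x
    proof -
      have "0 < (1/2::real) ^ n" by simp
      then show ?thesis using Suc.IH[OF that] by linarith
    qed
    then have "0 \<le> g n x \<and> g n x \<le> 1" using stepI[of n] co_bd[of "g n" n x] Suc.prems by (simp add: best_def)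
    then have "0 \<le> (1/2) ^ Suc n * g n x" "(1/2) ^ Suc n * g n x \<le> (1/2) ^ Suc n * 1"
      by (auto intro!: mult_nonneg_nonneg mult_left_mono)
    moreover have "(1/2::real) ^ n = (1/2) ^ Suc n * 1 + (1/2) ^ Suc n" by simp
    ultimately show ?case using Suc.IH[OF Suc.prems] wS[of n x] by linarith
  qed (simp add: w0)
  have w_bd1: "0 \<le> w n x \<and> w n x \<le> 1" if "x \<in> K" for n x
  proof -
    have "0 < (1/2::real) ^ n" by simp
    then show ?thesis using w_bd[OF that, of n] by linarith
  qed
  have g_co: "g n \<in> co n"
    and g_min: "\<And>g'. g' \<in> co n \<Longrightarrow>
      S (\<lambda>x. w n x + (1/2) ^ n * g n x) \<le> S (\<lambda>x. w n x + (1/2) ^ n * g' x) + \<eta> n" for n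
    using stepI[of n, OF w_bd1] by (simp_all add: best_def)
  have g_bd: "0 \<le> g n x \<and> g n x \<le> 1" if "x \<in> K" for n x using co_bd[OF g_co that] .
  have w_mono: "w n x \<le> w (n + d) x \<and> w (n + d) x \<le> w n x + ((1/2) ^ n - (1/2) ^ (n + d)) * c"
    if x: "x \<in> K" and c: "\<And>k. n \<le> k \<Longrightarrow> g k x \<le> c" for n d x c
  proof (induction d)
    case (Suc d)
    have "0 \<le> (1/2) ^ Suc (n + d) * g (n + d) x" using g_bd[OF x] by (intro mult_nonneg_nonneg) auto
    moreover have "(1/2) ^ Suc (n + d) * g (n + d) x \<le> (1/2) ^ Suc (n + d) * c"
      using c by (intro mult_left_mono) auto
    moreover have "(1/2) ^ (n + d) * c = 2 * ((1/2) ^ Suc (n + d) * c)" by simp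
    ultimately show ?case
      using Suc wS[of "n + d" x] unfolding left_diff_distrib add_Suc_right by linarith
  qed simp
  \<comment> \<open>\<open>v n\<close> doubles the last summand of \<open>w (n + 1)\<close>, so that its weights add up to one\<close>
  define v where "v n x = w n x + (1/2) ^ n * g n x" for n x
  have v_tail: "\<exists>g'\<in>co n. \<forall>x. v (n + d) x = w n x + (1/2) ^ n * g' x" for n d
  proof (induction d arbitrary: n)
    case 0
    show ?case using g_co by (auto simp: v_def)
  next
    case (Suc d)
    obtain h where h: "h \<in> co (Suc n)" "\<And>x. v (Suc n + d) x = w (Suc n) x + (1/2) ^ Suc n * h x"
      using Suc.IH[of "Suc n"] by blast
    have "h \<in> co n" using h(1) conv_tails_antimono[of "m + n" "m + Suc n" \<phi>] by (auto simp: co_def)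
    then have "(\<lambda>x. (g n x + h x) / 2) \<in> co n"
      using g_co[of n] unfolding co_def by (intro conv_tails_midpoint)
    moreover have "v (n + Suc d) x = w n x + (1/2) ^ n * ((g n x + h x) / 2)" for x
      using h(2)[of x] wS[of n x] by (simp add: field_simps)
    ultimately show ?case by (intro bexI[of _ "\<lambda>x. (g n x + h x) / 2"] allI)
  qed
  \<comment> \<open>\<open>v (n + d)\<close> is admissible in the minimisation that defines \<open>g n\<close>, and tends to \<open>W\<close> with \<open>d\<close>\<close>
  define W where "W x = lim (\<lambda>n. w n x)" for x
  have W: "(\<lambda>n. w n x) \<longlonglongrightarrow> W x" if "x \<in> K" for x
  proof -
    have "incseq (\<lambda>n. w n x)" using g_bd[OF that] by (intro incseq_SucI) (simp add: wS)
    moreover have "bdd_above (range (\<lambda>n. w n x))" using w_bd1[OF that] by (intro bdd_aboveI2) auto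
    ultimately show ?thesis unfolding W_def using LIMSEQ_incseq_SUP limI by metis
  qed
  have W_bd: "w n x \<le> W x \<and> W x \<le> w n x + (1/2) ^ n * c"
    if x: "x \<in> K" and c: "\<And>k. n \<le> k \<Longrightarrow> g k x \<le> c" for n x c
  proof
    have lim: "(\<lambda>d. w (n + d) x) \<longlonglongrightarrow> W x" using LIMSEQ_ignore_initial_segment[OF W[OF x], of n]
      by (simp add: add.commute)
    show "w n x \<le> W x" using w_mono[OF x, where n = n and c = c, OF c] by (intro LIMSEQ_le_const[OF lim]) auto
    have c0: "0 \<le> c" using c[of n] g_bd[OF x, of n] by linarith
    have "w (n + d) x \<le> w n x + (1/2) ^ n * c" for d
    proof -
      have "((1/2) ^ n - (1/2) ^ (n + d)) * c \<le> (1/2) ^ n * c" using c0 by (intro mult_right_mono) auto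
      then show ?thesis using w_mono[OF x, where n = n and c = c and d = d, OF c] by linarith
    qed
    then show "W x \<le> w n x + (1/2) ^ n * c" by (intro LIMSEQ_le_const2[OF lim]) auto
  qed
  have Wcont: "continuous_on K W"
  proof (rule uniform_limit_theorem[where F = sequentially and f = w])
    have "continuous_on K (w n)" for n
    proof (induction n)
      case 0
      have "w 0 = (\<lambda>_. 0)" using w0 by blast
      then show ?case by simp
    next
      case (Suc n)
      have "continuous_on K (g n)" using conv_tails_continuous g_co cont unfolding co_def by blast
      then have "continuous_on K (\<lambda>x. w n x + (1/2) ^ Suc n * g n x)"
        using Suc by (intro continuous_intros)
      then show ?case by (simp add: wS[abs_def])
    qed
    then show "\<forall>\<^sub>F n in sequentially. continuous_on K (w n)" by simp
    show "uniform_limit K w W sequentially"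
      unfolding uniform_limit_iff
    proof (intro allI impI)
      fix e :: real assume "0 < e"
      have "(\<lambda>n. (1/2::real) ^ n) \<longlonglongrightarrow> 0" by (rule LIMSEQ_power_zero) simp
      then have "\<forall>\<^sub>F n in sequentially. (1/2::real) ^ n < e" using \<open>0 < e\<close> by (intro order_tendstoD)
      then show "\<forall>\<^sub>F n in sequentially. \<forall>x\<in>K. dist (w n x) (W x) < e"
      proof eventually_elim
        case (elim n)
        then show ?case using W_bd[of _ n 1] g_bd by (fastforce simp: dist_real_def)
      qed
    qed
  qed simp
  obtain y where y: "y \<in> K" "\<And>x. x \<in> K \<Longrightarrow> W x \<le> W y"
    using continuous_attains_sup[OF K Kne Wcont] by blast
  have v_bd: "v n x \<le> W x + (1/2) ^ n" if "x \<in> K" for n x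
  proof -
    have "(1/2) ^ n * g n x \<le> (1/2) ^ n * 1" using g_bd[OF that] by (intro mult_left_mono) auto
    moreover have "w n x \<le> W x" using W_bd[OF that, where n = n and c = 1] g_bd[OF that] by simp
    ultimately show ?thesis unfolding v_def by linarith
  qed
  have Sv: "S (v n) \<le> W y + (1/2) ^ n" for n
    using v_bd y(2) by (intro Sle) (smt (verit))
  have half0: "(\<lambda>d. c + (1/2::real) ^ (n + d)) \<longlonglongrightarrow> c" for c n
  proof -
    have "(\<lambda>d. c + (1/2::real) ^ n * (1/2) ^ d) \<longlonglongrightarrow> c + (1/2) ^ n * 0"
      by (intro tendsto_intros LIMSEQ_power_zero) simp
    then show ?thesis by (simp add: power_add)
  qed
  have key: "v n y \<le> W y + \<eta> n" for n
  proof -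
    have "S (v n) \<le> W y + \<eta> n + (1/2) ^ (n + d)" for d
    proof -
      obtain g' where g': "g' \<in> co n" "\<And>x. v (n + d) x = w n x + (1/2) ^ n * g' x"
        using v_tail by blast
      have "S (v n) \<le> S (v (n + d)) + \<eta> n" using g_min[OF g'(1)] g'(2) by (simp add: v_def[abs_def])
      then show ?thesis using Sv[of "n + d"] by simp
    qed
    then have "S (v n) \<le> W y + \<eta> n" by (intro LIMSEQ_le_const[OF half0]) auto
    moreover have "v n y \<le> S (v n)"
    proof (rule leS[OF y(1)])
      fix x assume "x \<in> K"
      then show "v n x \<le> W y + (1/2) ^ n" using v_bd y(2) by (smt (verit))
    qed
    ultimately show ?thesis by linarith
  qed
  have Wy: "\<delta> \<le> W y"
  proof -
    have "\<delta> \<le> W y + (1/2) ^ (0 + d)" for d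
    proof -
      obtain g' where g': "g' \<in> co 0" "\<And>x. v (0 + d) x = w 0 x + (1/2) ^ 0 * g' x"
        using v_tail[of 0 d] by blast
      obtain x where x: "x \<in> K" "\<delta> < g' x" using big co0 g'(1) by blast
      have "\<delta> < v d x" using g'(2)[of x] x(2) by (simp add: w0)
      then show ?thesis using v_bd[OF x(1), of d] y(2)[OF x(1)] by simp
    qed
    then show ?thesis by (intro LIMSEQ_le_const[OF half0[of _ 0]]) auto
  qed
  define r where "r n = 2 ^ n * (W y - w n y)" for n
  have r_step: "r n \<le> r (Suc n) + \<delta> / 4 * (1/2) ^ n" for n
  proof -
    have AH: "(2::real) ^ i * ((1/2) ^ i * z) = z" for i z by (simp add: power_one_over)
    have "2 ^ n * (v n y) \<le> 2 ^ n * (W y + \<eta> n)" using key by (intro mult_left_mono) auto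
    moreover have "2 ^ n * (v n y) = 2 ^ n * w n y + g n y" by (simp only: v_def distrib_left AH)
    moreover have "2 ^ n * (W y + \<eta> n) = 2 ^ n * W y + \<delta> / 4 * (1/2) ^ n"
    proof -
      have "(2::real) ^ n * (1/4) ^ n = (1/2) ^ n" by (simp add: power_mult_distrib[symmetric])
      then have "2 ^ n * \<eta> n = \<delta> / 4 * (1/2) ^ n" unfolding \<eta>_def by (metis mult.left_commute)
      then show ?thesis by (simp only: distrib_left)
    qed
    ultimately have "g n y \<le> r n + \<delta> / 4 * (1/2) ^ n" unfolding r_def right_diff_distrib by linarith
    moreover have "2 ^ Suc n * w (Suc n) y = 2 ^ Suc n * w n y + g n y"
      by (simp only: wS distrib_left AH)
    then have "r (Suc n) = 2 * r n - g n y" by (simp add: r_def right_diff_distrib)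
    ultimately show ?thesis by simp
  qed
  have r_low: "r 0 \<le> r n + \<delta> / 2 * (1 - (1/2) ^ n)" for n
  proof (induction n)
    case (Suc n)
    then show ?case using r_step[of n] by (simp add: algebra_simps)
  qed simp
  have "\<forall>\<^sub>F k in sequentially. \<phi> k y < \<delta> / 4"
    using null[OF y(1)] \<delta> by (intro order_tendstoD) auto
  then obtain n where n: "\<And>k. n \<le> k \<Longrightarrow> \<phi> k y < \<delta> / 4" by (auto simp: eventually_sequentially)
  have "g k y \<le> \<delta> / 4" if "n \<le> k" for k
  proof -
    have "0 \<le> g k y \<and> g k y \<le> \<delta> / 4"
    proof (rule conv_tails_bounds[where g = "g k" and \<phi> = \<phi> and n = "m + k"])
      show "g k \<in> conv_tails \<phi> (m + k)" using g_co[of k] by (simp add: co_def)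
      show "0 \<le> \<phi> j y \<and> \<phi> j y \<le> \<delta> / 4" if "m + k \<le> j" for j
        using bd[OF y(1), of j] n[of j] that \<open>n \<le> k\<close> by simp
    qed
    then show ?thesis by simp
  qed
  then have "W y \<le> w n y + (1/2) ^ n * (\<delta> / 4)" using W_bd[OF y(1)] by blast
  then have "2 ^ n * (W y - w n y) \<le> 2 ^ n * ((1/2) ^ n * (\<delta> / 4))" by (intro mult_left_mono) auto
  then have "r n \<le> \<delta> / 4" by (simp add: r_def power_one_over)
  moreover have "\<delta> \<le> r 0" using Wy by (simp add: r_def w0)
  moreover have "\<delta> / 2 * (1 - (1/2) ^ n) \<le> \<delta> / 2 * 1" using \<delta> by (intro mult_left_mono) auto
  ultimately show False using r_low[of n] \<delta> by linarith
qed

section \<open>Divergent weights along disjoint blocks of atoms\<close>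

text \<open>The closure of the unit ball for coordinatewise convergence. Its elements are families of
  coefficients, which makes compactness a consequence of Tychonoff's theorem.\<close>

definition coeff_ball :: "('a::banach_lattice \<Rightarrow> real) set" where
  "coeff_ball = {z. (\<forall>F. finite F \<and> F \<subseteq> atoms \<longrightarrow> norm (\<Sum>a\<in>F. z a *\<^sub>R a) \<le> 1) \<and>
     (\<forall>a. a \<notin> atoms \<longrightarrow> z a = 0)}"

lemma continuous_on_coeff_sum:
  "continuous_on S (\<lambda>z::'a::banach_lattice \<Rightarrow> real. \<Sum>a\<in>F. z a *\<^sub>R a)"
proof -
  have "continuous_on S (\<lambda>z::'a \<Rightarrow> real. z a)" for a
    by (rule continuous_on_subset[OF continuous_on_product_coordinates]) simp
  then show ?thesis by (intro continuous_intros)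
qed

lemma compact_coeff_ball: "compact (coeff_ball :: ('a::banach_lattice \<Rightarrow> real) set)"
proof -
  have "compactin (product_topology (\<lambda>_::'a. euclidean) UNIV) (PiE UNIV (\<lambda>_. {-1..1::real}))"
    by (simp add: compactin_PiE)
  then have box: "compact (PiE UNIV (\<lambda>_::'a. {-1..1::real}))"
    by (simp add: euclidean_product_topology)
  have "coeff_ball \<subseteq> PiE UNIV (\<lambda>_::'a. {-1..1::real})"
  proof
    fix z :: "'a \<Rightarrow> real" assume z: "z \<in> coeff_ball"
    have "\<bar>z a\<bar> \<le> 1" for a
    proof (cases "a \<in> atoms")
      case True
      then have "norm (\<Sum>b\<in>{a}. z b *\<^sub>R b) \<le> 1" using z unfolding coeff_ball_def by blast
      then show ?thesis using atoms_norm[OF True] by simp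
    qed (use z in \<open>auto simp: coeff_ball_def\<close>)
    then show "z \<in> PiE UNIV (\<lambda>_::'a. {-1..1::real})" by (auto simp: abs_le_iff minus_le_iff)
  qed
  moreover have "closed (coeff_ball :: ('a \<Rightarrow> real) set)"
  proof -
    have *: "coeff_ball = (\<Inter>F\<in>{F. finite F \<and> F \<subseteq> atoms}. {z::'a \<Rightarrow> real. norm (\<Sum>a\<in>F. z a *\<^sub>R a) \<le> 1})
        \<inter> (\<Inter>a\<in>- atoms. {z. z a = 0})" by (auto simp: coeff_ball_def)
    show ?thesis
      unfolding * by (intro closed_Int closed_INT ballI closed_Collect_le closed_Collect_eq
          continuous_on_norm continuous_on_coeff_sum continuous_on_const continuous_on_product_coordinates)
  qed
  ultimately show ?thesis using compact_Int_closed[OF box] by (metis inf.absorb2)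
qed

lemma sum_UN_blocks:
  assumes "\<And>n::nat. finite (G n)" "\<And>m n. m \<noteq> n \<Longrightarrow> G m \<inter> G n = {}"
  shows "(\<Sum>n<N. \<Sum>a\<in>G n. h a) = sum h (\<Union>n<N. G n)"
  by (rule sum.UNION_disjoint[symmetric]) (use assms in auto)

text \<open>A bounded family of formal sums defines the functional \<open>f \<mapsto> (\<Sum>n. f (u n))\<close> on the dual, where
  \<open>u n\<close> is the \<open>n\<close>-th block. Norming functionals of the blocks are weak* null by order continuity,
  hence weakly null, and the functional takes the value \<open>norm (u n)\<close> at them.\<close>

lemma coeff_blocks_null:
  fixes z :: "'a::banach_lattice \<Rightarrow> real"
  assumes oc: "disjoint_null TYPE('a)" and gr: "grothendieck TYPE('a)" and z: "z \<in> coeff_ball"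
    and G: "\<And>n::nat. finite (G n)" "\<And>n. G n \<subseteq> atoms" "\<And>m n. m \<noteq> n \<Longrightarrow> G m \<inter> G n = {}"
  shows "(\<lambda>n. norm (\<Sum>a\<in>G n. z a *\<^sub>R a)) \<longlonglongrightarrow> 0"
proof -
  define u where "u n = (\<Sum>a\<in>G n. z a *\<^sub>R a)" for n
  have "\<forall>n. \<exists>g :: 'a dual. norm g \<le> 1 \<and> blinfun_apply g (u n) = norm (u n)"
    using norming_functional by metis
  then obtain g :: "nat \<Rightarrow> 'a dual" where g: "\<And>n. norm (g n) \<le> 1" "\<And>n. blinfun_apply (g n) (u n) = norm (u n)"
    by metis
  define f where "f n = restr (G n) (g n)" for n
  have "weak_star_null f"
    unfolding weak_star_null_def
  proof
    fix x
    have "\<bar>blinfun_apply (f n) x\<bar> \<le> norm (proj (G n) x)" for n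
    proof -
      have "\<bar>blinfun_apply (f n) x\<bar> \<le> norm (g n) * norm (proj (G n) x)"
        using norm_blinfun[of "g n" "proj (G n) x"] by (simp add: f_def restr_apply[OF G(1,2)])
      also have "\<dots> \<le> 1 * norm (proj (G n) x)" using g(1) by (intro mult_right_mono) auto
      finally show ?thesis by simp
    qed
    then show "(\<lambda>n. blinfun_apply (f n) x) \<longlonglongrightarrow> 0"
      by (intro Lim_null_comparison[OF always_eventually tendsto_norm_zero[OF proj_null[OF oc G]]]) auto
  qed
  then have wn: "weakly_null f" using gr by (simp add: grothendieck_def)
  have "(\<Sum>n<N. \<bar>blinfun_apply (h :: 'a dual) (u n)\<bar>) \<le> norm h * 1" for h N
  proof -
    have "(\<Sum>n<N. \<bar>blinfun_apply h (u n)\<bar>) \<le> norm h * norm (\<Sum>n<N. u n)"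
      unfolding u_def by (intro blinfun_sum_abs_le disj_sum_atoms G) auto
    also have "(\<Sum>n<N. u n) = (\<Sum>a\<in>(\<Union>n<N. G n). z a *\<^sub>R a)"
      unfolding u_def by (rule sum_UN_blocks[OF G(1,3)])
    also have "norm h * norm (\<Sum>a\<in>(\<Union>n<N. G n). z a *\<^sub>R a) \<le> norm h * 1"
    proof (rule mult_left_mono)
      have "finite (\<Union>n<N. G n) \<and> (\<Union>n<N. G n) \<subseteq> atoms" using G(1,2) by auto
      then show "norm (\<Sum>a\<in>(\<Union>n<N. G n). z a *\<^sub>R a) \<le> 1" using z unfolding coeff_ball_def by blast
    qed simp
    finally show ?thesis .
  qed
  from bidual_series(2)[OF this, of "\<lambda>_. 1"] obtain \<Phi> :: "'a dual dual"
    where \<Phi>: "\<And>h. (\<lambda>n. blinfun_apply h (u n)) sums blinfun_apply \<Phi> h" by auto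
  have "blinfun_apply \<Phi> (f m) = norm (u m)" for m
  proof -
    have "blinfun_apply (f m) (u n) = (if n = m then norm (u m) else 0)" for n
    proof (cases "n = m")
      case True
      have "proj (G m) (u m) = u m" unfolding u_def by (simp add: proj_sum_atoms G)
      then show ?thesis using True g(2) by (simp add: f_def restr_apply[OF G(1,2)])
    next
      case False
      then have "proj (G m) (u n) = 0" unfolding u_def by (simp add: proj_sum_atoms G)
      then show ?thesis using False by (simp add: f_def restr_apply[OF G(1,2)] blinfun.zero_right)
    qed
    then have "(\<lambda>n. blinfun_apply (f m) (u n)) sums norm (u m)"
      using sums_single[of m "\<lambda>_. norm (u m)"] by simp
    then show ?thesis using \<Phi>[of "f m"] sums_unique2 by blast
  qed
  then show ?thesis using wn[unfolded weakly_null_def, rule_format, of \<Phi>] by (simp add: u_def)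
qed

lemma block_weights_finite:
  fixes G :: "nat \<Rightarrow> 'a::banach_lattice set"
  assumes oc: "disjoint_null TYPE('a)" and gr: "grothendieck TYPE('a)" and p: "1 \<le> p"
    and G: "\<And>n. finite (G n)" "\<And>n. G n \<subseteq> atoms" "\<And>m n. m \<noteq> n \<Longrightarrow> G m \<inter> G n = {}"
    and \<delta>: "0 < \<delta>"
  shows "\<exists>l N. m < N \<and> (\<forall>k. 0 \<le> l k) \<and> (\<Sum>k\<in>{m..<N}. l k) = 1 \<and>
    (\<forall>x. (\<Sum>k\<in>{m..<N}. l k * norm (proj (G k) x) powr p) \<le> \<delta> * norm x powr p)"
proof -
  define \<phi> where "\<phi> n z = norm (\<Sum>a\<in>G n. z a *\<^sub>R a) powr p" for n and z :: "'a \<Rightarrow> real"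
  have "\<exists>g\<in>conv_tails \<phi> m. \<forall>z\<in>coeff_ball. g z \<le> \<delta>"
  proof (rule convex_combination_uniformly_small[OF compact_coeff_ball _ _ _ \<delta>])
    show "continuous_on coeff_ball (\<phi> k)" for k
      unfolding \<phi>_def using p by (intro continuous_on_powr' continuous_on_norm continuous_on_coeff_sum) auto
    show "0 \<le> \<phi> k z \<and> \<phi> k z \<le> 1" if "z \<in> coeff_ball" for k z
      using that G p unfolding coeff_ball_def \<phi>_def by (auto intro!: powr_le1)
    show "(\<lambda>k. \<phi> k z) \<longlonglongrightarrow> 0" if "z \<in> coeff_ball" for z
      unfolding \<phi>_def using coeff_blocks_null[OF oc gr that G] p
      by (intro tendsto_zero_powrI[OF _ tendsto_const]) auto
  qed
  then obtain l N where l: "\<And>k. 0 \<le> l k" "\<And>k. l k \<noteq> 0 \<Longrightarrow> m \<le> k \<and> k < N" "(\<Sum>k<N. l k) = 1"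
    "\<And>z. z \<in> coeff_ball \<Longrightarrow> (\<Sum>k<N. l k * \<phi> k z) \<le> \<delta>"
    unfolding conv_tails_def by auto
  have "l k = 0" if "k < m" for k using l(2)[of k] that by fastforce
  then have eq: "(\<Sum>k\<in>{m..<N}. l k * c k) = (\<Sum>k<N. l k * c k)" for c :: "nat \<Rightarrow> real"
    by (intro sum.mono_neutral_left) auto
  have "(\<Sum>k\<in>{m..<N}. l k * norm (proj (G k) x) powr p) \<le> \<delta> * norm x powr p" for x
  proof (cases "x = 0")
    case True
    then show ?thesis using G by (simp add: linear_0[OF linear_proj])
  next
    case False
    define z where "z a = (if a \<in> atoms then coord a ((1 / norm x) *\<^sub>R x) else 0)" for a
    have zF: "(\<Sum>a\<in>F. z a *\<^sub>R a) = (1 / norm x) *\<^sub>R proj F x" if "F \<subseteq> atoms" for F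
    proof -
      have "(\<Sum>a\<in>F. z a *\<^sub>R a) = proj F ((1 / norm x) *\<^sub>R x)"
        unfolding proj_def using that by (intro sum.cong) (auto simp: z_def)
      then show ?thesis by (simp add: linear_scale[OF linear_proj[OF that]])
    qed
    have "z \<in> coeff_ball"
      unfolding coeff_ball_def
      using zF norm_proj_le[of _ x] False by (auto simp: z_def divide_le_eq)
    have "(\<Sum>k\<in>{m..<N}. l k * norm (proj (G k) x) powr p) = norm x powr p * (\<Sum>k<N. l k * \<phi> k z)"
    proof -
      have "norm (proj (G k) x) powr p = norm x powr p * \<phi> k z" for k
        using False by (simp add: \<phi>_def zF[OF G(2)] powr_divide)
      then show ?thesis unfolding eq by (simp add: sum_distrib_left mult.left_commute)
    qed
    also have "\<dots> \<le> norm x powr p * \<delta>" using l(4)[OF \<open>z \<in> coeff_ball\<close>] by (intro mult_left_mono) auto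
    finally show ?thesis by (simp add: mult.commute)
  qed
  moreover have "(\<Sum>k\<in>{m..<N}. l k) = 1" using eq[of "\<lambda>_. 1"] l(3) by simp
  moreover have "m < N"
  proof (rule ccontr)
    assume "\<not> m < N"
    then show False using \<open>(\<Sum>k\<in>{m..<N}. l k) = 1\<close> by simp
  qed
  ultimately show ?thesis using l(1) by blast
qed

text \<open>Concatenating finite convex weights for \<open>\<delta> = 2\<^sup>-\<^sup>j\<close>: each block of indices contributes \<open>1\<close> to the
  sum of the weights and at most \<open>2\<^sup>-\<^sup>j\<close> to the weighted sum at a unit vector.\<close>

lemma block_weights:
  fixes G :: "nat \<Rightarrow> 'a::banach_lattice set"
  assumes oc: "disjoint_null TYPE('a)" and gr: "grothendieck TYPE('a)" and p: "1 \<le> p"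
    and G: "\<And>n. finite (G n)" "\<And>n. G n \<subseteq> atoms" "\<And>m n. m \<noteq> n \<Longrightarrow> G m \<inter> G n = {}"
  obtains t where "\<And>n. 0 \<le> t n" "\<not> summable t"
    "\<And>x. summable (\<lambda>n. t n * norm (proj (G n) x) powr p)"
proof -
  define good where "good m j l N \<longleftrightarrow> m < N \<and> (\<forall>k. 0 \<le> l k) \<and> (\<Sum>k\<in>{m..<N}. l k) = 1 \<and>
    (\<forall>x. (\<Sum>k\<in>{m..<N}. l k * norm (proj (G k) x) powr p) \<le> (1/2) ^ j * norm x powr p)"
    for m j N :: nat and l :: "nat \<Rightarrow> real"
  have "\<exists>l N. good m j l N" for m j
    unfolding good_def by (rule block_weights_finite[OF oc gr p G]) auto
  then obtain l \<tau> where "\<And>m j. good m j (l m j) (\<tau> m j)" by metis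
  then have l: "\<And>m j. m < \<tau> m j" "\<And>m j k. 0 \<le> l m j k"
      "\<And>m j. (\<Sum>k\<in>{m..<\<tau> m j}. l m j k) = 1"
      "\<And>m j x. (\<Sum>k\<in>{m..<\<tau> m j}. l m j k * norm (proj (G k) x) powr p) \<le> (1/2) ^ j * norm x powr p"
    unfolding good_def by blast+
  define T where "T = rec_nat 0 (\<lambda>j m. \<tau> m j)"
  have T: "T 0 = 0" "\<And>j. T (Suc j) = \<tau> (T j) j" by (simp_all add: T_def)
  have Tm: "strict_mono T" using l(1) by (simp add: strict_mono_Suc_iff T)
  define t where "t n = (\<Sum>j\<in>{j. j \<le> n \<and> T j \<le> n \<and> n < T (Suc j)}. l (T j) j n)" for n
  have tj: "t n = l (T j) j n" if "T j \<le> n" "n < T (Suc j)" for n j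
  proof -
    have "i = j" if "T i \<le> n" "n < T (Suc i)" for i
    proof (rule ccontr)
      assume "i \<noteq> j"
      then have "Suc i \<le> j \<or> Suc j \<le> i" by auto
      then have "T (Suc i) \<le> T j \<or> T (Suc j) \<le> T i" using strict_mono_less_eq[OF Tm] by blast
      then show False using that \<open>T j \<le> n\<close> \<open>n < T (Suc j)\<close> by auto
    qed
    moreover have "j \<le> n" using strict_mono_imp_increasing[OF Tm, of j] that by simp
    ultimately have "{j. j \<le> n \<and> T j \<le> n \<and> n < T (Suc j)} = {j}" using that by blast
    then show ?thesis by (simp add: t_def)
  qed
  have t0: "0 \<le> t n" for n unfolding t_def by (intro sum_nonneg l(2))
  have split: "(\<Sum>n<T m. t n * c n) = (\<Sum>j<m. \<Sum>n\<in>{T j..<T (Suc j)}. l (T j) j n * c n)" for m c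
  proof (induction m)
    case (Suc m)
    have "(\<Sum>n<T (Suc m). t n * c n) = (\<Sum>n<T m. t n * c n) + (\<Sum>n\<in>{T m..<T (Suc m)}. t n * c n)"
      using sum.atLeastLessThan_concat[of 0 "T m" "T (Suc m)" "\<lambda>n. t n * c n"]
        strict_mono_less_eq[OF Tm, of m "Suc m"] by (simp add: atLeast0LessThan)
    also have "(\<Sum>n\<in>{T m..<T (Suc m)}. t n * c n) = (\<Sum>n\<in>{T m..<T (Suc m)}. l (T m) m n * c n)"
      by (intro sum.cong) (auto simp: tj)
    finally show ?case using Suc by simp
  qed (simp add: T)
  have "\<not> summable t"
  proof
    assume s: "summable t"
    have "real m \<le> suminf t" for m
      using split[where m = m and c = "\<lambda>_. 1"] l(3) sum_le_suminf[OF s, of "{..<T m}"] t0 by (simp add: T)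
    then show False using reals_Archimedean2 not_le by blast
  qed
  moreover have "summable (\<lambda>n. t n * norm (proj (G n) x) powr p)" for x
  proof (rule summableI_nonneg_bounded)
    show "0 \<le> t n * norm (proj (G n) x) powr p" for n using t0 by simp
    fix m
    have "(\<Sum>n<m. t n * norm (proj (G n) x) powr p) \<le> (\<Sum>n<T m. t n * norm (proj (G n) x) powr p)"
      using strict_mono_imp_increasing[OF Tm, of m] t0 by (intro sum_mono2) auto
    also have "\<dots> \<le> (\<Sum>j<m. (1/2) ^ j * norm x powr p)"
      unfolding split using l(4) by (intro sum_mono) (simp add: T)
    also have "\<dots> = (\<Sum>j<m. (1/2) ^ j) * norm x powr p" by (simp add: sum_distrib_right)
    also have "\<dots> \<le> 2 * norm x powr p"
      using sum_le_suminf[OF summable_geometric[of "1/2::real"], of "{..<m}"]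
      by (intro mult_right_mono) (auto simp: suminf_geometric)
    finally show "(\<Sum>n<m. t n * norm (proj (G n) x) powr p) \<le> 2 * norm x powr p" .
  qed
  ultimately show thesis using t0 that by blast
qed

section \<open>Almost limited and almost \<open>p\<close>-limited sets\<close>

text \<open>If \<open>x - P\<^sub>F x\<close> is large for some \<open>x\<close> in \<open>A\<close>, the convergent expansion of this \<open>x\<close> provides a
  finite set of further atoms that carries more than half of the remainder.\<close>

lemma blocks_of_not_uniform:
  fixes A :: "'a::banach_lattice set"
  assumes oc: "disjoint_null TYPE('a)" and disc: "discrete_lattice TYPE('a)" and e: "0 < e"
    and not: "\<not> (\<exists>F. finite F \<and> F \<subseteq> atoms \<and> (\<forall>x\<in>A. norm (x - proj F x) < e))"
  obtains G x and g :: "nat \<Rightarrow> 'a dual" where "\<And>n. finite (G n)" "\<And>n. G n \<subseteq> atoms"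
    "\<And>m n. m \<noteq> n \<Longrightarrow> G m \<inter> G n = {}" "\<And>n::nat. x n \<in> A" "\<And>n. norm (g n) \<le> 1"
    "\<And>n. e / 2 \<le> blinfun_apply (g n) (proj (G n) (x n))"
proof -
  define Q where "Q G y \<longleftrightarrow> fst y \<in> A \<and> norm (snd y) \<le> 1 \<and>
    e / 2 \<le> blinfun_apply (snd y) (proj G (fst y))" for G and y :: "'a \<times> 'a dual"
  have "\<exists>G y. finite G \<and> G \<subseteq> atoms \<and> G \<inter> F = {} \<and> Q G y" if F: "finite F" "F \<subseteq> atoms" for F
  proof -
    obtain x where x: "x \<in> A" "e \<le> norm (x - proj F x)" using not F by (meson not_le)
    obtain F' where F': "finite F'" "F' \<subseteq> atoms" "norm (x - proj F' x) < e / 2"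
      using atomic_expansion[OF oc disc, of "e / 2"] e by auto
    define H where "H = F \<union> F'"
    have H: "finite H" "H \<subseteq> atoms" "F \<subseteq> H" "F' \<subseteq> H" using F F' by (auto simp: H_def)
    have small: "norm (x - proj H x) < e / 2"
      using norm_remainder_antimono[OF H(1,2,4), of x] F'(3) by simp
    have "proj (H - F) x = (x - proj F x) - (x - proj H x)"
      using proj_diff_subset[OF H(1,3), of x] by simp
    then have "norm (x - proj F x) - norm (x - proj H x) \<le> norm (proj (H - F) x)"
      by (metis norm_triangle_ineq2)
    then have large: "e / 2 \<le> norm (proj (H - F) x)" using small x(2) by simp
    obtain g :: "'a dual" where g: "norm g \<le> 1" "blinfun_apply g (proj (H - F) x) = norm (proj (H - F) x)"
      by (rule norming_functional)
    have "Q (H - F) (x, g)" using x(1) g large by (simp add: Q_def)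
    moreover have "finite (H - F)" "H - F \<subseteq> atoms" "(H - F) \<inter> F = {}" using H by auto
    ultimately show ?thesis by blast
  qed
  then obtain G y where G: "\<And>n::nat. finite (G n)" "\<And>n. G n \<subseteq> atoms" "\<And>n. Q (G n) (y n)"
      "\<And>m n. m \<noteq> n \<Longrightarrow> G m \<inter> G n = {}"
    using disjoint_sequence_choice[of atoms Q] by metis
  show thesis
    by (rule that[of G "\<lambda>n. fst (y n)" "\<lambda>n. snd (y n)"]) (use G in \<open>auto simp: Q_def\<close>)
qed

lemma abs_restr_le:
  assumes "finite G" "G \<subseteq> atoms" "norm g \<le> 1"
  shows "\<bar>blinfun_apply (restr G g) x\<bar> \<le> norm (proj G x)"
proof -
  have "\<bar>blinfun_apply (restr G g) x\<bar> \<le> norm g * norm (proj G x)"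
    using norm_blinfun[of g "proj G x"] by (simp add: restr_apply[OF assms(1,2)])
  also have "\<dots> \<le> 1 * norm (proj G x)" using assms(3) by (intro mult_right_mono) auto
  finally show ?thesis by simp
qed

text \<open>The block functionals are disjoint, and weak* null by order continuity.\<close>

theorem almost_limited_imp_relatively_compact:
  fixes A :: "'a::banach_lattice set"
  assumes oc: "disjoint_null TYPE('a)" and disc: "discrete_lattice TYPE('a)" and A: "almost_limited A"
  shows "relatively_compact A"
proof (rule relatively_compact_atomic)
  fix a :: 'a assume a: "a \<in> atoms"
  obtain B where "\<And>x. x \<in> A \<Longrightarrow> norm x \<le> B" using A by (auto simp: almost_limited_def bounded_iff)
  then show "\<exists>C. \<forall>x\<in>A. \<bar>coord a x\<bar> \<le> C" using abs_coord_le_norm[OF a] order_trans by blast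
next
  fix e :: real assume e: "0 < e"
  show "\<exists>F. finite F \<and> F \<subseteq> atoms \<and> (\<forall>x\<in>A. norm (x - proj F x) < e)"
  proof (rule ccontr)
    assume not: "\<not> ?thesis"
    obtain G x and g :: "nat \<Rightarrow> 'a dual" where G: "\<And>n. finite (G n)" "\<And>n. G n \<subseteq> atoms"
        "\<And>m n. m \<noteq> n \<Longrightarrow> G m \<inter> G n = {}" and x: "\<And>n::nat. x n \<in> A" and g: "\<And>n. norm (g n) \<le> 1"
        "\<And>n. e / 2 \<le> blinfun_apply (g n) (proj (G n) (x n))"
      by (rule blocks_of_not_uniform[OF oc disc e not]) (rule that)
    define f where "f n = restr (G n) (g n)" for n
    have "pairwise_disjoint_seq f"
      unfolding pairwise_disjoint_seq_def f_def by (intro allI impI dual_disjoint_restr G)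
    moreover have "weak_star_null f"
      unfolding weak_star_null_def f_def
      using abs_restr_le[OF G(1,2) g(1)]
      by (intro allI Lim_null_comparison[OF always_eventually tendsto_norm_zero[OF proj_null[OF oc G]]]) auto
    ultimately have "uniform_limit A (\<lambda>n. blinfun_apply (f n)) (\<lambda>_. 0) sequentially"
      using A by (simp add: almost_limited_def)
    from uniform_limitD[OF this, of "e / 2"]
    have "\<forall>\<^sub>F n in sequentially. \<forall>x\<in>A. \<bar>blinfun_apply (f n) x\<bar> < e / 2"
      using e by (simp add: dist_real_def)
    then obtain n where "\<bar>blinfun_apply (f n) (x n)\<bar> < e / 2"
      using x by (auto simp: eventually_sequentially)
    then show False using g(2)[of n] by (simp add: f_def restr_apply[OF G(1,2)])
  qed
qed

text \<open>Here the block functionals are multiplied by the \<open>p\<close>-th roots of divergent weights for which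
  they are still weak* \<open>p\<close>-summable.\<close>

theorem almost_p_limited_imp_relatively_compact:
  fixes A :: "'a::banach_lattice set"
  assumes oc: "disjoint_null TYPE('a)" and disc: "discrete_lattice TYPE('a)"
    and gr: "grothendieck TYPE('a)" and p: "1 \<le> p" and A: "almost_p_limited p A"
  shows "relatively_compact A"
    and "0 < e \<Longrightarrow> \<exists>F. finite F \<and> F \<subseteq> atoms \<and> (\<forall>x\<in>A. norm (x - proj F x) < e)"
proof -
  have dominated: "\<exists>a\<in>ell p. \<forall>x\<in>A. \<forall>n. \<bar>blinfun_apply (restr (G n) (g n)) x\<bar> \<le> a n"
    if "\<And>n. finite (G n)" "\<And>n. G n \<subseteq> atoms" "\<forall>m n. m \<noteq> n \<longrightarrow> G m \<inter> G n = {}"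
      "\<And>x. summable (\<lambda>n. \<bar>blinfun_apply (restr (G n) (g n)) x\<bar> powr p)"
    for G and g :: "nat \<Rightarrow> 'a dual"
  proof -
    have "pairwise_disjoint_seq (\<lambda>n. restr (G n) (g n))"
      unfolding pairwise_disjoint_seq_def by (intro allI impI dual_disjoint_restr that(1,2) that(3)[rule_format])
    then show ?thesis
      using A that(4) unfolding almost_p_limited_def weak_star_p_summable_def ell_def by simp
  qed
  show tail: "\<exists>F. finite F \<and> F \<subseteq> atoms \<and> (\<forall>x\<in>A. norm (x - proj F x) < e)" if e: "0 < e" for e
  proof (rule ccontr)
    assume not: "\<not> ?thesis"
    obtain G x and g :: "nat \<Rightarrow> 'a dual" where G: "\<And>n. finite (G n)" "\<And>n. G n \<subseteq> atoms"
        "\<And>m n. m \<noteq> n \<Longrightarrow> G m \<inter> G n = {}" and x: "\<And>n::nat. x n \<in> A" and g: "\<And>n. norm (g n) \<le> 1"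
        "\<And>n. e / 2 \<le> blinfun_apply (g n) (proj (G n) (x n))"
      by (rule blocks_of_not_uniform[OF oc disc e not]) (rule that)
    obtain t where t: "\<And>n. 0 \<le> t n" "\<not> summable t"
        "\<And>x. summable (\<lambda>n. t n * norm (proj (G n) x) powr p)"
      by (rule block_weights[where G = G, OF oc gr p G(1,2)]) (erule G(3), rule that)
    define h where "h n = (t n powr (1 / p)) *\<^sub>R g n" for n
    have root: "(t n powr (1 / p)) powr p = t n" for n using t(1)[of n] p by (simp add: powr_powr)
    have hx: "\<bar>blinfun_apply (restr (G n) (h n)) y\<bar> powr p
        = t n * \<bar>blinfun_apply (restr (G n) (g n)) y\<bar> powr p" for n y
      by (simp add: h_def restr_apply[OF G(1,2)] blinfun.scaleR_left abs_mult powr_mult root)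
    have "summable (\<lambda>n. \<bar>blinfun_apply (restr (G n) (h n)) y\<bar> powr p)" for y
      using t(1) abs_restr_le[OF G(1,2) g(1)] p unfolding hx
      by (intro summable_comparison_test'[OF t(3)[of y], of 0]) (auto intro!: mult_left_mono powr_mono2)
    then obtain a where a: "a \<in> ell p" "\<And>y n. y \<in> A \<Longrightarrow> \<bar>blinfun_apply (restr (G n) (h n)) y\<bar> \<le> a n"
      using dominated[where G = G and g = h] G by blast
    have le: "t n * (e / 2) powr p \<le> \<bar>a n\<bar> powr p" for n
    proof -
      have "t n * (e / 2) powr p \<le> t n * \<bar>blinfun_apply (restr (G n) (g n)) (x n)\<bar> powr p"
        using t(1) e p g(2)[of n] by (intro mult_left_mono powr_mono2) (auto simp: restr_apply[OF G(1,2)])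
      also have "\<dots> = \<bar>blinfun_apply (restr (G n) (h n)) (x n)\<bar> powr p" by (simp add: hx)
      also have "\<dots> \<le> \<bar>a n\<bar> powr p" using a(2)[OF x, of n n] p by (intro powr_mono2) auto
      finally show ?thesis .
    qed
    have "summable (\<lambda>n. \<bar>a n\<bar> powr p)" using a(1) by (simp add: ell_def)
    then have "summable (\<lambda>n. t n * (e / 2) powr p)"
    proof (rule summable_comparison_test')
      show "norm (t n * (e / 2) powr p) \<le> \<bar>a n\<bar> powr p" if "0 \<le> n" for n
        using le[of n] t(1)[of n] by (simp only: real_norm_def abs_mult abs_of_nonneg powr_ge_zero)
    qed
    then have "summable (\<lambda>n. t n * (e / 2) powr p * inverse ((e / 2) powr p))" by (rule summable_mult2)
    moreover have "(e / 2) powr p \<noteq> 0" using e by simp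
    then have "t n * (e / 2) powr p * inverse ((e / 2) powr p) = t n" for n
      by (metis mult.assoc mult.right_neutral right_inverse)
    ultimately have "summable t" by simp
    then show False using t(2) by blast
  qed
  show "relatively_compact A"
  proof (rule relatively_compact_atomic)
    fix b :: 'a assume b: "b \<in> atoms"
    obtain g :: "'a dual" where g: "blinfun_apply g b = norm b" using norming_functional by metis
    define G where "G n = (if n = 0 then {b} else {})" for n :: nat
    have G: "\<And>n. finite (G n)" "\<And>n. G n \<subseteq> atoms" "\<And>m n. m \<noteq> n \<Longrightarrow> G m \<inter> G n = {}"
      using b by (auto simp: G_def)
    have 0: "blinfun_apply (restr (G 0) g) x = coord b x" for x
      unfolding restr_apply[OF G(1,2)] using g atoms_norm[OF b] by (simp add: G_def blinfun_proj)
    have "blinfun_apply (restr (G n) g) x = 0" if "n \<noteq> 0" for n x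
      unfolding restr_apply[OF G(1,2)] using that by (simp add: G_def blinfun_proj)
    then have "summable (\<lambda>n. \<bar>blinfun_apply (restr (G n) g) x\<bar> powr p)" for x
      by (intro summable_finite[of "{0}"]) auto
    then obtain a where "\<And>x n. x \<in> A \<Longrightarrow> \<bar>blinfun_apply (restr (G n) g) x\<bar> \<le> a n"
      using dominated[where G = G and g = "\<lambda>_. g"] G by blast
    then show "\<exists>C. \<forall>x\<in>A. \<bar>coord b x\<bar> \<le> C" using 0 by metis
  qed (rule tail)
qed

section \<open>Tails of \<open>p\<close>-limited sets\<close>

text \<open>For bounded \<open>D\<close> this says that the operator \<open>f \<mapsto> f restricted to D\<close> from the dual space to
  \<open>\<ell>\<^sub>\<infinity>(D)\<close> is \<open>p\<close>-summing with \<open>p\<close>-summing norm at most \<open>\<epsilon>\<close> to the power \<open>1/p\<close>.\<close>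

definition p_summing_bound :: "real \<Rightarrow> real \<Rightarrow> 'b::real_normed_vector set \<Rightarrow> bool" where
  "p_summing_bound p \<epsilon> D \<longleftrightarrow> (\<forall>N f d. (\<forall>i<N::nat. d i \<in> D) \<and>
     (\<forall>z. (\<Sum>i<N. \<bar>blinfun_apply (f i :: 'b dual) z\<bar> powr p) \<le> norm z powr p) \<longrightarrow>
     (\<Sum>i<N. \<bar>blinfun_apply (f i) (d i)\<bar> powr p) \<le> \<epsilon>)"

lemma p_summing_bound_contraction:
  fixes T :: "'b::real_normed_vector \<Rightarrow> 'b"
  assumes T: "bounded_linear T" "\<And>x. norm (T x) \<le> norm x" and p: "0 \<le> p" and D: "p_summing_bound p \<epsilon> D"
  shows "p_summing_bound p \<epsilon> (T ` D)"
  unfolding p_summing_bound_def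
proof (intro allI impI, elim conjE)
  fix N :: nat and f :: "nat \<Rightarrow> 'b dual" and d
  assume d: "\<forall>i<N. d i \<in> T ` D"
    and f: "\<forall>z. (\<Sum>i<N. \<bar>blinfun_apply (f i) z\<bar> powr p) \<le> norm z powr p"
  have "\<forall>i. \<exists>c. i < N \<longrightarrow> c \<in> D \<and> d i = T c" using d by blast
  from choice[OF this] obtain c where c: "\<And>i. i < N \<Longrightarrow> c i \<in> D \<and> d i = T (c i)" by blast
  define h where "h i = f i o\<^sub>L Blinfun T" for i
  have h: "blinfun_apply (h i) z = blinfun_apply (f i) (T z)" for i z
    by (simp add: h_def bounded_linear_Blinfun_apply[OF T(1)])
  have "(\<Sum>i<N. \<bar>blinfun_apply (h i) z\<bar> powr p) \<le> norm z powr p" for z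
    unfolding h using order_trans[OF f[rule_format, of "T z"] powr_mono2[OF p norm_ge_zero T(2)]] .
  then have "(\<Sum>i<N. \<bar>blinfun_apply (h i) (c i)\<bar> powr p) \<le> \<epsilon>"
    using D c unfolding p_summing_bound_def by blast
  then show "(\<Sum>i<N. \<bar>blinfun_apply (f i) (d i)\<bar> powr p) \<le> \<epsilon>"
    using c by (simp add: h)
qed

lemma sum_prod_decode_le:
  fixes \<psi> :: "nat \<times> nat \<Rightarrow> real"
  assumes "\<And>q. 0 \<le> \<psi> q"
  shows "(\<Sum>n<M. \<psi> (prod_decode n)) \<le> (\<Sum>j<M. \<Sum>i<M. \<psi> (j, i))"
proof -
  have "(\<Sum>n<M. \<psi> (prod_decode n)) = sum \<psi> (prod_decode ` {..<M})"
    by (rule sum.reindex[symmetric, unfolded comp_def]) (rule inj_prod_decode)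
  also have "\<dots> \<le> sum \<psi> ({..<M} \<times> {..<M})"
  proof (rule sum_mono2)
    show "prod_decode ` {..<M} \<subseteq> {..<M} \<times> {..<M}"
    proof
      fix q assume "q \<in> prod_decode ` {..<M}"
      then have "prod_encode (fst q, snd q) < M" by auto
      then have "fst q < M" "snd q < M"
        using le_prod_encode_1[of "fst q" "snd q"] le_prod_encode_2[of "snd q" "fst q"] by linarith+
      then show "q \<in> {..<M} \<times> {..<M}" by (simp add: mem_Times_iff)
    qed
  qed (use assms in auto)
  also have "\<dots> = (\<Sum>j<M. \<Sum>i<M. \<psi> (j, i))" by (simp add: sum.cartesian_product)
  finally show ?thesis .
qed

text \<open>If the \<open>p\<close>-th powers of the \<open>p\<close>-summing norms of all tails exceeded \<open>\<epsilon>\<close>, finite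
  families of functionals on disjoint blocks would witness it. Divergent block weights combine them to one weak* \<open>p\<close>-summable sequence, for
  which the suprema over \<open>A\<close> are not \<open>p\<close>-summable.\<close>

lemma p_limited_small_tail:
  fixes A :: "'a::banach_lattice set"
  assumes oc: "disjoint_null TYPE('a)" and gr: "grothendieck TYPE('a)" and p: "1 \<le> p"
    and A: "p_limited p A"
    and approx: "\<And>e. 0 < e \<Longrightarrow> \<exists>F. finite F \<and> F \<subseteq> atoms \<and> (\<forall>x\<in>A. norm (x - proj F x) < e)"
    and \<epsilon>: "0 < \<epsilon>"
  shows "\<exists>F. finite F \<and> F \<subseteq> atoms \<and> p_summing_bound p \<epsilon> ((\<lambda>x. x - proj F x) ` A)"
proof (rule ccontr)
  assume not: "\<not> ?thesis"
  define Q where "Q G y = (case y of (N, f, x) \<Rightarrow> (\<forall>i<N. x i \<in> A) \<and>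
      (\<forall>z. (\<Sum>i<N. \<bar>blinfun_apply (f i) z\<bar> powr p) \<le> norm z powr p) \<and>
      \<epsilon> < (\<Sum>i<N. \<bar>blinfun_apply (f i) (proj G (x i))\<bar> powr p))"
    for G and y :: "nat \<times> (nat \<Rightarrow> 'a dual) \<times> (nat \<Rightarrow> 'a)"
  have "\<exists>G y. finite G \<and> G \<subseteq> atoms \<and> G \<inter> F = {} \<and> Q G y" if F: "finite F" "F \<subseteq> atoms" for F
  proof -
    have "\<not> p_summing_bound p \<epsilon> ((\<lambda>x. x - proj F x) ` A)" using not F by blast
    then obtain N d and f :: "nat \<Rightarrow> 'a dual" where d: "\<And>i. i < N \<Longrightarrow> d i \<in> (\<lambda>x. x - proj F x) ` A"
      and f: "\<And>z. (\<Sum>i<N. \<bar>blinfun_apply (f i) z\<bar> powr p) \<le> norm z powr p"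
      and large: "\<epsilon> < (\<Sum>i<N. \<bar>blinfun_apply (f i) (d i)\<bar> powr p)"
      unfolding p_summing_bound_def not_all not_imp not_le by blast
    have "\<forall>i. \<exists>x. i < N \<longrightarrow> x \<in> A \<and> d i = x - proj F x" using d by blast
    from choice[OF this] obtain x where x: "\<And>i. i < N \<Longrightarrow> x i \<in> A \<and> d i = x i - proj F (x i)" by blast
    have "\<exists>H. finite H \<and> H \<subseteq> atoms \<and> F \<subseteq> H \<and> (\<forall>x\<in>A. norm (x - proj H x) < inverse (real (Suc m)))" for m
    proof -
      obtain F' where F': "finite F'" "F' \<subseteq> atoms" "\<forall>x\<in>A. norm (x - proj F' x) < inverse (real (Suc m))"
        using approx[of "inverse (real (Suc m))"] by auto
      have H: "finite (F \<union> F')" "F \<union> F' \<subseteq> atoms" using F F' by auto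
      have "norm (x - proj (F \<union> F') x) < inverse (real (Suc m))" if "x \<in> A" for x
        using norm_remainder_antimono[OF H, of F' x] F'(3) that by (meson Un_upper2 le_less_trans)
      then show ?thesis using H by (intro exI[of _ "F \<union> F'"]) auto
    qed
    then obtain H where H: "\<And>m. finite (H m)" "\<And>m. H m \<subseteq> atoms" "\<And>m. F \<subseteq> H m"
        "\<And>m x. x \<in> A \<Longrightarrow> norm (x - proj (H m) x) < inverse (real (Suc m))" by metis
    have lim: "(\<lambda>m. proj (H m - F) (x i)) \<longlonglongrightarrow> d i" if i: "i < N" for i
    proof -
      have "(\<lambda>m. d i - proj (H m - F) (x i)) \<longlonglongrightarrow> 0"
      proof (rule Lim_null_comparison[OF always_eventually LIMSEQ_inverse_real_of_nat], intro allI)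
        fix m
        have "d i - proj (H m - F) (x i) = x i - proj (H m) (x i)"
          using x[OF i] proj_diff_subset[OF H(1,3), of m "x i"] by (simp add: algebra_simps)
        then have "norm (d i - proj (H m - F) (x i)) = norm (x i - proj (H m) (x i))" by (simp only:)
        then show "norm (d i - proj (H m - F) (x i)) \<le> inverse (real (Suc m))"
          using H(4)[of "x i" m] x[OF i] by linarith
      qed
      then show ?thesis using tendsto_diff[OF tendsto_const, of _ 0 sequentially "d i"] by fastforce
    qed
    have "(\<lambda>m. \<Sum>i<N. \<bar>blinfun_apply (f i) (proj (H m - F) (x i))\<bar> powr p)
        \<longlonglongrightarrow> (\<Sum>i<N. \<bar>blinfun_apply (f i) (d i)\<bar> powr p)"
      using p lim by (intro tendsto_sum tendsto_powr' tendsto_intros blinfun.tendsto) auto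
    then have "\<forall>\<^sub>F m in sequentially. \<epsilon> < (\<Sum>i<N. \<bar>blinfun_apply (f i) (proj (H m - F) (x i))\<bar> powr p)"
      using large by (rule order_tendstoD)
    then obtain m where "\<epsilon> < (\<Sum>i<N. \<bar>blinfun_apply (f i) (proj (H m - F) (x i))\<bar> powr p)"
      by (auto simp: eventually_sequentially)
    then have "Q (H m - F) (N, f, x)" using x f by (simp add: Q_def)
    moreover have "finite (H m - F)" "H m - F \<subseteq> atoms" "(H m - F) \<inter> F = {}" using H(1,2)[of m] by auto
    ultimately show ?thesis by blast
  qed
  then obtain G y where G: "\<And>n::nat. finite (G n)" "\<And>n. G n \<subseteq> atoms" "\<And>n. Q (G n) (y n)"
      "\<And>m n. m \<noteq> n \<Longrightarrow> G m \<inter> G n = {}"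
    using disjoint_sequence_choice[of atoms Q] by metis
  define N f x where "N j = fst (y j)" and "f j = fst (snd (y j))" and "x j = snd (snd (y j))" for j
  have y: "\<And>j i. i < N j \<Longrightarrow> x j i \<in> A"
      "\<And>j z. (\<Sum>i<N j. \<bar>blinfun_apply (f j i) z\<bar> powr p) \<le> norm z powr p"
      "\<And>j. \<epsilon> < (\<Sum>i<N j. \<bar>blinfun_apply (f j i) (proj (G j) (x j i))\<bar> powr p)"
    using G(3) by (simp_all add: Q_def N_def f_def x_def case_prod_beta)
  obtain t where t: "\<And>n. 0 \<le> t n" "\<not> summable t"
      "\<And>x. summable (\<lambda>n. t n * norm (proj (G n) x) powr p)"
    by (rule block_weights[where G = G, OF oc gr p G(1,2)]) (erule G(4), rule that)
  define h where "h j i = (if i < N j then restr (G j) ((t j powr (1 / p)) *\<^sub>R f j i) else 0)" for j i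
  define h' where "h' n = (case prod_decode n of (j, i) \<Rightarrow> h j i)" for n
  have root: "(t n powr (1 / p)) powr p = t n" for n using t(1)[of n] p by (simp add: powr_powr)
  have hx: "\<bar>blinfun_apply (h j i) z\<bar> powr p
      = (if i < N j then t j * \<bar>blinfun_apply (f j i) (proj (G j) z)\<bar> powr p else 0)" for j i z
    using p by (simp add: h_def restr_apply[OF G(1,2)] blinfun.scaleR_left abs_mult powr_mult root)
  have row: "(\<Sum>i<M. \<bar>blinfun_apply (h j i) z\<bar> powr p) \<le> t j * norm (proj (G j) z) powr p" for j M z
  proof -
    have "(\<Sum>i<M. \<bar>blinfun_apply (h j i) z\<bar> powr p) \<le> (\<Sum>i<max M (N j). \<bar>blinfun_apply (h j i) z\<bar> powr p)"
      by (intro sum_mono2) auto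
    also have "\<dots> = (\<Sum>i<N j. t j * \<bar>blinfun_apply (f j i) (proj (G j) z)\<bar> powr p)"
      by (intro sum.mono_neutral_cong_right) (auto simp: hx)
    also have "\<dots> \<le> t j * norm (proj (G j) z) powr p"
      unfolding sum_distrib_left[symmetric] by (intro mult_left_mono y(2) t(1))
    finally show ?thesis .
  qed
  have "weak_star_p_summable p h'"
    unfolding weak_star_p_summable_def ell_def mem_Collect_eq
  proof (intro allI summableI_nonneg_bounded)
    fix z M
    have "(\<Sum>n<M. \<bar>blinfun_apply (h' n) z\<bar> powr p) \<le> (\<Sum>j<M. \<Sum>i<M. \<bar>blinfun_apply (h j i) z\<bar> powr p)"
      using sum_prod_decode_le[of "\<lambda>(j, i). \<bar>blinfun_apply (h j i) z\<bar> powr p" M]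
      by (simp add: h'_def case_prod_beta)
    also have "\<dots> \<le> (\<Sum>j<M. t j * norm (proj (G j) z) powr p)" by (intro sum_mono row)
    also have "\<dots> \<le> (\<Sum>j. t j * norm (proj (G j) z) powr p)"
      using t(1) by (intro sum_le_suminf t(3)) auto
    finally show "(\<Sum>n<M. \<bar>blinfun_apply (h' n) z\<bar> powr p) \<le> (\<Sum>j. t j * norm (proj (G j) z) powr p)" .
  qed simp
  then obtain a where a: "a \<in> ell p" "\<And>z n. z \<in> A \<Longrightarrow> \<bar>blinfun_apply (h' n) z\<bar> \<le> a n"
    using A unfolding p_limited_def by blast
  have sa: "summable (\<lambda>n. \<bar>a n\<bar> powr p)" using a(1) by (simp add: ell_def)
  have "(\<Sum>j<J. t j) \<le> (\<Sum>n. \<bar>a n\<bar> powr p) / \<epsilon>" for J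
  proof -
    define R where "R = Sigma {..<J} (\<lambda>j. {..<N j})"
    have "(\<Sum>j<J. t j) * \<epsilon> = (\<Sum>j<J. t j * \<epsilon>)" by (rule sum_distrib_right)
    also have "\<dots> \<le> (\<Sum>j<J. \<Sum>i<N j. \<bar>blinfun_apply (h j i) (x j i)\<bar> powr p)"
    proof (rule sum_mono)
      fix j
      have "t j * \<epsilon> \<le> t j * (\<Sum>i<N j. \<bar>blinfun_apply (f j i) (proj (G j) (x j i))\<bar> powr p)"
        using t(1) y(3)[of j] by (intro mult_left_mono) auto
      also have "\<dots> = (\<Sum>i<N j. \<bar>blinfun_apply (h j i) (x j i)\<bar> powr p)"
        by (simp add: hx sum_distrib_left)
      finally show "t j * \<epsilon> \<le> (\<Sum>i<N j. \<bar>blinfun_apply (h j i) (x j i)\<bar> powr p)" .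
    qed
    also have "\<dots> \<le> (\<Sum>j<J. \<Sum>i<N j. \<bar>a (prod_encode (j, i))\<bar> powr p)"
    proof (intro sum_mono powr_mono2)
      fix j i assume "i \<in> {..<N j}"
      then show "\<bar>blinfun_apply (h j i) (x j i)\<bar> \<le> \<bar>a (prod_encode (j, i))\<bar>"
        using a(2)[OF y(1)[of i j], of "prod_encode (j, i)"] by (simp add: h'_def)
    qed (use p in auto)
    also have "\<dots> = (\<Sum>q\<in>R. \<bar>a (prod_encode q)\<bar> powr p)"
      unfolding R_def by (simp add: sum.Sigma case_prod_beta)
    also have "\<dots> = (\<Sum>n\<in>prod_encode ` R. \<bar>a n\<bar> powr p)"
      by (rule sum.reindex[symmetric, unfolded comp_def]) (rule inj_prod_encode)
    also have "\<dots> \<le> (\<Sum>n. \<bar>a n\<bar> powr p)"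
      by (intro sum_le_suminf sa) (auto simp: R_def)
    finally show ?thesis using \<epsilon> by (simp add: field_simps)
  qed
  then have "summable t" using t(1) by (intro summableI_nonneg_bounded)
  then show False using t(2) by blast
qed

section \<open>Pietsch domination on a finite block\<close>

text \<open>Blackwell's approachability argument. Playing at each step a best response to the negative
  part of the current vector of sums increases the squared distance to the positive orthant by at
  most \<open>card I * B\<^sup>2\<close> per step, so that the distance of the averages tends to \<open>0\<close>.\<close>

lemma approachability:
  fixes u :: "'x \<Rightarrow> 'i \<Rightarrow> real"
  assumes I: "finite I" and B: "\<And>x i. x \<in> X \<Longrightarrow> i \<in> I \<Longrightarrow> \<bar>u x i\<bar> \<le> B"
    and response: "\<And>l. (\<And>i. i \<in> I \<Longrightarrow> 0 \<le> l i) \<Longrightarrow> \<exists>x\<in>X. 0 \<le> (\<Sum>i\<in>I. l i * u x i)"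
    and \<eta>: "0 < \<eta>"
  shows "\<exists>n>0. \<exists>x::nat \<Rightarrow> 'x. (\<forall>k<n. x k \<in> X) \<and> (\<forall>i\<in>I. - \<eta> * real n \<le> (\<Sum>k<n. u (x k) i))"
proof -
  define neg where "neg v i = max 0 (- v i)" for v :: "'i \<Rightarrow> real" and i
  have "\<exists>x. x \<in> X \<and> 0 \<le> (\<Sum>i\<in>I. neg v i * u x i)" for v
    using response[of "neg v"] by (auto simp: neg_def)
  then obtain \<sigma> where \<sigma>: "\<And>v. \<sigma> v \<in> X" "\<And>v. 0 \<le> (\<Sum>i\<in>I. neg v i * u (\<sigma> v) i)" by metis
  define V where "V = rec_nat (\<lambda>_. 0) (\<lambda>_ v i. v i + u (\<sigma> v) i)"
  have V: "V 0 i = 0" "V (Suc n) i = V n i + u (\<sigma> (V n)) i" for n i by (simp_all add: V_def)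
  define x where "x n = \<sigma> (V n)" for n
  have Vsum: "V n i = (\<Sum>k<n. u (x k) i)" for n i by (induction n) (simp_all add: V x_def)
  define C where "C = real (card I) * B\<^sup>2"
  have dist: "(\<Sum>i\<in>I. (neg (V n) i)\<^sup>2) \<le> real n * C" for n
  proof (induction n)
    case 0
    show ?case by (simp add: neg_def V)
  next
    case (Suc n)
    let ?u = "\<lambda>i. u (\<sigma> (V n)) i"
    have "(neg (V (Suc n)) i)\<^sup>2 \<le> (neg (V n) i)\<^sup>2 - 2 * (neg (V n) i * ?u i) + B\<^sup>2" if i: "i \<in> I" for i
    proof -
      have "\<bar>neg (V (Suc n)) i\<bar> \<le> \<bar>neg (V n) i - ?u i\<bar>" by (auto simp: neg_def V)
      then have "(neg (V (Suc n)) i)\<^sup>2 \<le> (neg (V n) i - ?u i)\<^sup>2" by (simp add: abs_le_square_iff)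
      moreover have "\<bar>?u i\<bar> \<le> \<bar>B\<bar>" using B[OF \<sigma>(1)[of "V n"] i] by linarith
      then have "(?u i)\<^sup>2 \<le> B\<^sup>2" by (simp add: abs_le_square_iff)
      ultimately show ?thesis by (simp add: power2_diff)
    qed
    then have "(\<Sum>i\<in>I. (neg (V (Suc n)) i)\<^sup>2)
        \<le> (\<Sum>i\<in>I. (neg (V n) i)\<^sup>2 - 2 * (neg (V n) i * ?u i) + B\<^sup>2)" by (intro sum_mono)
    also have "\<dots> = (\<Sum>i\<in>I. (neg (V n) i)\<^sup>2) - 2 * (\<Sum>i\<in>I. neg (V n) i * ?u i) + C"
      by (simp add: sum.distrib sum_subtractf sum_distrib_left C_def)
    also have "\<dots> \<le> real n * C + C" using \<sigma>(2)[of "V n"] Suc by linarith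
    finally show ?case by (simp add: algebra_simps)
  qed
  obtain n0 :: nat where n0: "C / \<eta>\<^sup>2 \<le> real n0" using real_arch_simple by blast
  define n where "n = Suc n0"
  have "C \<le> real n0 * \<eta>\<^sup>2" using n0 \<eta> by (simp add: field_simps)
  also have "\<dots> \<le> real n * \<eta>\<^sup>2" by (intro mult_right_mono) (simp_all add: n_def)
  finally have n: "0 < n" "C \<le> real n * \<eta>\<^sup>2" by (simp_all add: n_def)
  have "- \<eta> * real n \<le> V n i" if i: "i \<in> I" for i
  proof -
    have "(neg (V n) i)\<^sup>2 \<le> (\<Sum>i\<in>I. (neg (V n) i)\<^sup>2)" using I i by (intro member_le_sum) auto
    also have "\<dots> \<le> real n * (real n * \<eta>\<^sup>2)" using dist[of n] n(2) by (meson mult_left_mono of_nat_0_le_iff order_trans)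
    also have "\<dots> = (\<eta> * real n)\<^sup>2" by (simp add: power2_eq_square)
    finally have "neg (V n) i \<le> \<eta> * real n" by (rule power2_le_imp_le) (use \<eta> in simp)
    then show ?thesis by (simp add: neg_def)
  qed
  then have "\<forall>i\<in>I. - \<eta> * real n \<le> (\<Sum>k<n. u (x k) i)" unfolding Vsum by (intro ballI)
  moreover have "\<forall>k<n. x k \<in> X" using \<sigma>(1) by (simp add: x_def)
  ultimately show ?thesis using n(1) by blast
qed

lemma finite_net_of_restrictions:
  fixes G :: "'a::banach_lattice set"
  assumes G: "finite G" "G \<subseteq> atoms" and \<theta>: "0 < \<theta>"
  shows "\<exists>S. finite S \<and> (\<forall>s\<in>S. norm s \<le> 1) \<and>
    (\<forall>f :: 'a dual. norm f \<le> 1 \<longrightarrow> (\<exists>s\<in>S. norm (restr G f - restr G s) < \<theta>))"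
proof -
  define \<phi> where "\<phi> a = Blinfun (coord a)" for a :: 'a
  have \<phi>: "blinfun_apply (\<phi> a) x = coord a x" if "a \<in> atoms" for a x
    by (simp add: \<phi>_def bounded_linear_Blinfun_apply coord_bounded_linear that)
  have "restr G f = (\<Sum>a\<in>G. blinfun_apply f a *\<^sub>R \<phi> a)" for f
  proof (rule blinfun_eqI)
    fix x
    show "blinfun_apply (restr G f) x = blinfun_apply (\<Sum>a\<in>G. blinfun_apply f a *\<^sub>R \<phi> a) x"
      using G(2) by (auto simp: restr_apply[OF G] blinfun_proj blinfun.sum_left blinfun.scaleR_left \<phi>
          intro!: sum.cong)
  qed
  moreover have "\<bar>blinfun_apply f a\<bar> \<le> 1" if "norm f \<le> 1" "a \<in> G" for f :: "'a dual" and a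
  proof -
    have "\<bar>blinfun_apply f a\<bar> \<le> norm f * 1" using norm_blinfun[of f a] atoms_norm[of a] that G by auto
    then show ?thesis using that by simp
  qed
  ultimately have box: "restr G f \<in> {\<Sum>a\<in>G. t a *\<^sub>R \<phi> a | t. \<forall>a\<in>G. \<bar>t a\<bar> \<le> 1}" if "norm f \<le> 1" for f
    using that by (auto intro!: exI[of _ "blinfun_apply f"])
  have "compact {\<Sum>a\<in>G. t a *\<^sub>R \<phi> a | t. \<forall>a\<in>G. \<bar>t a\<bar> \<le> 1}" by (rule compact_box[OF G(1)])
  then obtain k where k: "finite k" "{\<Sum>a\<in>G. t a *\<^sub>R \<phi> a | t. \<forall>a\<in>G. \<bar>t a\<bar> \<le> 1} \<subseteq> (\<Union>c\<in>k. ball c (\<theta> / 2))"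
    using \<theta> unfolding compact_eq_totally_bounded by (meson half_gt_zero)
  define P where "P c f \<longleftrightarrow> norm f \<le> 1 \<and> restr G f \<in> ball c (\<theta> / 2)" for c f
  define r where "r c = (SOME f. P c f)" for c
  have r: "P c (r c)" if "P c f" for c f unfolding r_def using that by (rule someI)
  define S where "S = r ` {c \<in> k. \<exists>f. P c f}"
  show ?thesis
  proof (intro exI[of _ S] conjI allI impI ballI)
    show "finite S" using k(1) by (simp add: S_def)
    show "norm s \<le> 1" if "s \<in> S" for s using that r by (auto simp: S_def P_def)
    fix f :: "'a dual" assume f: "norm f \<le> 1"
    then obtain c where c: "c \<in> k" "restr G f \<in> ball c (\<theta> / 2)" using box k(2) by blast
    then have Pc: "P c f" using f by (simp add: P_def)
    then have "restr G (r c) \<in> ball c (\<theta> / 2)" using r by (simp add: P_def)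
    then have "dist (restr G f) (restr G (r c)) < \<theta>"
      using c(2) dist_triangle_half_r[of c "restr G f" \<theta> "restr G (r c)"] by simp
    then show "\<exists>s\<in>S. norm (restr G f - restr G s) < \<theta>" using Pc c(1) by (auto simp: S_def dist_norm)
  qed
qed

text \<open>The responses needed for approachability are the \<open>p\<close>-summing inequality for the weighted net
  elements. Equal weights \<open>1 / n\<close> turn the average over the points \<open>x k\<close> into vectors \<open>y k\<close>.\<close>

lemma domination_on_finite_set:
  fixes D :: "'b::real_normed_vector set" and S :: "'b dual set"
  assumes p: "1 \<le> p" and D: "p_summing_bound p \<epsilon> D" and \<epsilon>: "0 < \<epsilon>" and S: "finite S"
    and d: "\<And>s. s \<in> S \<Longrightarrow> d s \<in> D" and \<eta>: "0 < \<eta>"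
  shows "\<exists>n (y :: nat \<Rightarrow> 'b). (\<Sum>k<n. norm (y k) powr p) \<le> 2 * \<epsilon> \<and>
    (\<forall>s\<in>S. \<bar>blinfun_apply s (d s)\<bar> powr p \<le> (\<Sum>k<n. \<bar>blinfun_apply s (y k)\<bar> powr p) + \<eta>)"
proof -
  define b where "b s = \<bar>blinfun_apply s (d s)\<bar> powr p" for s
  define u where "u x s = 2 * \<epsilon> * \<bar>blinfun_apply s x\<bar> powr p - b s" for x s
  have bdd: "\<bar>u x s\<bar> \<le> (\<Sum>s\<in>S. 2 * \<epsilon> * norm s powr p + b s)" if "x \<in> {x. norm x \<le> 1}" "s \<in> S" for x s
  proof -
    have b0: "0 \<le> b s" for s by (simp add: b_def)
    have "\<bar>blinfun_apply s x\<bar> \<le> norm s * norm x" using norm_blinfun[of s x] by simp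
    also have "\<dots> \<le> norm s * 1" using that by (intro mult_left_mono) auto
    finally have "2 * \<epsilon> * \<bar>blinfun_apply s x\<bar> powr p \<le> 2 * \<epsilon> * norm s powr p"
      using p \<epsilon> by (intro mult_left_mono powr_mono2) auto
    moreover have "0 \<le> 2 * \<epsilon> * \<bar>blinfun_apply s x\<bar> powr p" using \<epsilon> by simp
    ultimately have "\<bar>u x s\<bar> \<le> 2 * \<epsilon> * norm s powr p + b s" using b0[of s] by (simp add: u_def abs_le_iff)
    also have "\<dots> \<le> (\<Sum>s\<in>S. 2 * \<epsilon> * norm s powr p + b s)"
      using S that(2) \<epsilon> b0 by (intro member_le_sum) (auto intro!: add_nonneg_nonneg)
    finally show ?thesis .
  qed
  have response: "\<exists>x\<in>{x. norm x \<le> 1}. 0 \<le> (\<Sum>s\<in>S. l s * u x s)" if l: "\<And>s. s \<in> S \<Longrightarrow> 0 \<le> l s" for l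
  proof (rule ccontr)
    assume neg: "\<not> ?thesis"
    define T where "T = (\<Sum>s\<in>S. l s * b s)"
    have eq: "(\<Sum>s\<in>S. l s * u x s) = 2 * \<epsilon> * (\<Sum>s\<in>S. l s * \<bar>blinfun_apply s x\<bar> powr p) - T" for x
      by (simp add: u_def T_def right_diff_distrib sum_subtractf sum_distrib_left mult.left_commute)
    have lt: "2 * \<epsilon> * (\<Sum>s\<in>S. l s * \<bar>blinfun_apply s x\<bar> powr p) < T" if "norm x \<le> 1" for x
      using neg that eq[of x] by force
    have "0 \<le> 2 * \<epsilon> * (\<Sum>s\<in>S. l s * \<bar>blinfun_apply s 0\<bar> powr p)"
      using \<epsilon> l by (intro mult_nonneg_nonneg sum_nonneg) auto
    then have T: "0 < T" using lt[of 0] by simp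
    \<comment> \<open>this scaling turns \<open>lt\<close> into the hypothesis of the \<open>p\<close>-summing inequality, whose left side
      becomes \<open>2 * \<epsilon>\<close>\<close>
    define c where "c = 2 * \<epsilon> / T"
    have c: "0 < c" using T \<epsilon> by (simp add: c_def)
    obtain h where h: "bij_betw h {..<card S} S"
      using ex_bij_betw_nat_finite[OF S] by (auto simp: atLeast0LessThan)
    define f where "f i = ((c * l (h i)) powr (1 / p)) *\<^sub>R h i" for i
    have hS: "h i \<in> S" if "i < card S" for i using h that by (auto simp: bij_betw_def)
    have fx: "\<bar>blinfun_apply (f i) x\<bar> powr p = c * l (h i) * \<bar>blinfun_apply (h i) x\<bar> powr p"
      if "i < card S" for i x
    proof -
      have "0 \<le> c * l (h i)" using c l[OF hS[OF that]] by simp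
      then have "((c * l (h i)) powr (1 / p)) powr p = c * l (h i)" using p by (simp add: powr_powr)
      then show ?thesis by (simp add: f_def blinfun.scaleR_left abs_mult powr_mult)
    qed
    have sumS: "(\<Sum>i<card S. c * l (h i) * \<psi> (h i)) = c * (\<Sum>s\<in>S. l s * \<psi> s)" for \<psi> :: "'b dual \<Rightarrow> real"
      using sum.reindex_bij_betw[OF h, of "\<lambda>s. c * l s * \<psi> s"] by (simp add: sum_distrib_left mult.assoc)
    have "(\<Sum>i<card S. \<bar>blinfun_apply (f i) z\<bar> powr p) \<le> norm z powr p" for z
    proof -
      have "(\<Sum>i<card S. \<bar>blinfun_apply (f i) z\<bar> powr p)
          = (\<Sum>i<card S. c * l (h i) * \<bar>blinfun_apply (h i) z\<bar> powr p)"
        by (intro sum.cong) (auto simp: fx)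
      also have "\<dots> = c * (\<Sum>s\<in>S. l s * \<bar>blinfun_apply s z\<bar> powr p)" by (rule sumS)
      also have "\<dots> \<le> norm z powr p"
      proof (cases "z = 0")
        case False
        define z1 where "z1 = (1 / norm z) *\<^sub>R z"
        have z1: "norm z1 \<le> 1" using False by (simp add: z1_def)
        have "\<bar>blinfun_apply s z\<bar> powr p = norm z powr p * \<bar>blinfun_apply s z1\<bar> powr p" for s
        proof -
          have "blinfun_apply s z = norm z * blinfun_apply s z1"
            using False by (simp add: z1_def blinfun.scaleR_right)
          then show ?thesis by (simp add: abs_mult powr_mult)
        qed
        then have eq: "c * (\<Sum>s\<in>S. l s * \<bar>blinfun_apply s z\<bar> powr p)
            = norm z powr p * (c * (\<Sum>s\<in>S. l s * \<bar>blinfun_apply s z1\<bar> powr p))"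
          by (simp add: sum_distrib_left mult.left_commute)
        have "c * (\<Sum>s\<in>S. l s * \<bar>blinfun_apply s z1\<bar> powr p) \<le> 1"
          using lt[OF z1] T by (simp add: c_def)
        from mult_left_mono[OF this, of "norm z powr p"] show ?thesis unfolding eq by simp
      qed simp
      finally show ?thesis .
    qed
    moreover have "\<forall>i<card S. d (h i) \<in> D" using hS d by simp
    ultimately have "(\<Sum>i<card S. \<bar>blinfun_apply (f i) (d (h i))\<bar> powr p) \<le> \<epsilon>"
      using D[unfolded p_summing_bound_def, THEN spec[of _ "card S"], THEN spec[of _ f],
          THEN spec[of _ "\<lambda>i. d (h i)"]] by simp
    moreover have "(\<Sum>i<card S. \<bar>blinfun_apply (f i) (d (h i))\<bar> powr p) = c * T"
    proof -
      have "(\<Sum>i<card S. \<bar>blinfun_apply (f i) (d (h i))\<bar> powr p) = (\<Sum>i<card S. c * l (h i) * b (h i))"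
        by (intro sum.cong) (auto simp: fx b_def)
      then show ?thesis by (simp add: sumS T_def)
    qed
    moreover have "c * T = 2 * \<epsilon>" using T by (simp add: c_def)
    ultimately show False using \<epsilon> by simp
  qed
  obtain n x where n: "0 < n" "\<And>k. k < n \<Longrightarrow> norm (x k :: 'b) \<le> 1"
    "\<And>s. s \<in> S \<Longrightarrow> - \<eta> * real n \<le> (\<Sum>k<n. u (x k) s)"
    using approachability[OF S bdd response \<eta>] by auto
  define y where "y k = ((2 * \<epsilon> / real n) powr (1 / p)) *\<^sub>R x k" for k
  have root: "((2 * \<epsilon> / real n) powr (1 / p)) powr p = 2 * \<epsilon> / real n" using p \<epsilon> n(1) by (simp add: powr_powr)
  have "(\<Sum>k<n. norm (y k) powr p) \<le> (\<Sum>k<n. 2 * \<epsilon> / real n)"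
  proof (rule sum_mono)
    fix k assume "k \<in> {..<n}"
    then have "norm (x k) powr p \<le> 1" using n(2) p by (intro powr_le1) auto
    then have "(2 * \<epsilon> / real n) * norm (x k) powr p \<le> (2 * \<epsilon> / real n) * 1"
      using \<epsilon> by (intro mult_left_mono) auto
    moreover have "norm (y k) powr p = (2 * \<epsilon> / real n) * norm (x k) powr p" by (simp add: y_def powr_mult root)
    ultimately show "norm (y k) powr p \<le> 2 * \<epsilon> / real n" by simp
  qed
  also have "\<dots> = 2 * \<epsilon>" using n(1) by simp
  finally have ysum: "(\<Sum>k<n. norm (y k) powr p) \<le> 2 * \<epsilon>" .
  have "b s \<le> (\<Sum>k<n. \<bar>blinfun_apply s (y k)\<bar> powr p) + \<eta>" if "s \<in> S" for s
  proof -
    have "(\<Sum>k<n. u (x k) s) = 2 * \<epsilon> * (\<Sum>k<n. \<bar>blinfun_apply s (x k)\<bar> powr p) - real n * b s"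
      by (simp add: u_def sum_subtractf sum_distrib_left)
    then have "b s \<le> 2 * \<epsilon> / real n * (\<Sum>k<n. \<bar>blinfun_apply s (x k)\<bar> powr p) + \<eta>"
      using n(3)[OF that] n(1) by (simp add: field_simps)
    also have "2 * \<epsilon> / real n * (\<Sum>k<n. \<bar>blinfun_apply s (x k)\<bar> powr p) = (\<Sum>k<n. \<bar>blinfun_apply s (y k)\<bar> powr p)"
      by (simp add: y_def blinfun.scaleR_right abs_mult powr_mult root sum_distrib_left)
    finally show ?thesis .
  qed
  then show ?thesis using ysum unfolding b_def by blast
qed

lemma abs_blinfun_le_bound: "norm f \<le> M \<Longrightarrow> norm x \<le> L \<Longrightarrow> \<bar>blinfun_apply f x\<bar> \<le> M * L"
  for f :: "'b::real_normed_vector dual"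
  using norm_blinfun[of f x] mult_mono[of "norm f" M "norm x" L] norm_ge_zero[of f]
  by (smt (verit) norm_ge_zero real_norm_def)

text \<open>The passage from the net to all functionals costs the factor \<open>4\<^sup>p\<close> and an error that may be
  taken as small as desired after \<open>G\<close> has been fixed.\<close>

lemma domination_on_block:
  fixes D :: "'a::banach_lattice set"
  assumes p: "1 \<le> p" and D: "p_summing_bound p \<epsilon> D" and \<epsilon>: "0 < \<epsilon>"
    and G: "finite G" "G \<subseteq> atoms" and DG: "\<And>d. d \<in> D \<Longrightarrow> proj G d = d" and M: "\<And>d. d \<in> D \<Longrightarrow> norm d \<le> M"
    and \<eta>: "0 < \<eta>"
  shows "\<exists>n (y :: nat \<Rightarrow> 'a). (\<Sum>k<n. norm (y k) powr p) \<le> 4 powr p * (2 * \<epsilon>) \<and>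
    (\<forall>f d. norm f \<le> 1 \<and> d \<in> D \<longrightarrow> \<bar>blinfun_apply f d\<bar> powr p \<le> (\<Sum>k<n. \<bar>blinfun_apply f (y k)\<bar> powr p) + \<eta>)"
proof (cases "D = {}")
  case True
  then show ?thesis using \<epsilon> by (intro exI[of _ 0]) auto
next
  case False
  then obtain d0 where "d0 \<in> D" by blast
  then have M0: "0 \<le> M" using M norm_ge_zero order_trans by blast
  define K where "K = 2 powr p * M powr p + 4 powr p * (2 * \<epsilon>)"
  have K: "0 < K" using \<epsilon> by (simp add: K_def add_nonneg_pos)
  \<comment> \<open>net distance and loss in the suprema over \<open>D\<close>, each contributing \<open>\<eta> / 2\<close> to the error\<close>
  define \<theta> where "\<theta> = (\<eta> / (2 * K)) powr (1 / p)"
  have \<theta>: "0 < \<theta>" "\<theta> powr p = \<eta> / (2 * K)" using \<eta> K p by (simp_all add: \<theta>_def powr_powr)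
  define \<eta>' where "\<eta>' = \<eta> / (4 * 2 powr p)"
  have \<eta>': "0 < \<eta>'" using \<eta> by (simp add: \<eta>'_def)
  obtain S :: "'a dual set" where S: "finite S" "\<And>s. s \<in> S \<Longrightarrow> norm s \<le> 1"
      "\<And>f. norm f \<le> 1 \<Longrightarrow> \<exists>s\<in>S. norm (restr G f - restr G s) < \<theta>"
    using finite_net_of_restrictions[OF G \<theta>(1)] by blast
  have "\<exists>d0\<in>D. \<forall>d\<in>D. \<bar>blinfun_apply s d\<bar> powr p \<le> \<bar>blinfun_apply s d0\<bar> powr p + \<eta>'" if "s \<in> S" for s
  proof -
    define X where "X = (\<lambda>d. \<bar>blinfun_apply s d\<bar> powr p) ` D"
    have "\<bar>blinfun_apply s d\<bar> powr p \<le> (1 * M) powr p" if "d \<in> D" for d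
      using abs_blinfun_le_bound[OF S(2)[OF \<open>s \<in> S\<close>] M[OF that]] p by (intro powr_mono2) auto
    then have bdd: "bdd_above X" by (auto simp: X_def intro!: bdd_aboveI2)
    have "Sup X - \<eta>' < Sup X" using \<eta>' by simp
    then obtain v where v: "v \<in> X" "Sup X - \<eta>' < v" using less_cSupD[of X "Sup X - \<eta>'"] False by (auto simp: X_def)
    have "w \<le> v + \<eta>'" if "w \<in> X" for w using cSup_upper[OF that bdd] v(2) by simp
    then show ?thesis using v(1) unfolding X_def by auto
  qed
  then obtain e where e: "\<And>s. s \<in> S \<Longrightarrow> e s \<in> D"
    "\<And>s d. s \<in> S \<Longrightarrow> d \<in> D \<Longrightarrow> \<bar>blinfun_apply s d\<bar> powr p \<le> \<bar>blinfun_apply s (e s)\<bar> powr p + \<eta>'" by metis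
  have "\<exists>n (z :: nat \<Rightarrow> 'a). (\<Sum>k<n. norm (z k) powr p) \<le> 2 * \<epsilon> \<and>
    (\<forall>s\<in>restr G ` S. \<bar>blinfun_apply s (e (inv_into S (restr G) s))\<bar> powr p
        \<le> (\<Sum>k<n. \<bar>blinfun_apply s (z k)\<bar> powr p) + \<eta>')"
    using S(1) e(1) \<eta>' by (intro domination_on_finite_set[OF p D \<epsilon>]) (auto simp: inv_into_into)
  then obtain n and z :: "nat \<Rightarrow> 'a" where z: "(\<Sum>k<n. norm (z k) powr p) \<le> 2 * \<epsilon>"
    "\<forall>s\<in>restr G ` S. \<bar>blinfun_apply s (e (inv_into S (restr G) s))\<bar> powr p
        \<le> (\<Sum>k<n. \<bar>blinfun_apply s (z k)\<bar> powr p) + \<eta>'"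
    by blast
  define y where "y k = 4 *\<^sub>R proj G (z k)" for k
  have rD: "blinfun_apply (restr G f) d = blinfun_apply f d" if "d \<in> D" for f d
    using DG[OF that] by (simp add: restr_apply[OF G])
  have "\<bar>blinfun_apply f d\<bar> powr p \<le> (\<Sum>k<n. \<bar>blinfun_apply f (y k)\<bar> powr p) + \<eta>"
    if f: "norm f \<le> 1" and d: "d \<in> D" for f d
  proof -
    obtain s0 where s0: "s0 \<in> S" "norm (restr G f - restr G s0) < \<theta>" using S(3)[OF f] by blast
    \<comment> \<open>another net element with the same restriction to the block\<close>
    define s where "s = inv_into S (restr G) (restr G s0)"
    have s: "s \<in> S" "restr G s = restr G s0"
      unfolding s_def using s0(1) by (auto intro: inv_into_into f_inv_into_f)
    define g where "g = restr G f - restr G s"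
    have g: "norm g \<le> \<theta>" using s0(2) s(2) by (simp add: g_def)
    have "\<bar>blinfun_apply f d\<bar> powr p = \<bar>blinfun_apply g d + blinfun_apply s d\<bar> powr p"
      using rD[OF d] by (simp add: g_def blinfun.diff_left)
    also have "\<dots> \<le> 2 powr p * (\<bar>blinfun_apply g d\<bar> powr p + \<bar>blinfun_apply s d\<bar> powr p)" by (rule powr_add_le[OF p])
    also have "\<dots> \<le> 2 powr p * ((\<theta> * M) powr p + ((\<Sum>k<n. \<bar>blinfun_apply (restr G s) (z k)\<bar> powr p) + 2 * \<eta>'))"
    proof (intro mult_left_mono add_mono)
      show "\<bar>blinfun_apply g d\<bar> powr p \<le> (\<theta> * M) powr p"
        using abs_blinfun_le_bound[OF g M[OF d]] p by (intro powr_mono2) auto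
      have "\<bar>blinfun_apply s (e s)\<bar> powr p \<le> (\<Sum>k<n. \<bar>blinfun_apply (restr G s) (z k)\<bar> powr p) + \<eta>'"
        using z(2)[rule_format, of "restr G s0"] s0(1) s rD[OF e(1)[OF s(1)], of s] by (simp add: s_def[symmetric])
      then show "\<bar>blinfun_apply s d\<bar> powr p \<le> (\<Sum>k<n. \<bar>blinfun_apply (restr G s) (z k)\<bar> powr p) + 2 * \<eta>'"
        using e(2)[OF s(1) d] by linarith
    qed simp
    also have "(\<Sum>k<n. \<bar>blinfun_apply (restr G s) (z k)\<bar> powr p)
        \<le> (\<Sum>k<n. 2 powr p * (\<bar>blinfun_apply (restr G f) (z k)\<bar> powr p + \<theta> powr p * norm (z k) powr p))"
    proof (rule sum_mono)
      fix k
      have "\<bar>blinfun_apply (restr G s) (z k)\<bar> powr p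
          = \<bar>blinfun_apply (restr G f) (z k) + - blinfun_apply g (z k)\<bar> powr p"
        by (simp add: g_def blinfun.diff_left)
      also have "\<dots> \<le> 2 powr p * (\<bar>blinfun_apply (restr G f) (z k)\<bar> powr p + \<bar>- blinfun_apply g (z k)\<bar> powr p)"
        by (rule powr_add_le[OF p])
      also have "\<dots> \<le> 2 powr p * (\<bar>blinfun_apply (restr G f) (z k)\<bar> powr p + \<theta> powr p * norm (z k) powr p)"
      proof (intro mult_left_mono add_left_mono)
        have "\<bar>blinfun_apply g (z k)\<bar> powr p \<le> (\<theta> * norm (z k)) powr p"
          using abs_blinfun_le_bound[OF g order_refl] p by (intro powr_mono2) auto
        then show "\<bar>- blinfun_apply g (z k)\<bar> powr p \<le> \<theta> powr p * norm (z k) powr p" by (simp add: powr_mult)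
      qed simp
      finally show "\<bar>blinfun_apply (restr G s) (z k)\<bar> powr p
          \<le> 2 powr p * (\<bar>blinfun_apply (restr G f) (z k)\<bar> powr p + \<theta> powr p * norm (z k) powr p)" .
    qed
    also have "\<dots> = 2 powr p * ((\<Sum>k<n. \<bar>blinfun_apply (restr G f) (z k)\<bar> powr p)
        + \<theta> powr p * (\<Sum>k<n. norm (z k) powr p))"
      by (simp add: sum_distrib_left[symmetric] sum.distrib)
    also have "\<dots> \<le> 2 powr p * ((\<Sum>k<n. \<bar>blinfun_apply (restr G f) (z k)\<bar> powr p) + \<theta> powr p * (2 * \<epsilon>))"
      using z(1) by (intro mult_left_mono add_left_mono) auto
    finally have "\<bar>blinfun_apply f d\<bar> powr p \<le> 2 powr p * ((\<theta> * M) powr p +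
        (2 powr p * ((\<Sum>k<n. \<bar>blinfun_apply (restr G f) (z k)\<bar> powr p) + \<theta> powr p * (2 * \<epsilon>)) + 2 * \<eta>'))"
      by simp
    also have "\<dots> = (2 powr p * 2 powr p) * (\<Sum>k<n. \<bar>blinfun_apply (restr G f) (z k)\<bar> powr p)
        + \<theta> powr p * (2 powr p * M powr p + (2 powr p * 2 powr p) * (2 * \<epsilon>)) + 2 powr p * (2 * \<eta>')"
      using \<theta>(1) M0 by (simp add: powr_mult algebra_simps)
    also have "(2::real) powr p * 2 powr p = 4 powr p" using powr_mult[of 2 2 p] by simp
    also have "2 powr p * M powr p + 4 powr p * (2 * \<epsilon>) = K" by (simp add: K_def)
    also have "\<theta> powr p * K = \<eta> / 2" using K by (simp add: \<theta>(2))
    also have "2 powr p * (2 * \<eta>') = \<eta> / 2" by (simp add: \<eta>'_def)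
    also have "4 powr p * (\<Sum>k<n. \<bar>blinfun_apply (restr G f) (z k)\<bar> powr p) = (\<Sum>k<n. \<bar>blinfun_apply f (y k)\<bar> powr p)"
      by (simp add: y_def restr_apply[OF G] blinfun.scaleR_right abs_mult powr_mult sum_distrib_left)
    finally show ?thesis by simp
  qed
  moreover have "(\<Sum>k<n. norm (y k) powr p) \<le> 4 powr p * (2 * \<epsilon>)"
  proof -
    have "(\<Sum>k<n. norm (y k) powr p) \<le> (\<Sum>k<n. 4 powr p * norm (z k) powr p)"
      using norm_proj_le[OF G] p by (intro sum_mono) (simp add: y_def powr_mult powr_mono2)
    also have "\<dots> = 4 powr p * (\<Sum>k<n. norm (z k) powr p)" by (simp add: sum_distrib_left)
    also have "\<dots> \<le> 4 powr p * (2 * \<epsilon>)" using z(1) by (intro mult_left_mono) auto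
    finally show ?thesis .
  qed
  ultimately show ?thesis by blast
qed

section \<open>From domination to \<open>p\<close>-convex hulls\<close>

text \<open>Suppose \<open>d / 3\<close> is not of the form \<open>(\<Sum>j<n. c j *\<^sub>R y j) + e\<close> with \<open>c\<close> in the unit ball and
  \<open>norm e \<le> \<eta>\<close>. Separation from the convex set of these vectors gives \<open>f\<close> that is at
  most \<open>1\<close> there, so that \<open>(\<Sum>j<n. \<bar>f (y j)\<bar>\<^sup>p) \<le> 1\<close> by the equality case of Hoelder's inequality and
  \<open>norm f \<le> 1 / \<eta>\<close>, while \<open>f d \<ge> 3\<close>. Domination only allows \<open>\<bar>f d\<bar>\<^sup>p \<le> 2\<close>.\<close>

lemma p_convex_hull_of_domination:
  fixes d :: "'b::real_normed_vector" and y :: "nat \<Rightarrow> 'b"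
  assumes p: "1 < p" and \<eta>: "0 < \<eta>"
    and dom: "\<And>f. norm f \<le> 1 \<Longrightarrow> \<bar>blinfun_apply f d\<bar> powr p \<le> (\<Sum>j<n. \<bar>blinfun_apply f (y j)\<bar> powr p) + \<eta> powr p"
  shows "\<exists>c. (\<Sum>j<n. \<bar>c j\<bar> powr conj_exp p) \<le> 1 \<and> norm ((1/3) *\<^sub>R d - (\<Sum>j<n. c j *\<^sub>R y j)) \<le> \<eta>"
proof (rule ccontr)
  assume not: "\<not> ?thesis"
  define q where "q = conj_exp p"
  have q: "1 \<le> q" "(p - 1) * q = p" "1 / p + 1 / q = 1" "0 < q"
    using p conj_exp[of p] by (simp_all add: q_def conj_exp_def field_simps)
  define K where "K = {(\<Sum>j<n. c j *\<^sub>R y j) + e | c e. (\<Sum>j<n. \<bar>c j\<bar> powr q) \<le> 1 \<and> norm e \<le> \<eta>}"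
  have KI: "(\<Sum>j<n. c j *\<^sub>R y j) + e \<in> K" if "(\<Sum>j<n. \<bar>c j\<bar> powr q) \<le> 1" "norm e \<le> \<eta>" for c e
    using that by (auto simp: K_def)
  have "convex K"
  proof (rule convexI)
    fix x x' u v assume x: "x \<in> K" and x': "x' \<in> K" and uv: "0 \<le> u" "0 \<le> v" "u + v = (1::real)"
    obtain c e where c: "x = (\<Sum>j<n. c j *\<^sub>R y j) + e" "(\<Sum>j<n. \<bar>c j\<bar> powr q) \<le> 1" "norm e \<le> \<eta>"
      using x by (auto simp: K_def)
    obtain c' e' where c': "x' = (\<Sum>j<n. c' j *\<^sub>R y j) + e'" "(\<Sum>j<n. \<bar>c' j\<bar> powr q) \<le> 1" "norm e' \<le> \<eta>"
      using x' by (auto simp: K_def)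
    have "(\<Sum>j<n. \<bar>u * c j + v * c' j\<bar> powr q) \<le> (\<Sum>j<n. u * \<bar>c j\<bar> powr q + v * \<bar>c' j\<bar> powr q)"
    proof (rule sum_mono)
      fix j
      have "\<bar>u * c j + v * c' j\<bar> \<le> u * \<bar>c j\<bar> + v * \<bar>c' j\<bar>"
        using uv abs_triangle_ineq[of "u * c j" "v * c' j"] by (simp add: abs_mult)
      then have "\<bar>u * c j + v * c' j\<bar> powr q \<le> (u * \<bar>c j\<bar> + v * \<bar>c' j\<bar>) powr q"
        using q(1) by (intro powr_mono2) simp_all
      moreover have "(u * \<bar>c j\<bar> + v * \<bar>c' j\<bar>) powr q \<le> u * \<bar>c j\<bar> powr q + v * \<bar>c' j\<bar> powr q"
        by (rule powr_convex_nonneg[OF q(1) _ _ uv]) simp_all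
      ultimately show "\<bar>u * c j + v * c' j\<bar> powr q \<le> u * \<bar>c j\<bar> powr q + v * \<bar>c' j\<bar> powr q"
        by (rule order_trans)
    qed
    also have "\<dots> = u * (\<Sum>j<n. \<bar>c j\<bar> powr q) + v * (\<Sum>j<n. \<bar>c' j\<bar> powr q)"
      by (simp add: sum.distrib sum_distrib_left)
    also have "\<dots> \<le> u * 1 + v * 1" using uv c c' by (intro add_mono mult_left_mono) auto
    finally have 1: "(\<Sum>j<n. \<bar>u * c j + v * c' j\<bar> powr q) \<le> 1" using uv by simp
    have "norm (u *\<^sub>R e + v *\<^sub>R e') \<le> u * norm e + v * norm e'"
      using uv norm_triangle_ineq[of "u *\<^sub>R e" "v *\<^sub>R e'"] by simp
    also have "\<dots> \<le> u * \<eta> + v * \<eta>" using uv c c' by (intro add_mono mult_left_mono) auto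
    also have "\<dots> = \<eta>" using uv by (simp add: distrib_right[symmetric])
    finally have 2: "norm (u *\<^sub>R e + v *\<^sub>R e') \<le> \<eta>" .
    have "u *\<^sub>R x + v *\<^sub>R x' = (\<Sum>j<n. (u * c j + v * c' j) *\<^sub>R y j) + (u *\<^sub>R e + v *\<^sub>R e')"
      by (simp add: c(1) c'(1) scaleR_add_right scaleR_sum_right scaleR_add_left sum.distrib)
    then show "u *\<^sub>R x + v *\<^sub>R x' \<in> K" using KI[OF 1 2] by simp
  qed
  moreover have "ball 0 \<eta> \<subseteq> K" using KI[of "\<lambda>_. 0"] by auto
  moreover have "(1/3) *\<^sub>R d \<notin> K"
  proof
    assume "(1/3) *\<^sub>R d \<in> K"
    then obtain c e where "(1/3) *\<^sub>R d = (\<Sum>j<n. c j *\<^sub>R y j) + e" "(\<Sum>j<n. \<bar>c j\<bar> powr q) \<le> 1" "norm e \<le> \<eta>"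
      by (auto simp: K_def)
    then show False using not by (auto simp: q_def)
  qed
  ultimately obtain f :: "'b dual" where f: "\<And>x. x \<in> K \<Longrightarrow> blinfun_apply f x \<le> 1"
      "1 \<le> blinfun_apply f ((1/3) *\<^sub>R d)"
    using separate_from_convex[OF _ \<eta>] by metis
  define S where "S = (\<Sum>j<n. \<bar>blinfun_apply f (y j)\<bar> powr p)"
  have S1: "S \<le> 1"
  proof (cases "S = 0")
    case False
    then have S0: "0 < S" unfolding S_def using sum_nonneg[of "{..<n}" "\<lambda>j. \<bar>blinfun_apply f (y j)\<bar> powr p"]
      by (simp add: less_le)
    define c where "c j = sgn (blinfun_apply f (y j)) * \<bar>blinfun_apply f (y j)\<bar> powr (p - 1) / S powr (1 / q)" for j
    have "\<bar>c j\<bar> powr q = \<bar>blinfun_apply f (y j)\<bar> powr p / S" for j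
    proof (cases "blinfun_apply f (y j) = 0")
      case False
      then have "\<bar>c j\<bar> = \<bar>blinfun_apply f (y j)\<bar> powr (p - 1) / S powr (1 / q)"
        by (simp add: c_def abs_mult abs_sgn_eq)
      then show ?thesis using q S0 by (simp add: powr_divide powr_powr)
    qed (use p in \<open>simp add: c_def\<close>)
    then have "(\<Sum>j<n. \<bar>c j\<bar> powr q) = S / S" by (simp only: sum_divide_distrib[symmetric] S_def[symmetric])
    then have "(\<Sum>j<n. c j *\<^sub>R y j) + 0 \<in> K" using S0 \<eta> by (intro KI) auto
    then have "blinfun_apply f (\<Sum>j<n. c j *\<^sub>R y j) \<le> 1" using f(1) by fastforce
    moreover have "blinfun_apply f (\<Sum>j<n. c j *\<^sub>R y j) = S / S powr (1 / q)"
    proof -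
      have "c j * blinfun_apply f (y j) = \<bar>blinfun_apply f (y j)\<bar> powr p / S powr (1 / q)" for j
      proof (cases "blinfun_apply f (y j) = 0")
        case False
        have "c j * blinfun_apply f (y j)
            = (\<bar>blinfun_apply f (y j)\<bar> * \<bar>blinfun_apply f (y j)\<bar> powr (p - 1)) / S powr (1 / q)"
          by (simp add: c_def abs_sgn mult_ac)
        also have "\<bar>blinfun_apply f (y j)\<bar> * \<bar>blinfun_apply f (y j)\<bar> powr (p - 1) = \<bar>blinfun_apply f (y j)\<bar> powr p"
          using powr_mult_base[of "\<bar>blinfun_apply f (y j)\<bar>" "p - 1"] by simp
        finally show ?thesis .
      qed (use p in simp)
      then show ?thesis by (simp add: blinfun.sum_right blinfun.scaleR_right S_def sum_divide_distrib)
    qed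
    moreover have "S / S powr (1 / q) = S powr (1 / p)"
    proof -
      have "S powr (1 / p) * S powr (1 / q) = S powr 1" using q(3) by (simp add: powr_add[symmetric])
      then show ?thesis using S0 by (simp add: field_simps)
    qed
    ultimately have "S powr (1 / p) \<le> 1" by simp
    then show ?thesis using S0 p powr_mono2[of p "S powr (1 / p)" 1] by (simp add: powr_powr)
  qed simp
  have "norm (\<eta> *\<^sub>R f) \<le> 1"
  proof (rule norm_blinfun_bound)
    fix x
    show "norm (blinfun_apply (\<eta> *\<^sub>R f) x) \<le> 1 * norm x"
    proof (cases "x = 0")
      case False
      have "blinfun_apply f ((\<eta> / norm x) *\<^sub>R w) \<le> 1" if "norm w = norm x" for w
      proof -
        have "(\<Sum>j<n. 0 *\<^sub>R y j) + (\<eta> / norm x) *\<^sub>R w \<in> K" using that \<eta> False by (intro KI) auto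
        then show ?thesis using f(1) by fastforce
      qed
      from this[of x] this[of "- x"] show ?thesis using False \<eta>
        by (auto simp: blinfun.scaleR_right blinfun.scaleR_left blinfun.minus_right abs_le_iff field_simps)
    qed simp
  qed simp
  then have "\<bar>blinfun_apply (\<eta> *\<^sub>R f) d\<bar> powr p \<le> (\<Sum>j<n. \<bar>blinfun_apply (\<eta> *\<^sub>R f) (y j)\<bar> powr p) + \<eta> powr p"
    by (rule dom)
  moreover have "\<bar>blinfun_apply (\<eta> *\<^sub>R f) x\<bar> powr p = \<eta> powr p * \<bar>blinfun_apply f x\<bar> powr p" for x
    using \<eta> by (simp add: blinfun.scaleR_left abs_mult powr_mult)
  ultimately have "\<eta> powr p * \<bar>blinfun_apply f d\<bar> powr p \<le> \<eta> powr p * (S + 1)"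
    by (simp add: S_def sum_distrib_left[symmetric] distrib_left)
  then have "\<bar>blinfun_apply f d\<bar> powr p \<le> S + 1" using \<eta> by simp
  moreover have "3 \<le> blinfun_apply f d" using f(2) by (simp add: blinfun.scaleR_right)
  then have "3 powr 1 \<le> \<bar>blinfun_apply f d\<bar> powr p"
    using p powr_mono2[of p 3 "\<bar>blinfun_apply f d\<bar>"] powr_mono[of 1 p 3] by simp
  ultimately show False using S1 by simp
qed

lemma sum_lessThan_add:
  fixes h :: "nat \<Rightarrow> 'c::comm_monoid_add"
  shows "(\<Sum>j<n + m. h j) = (\<Sum>j<n. h j) + (\<Sum>i<m. h (n + i))"
  by (induction m) (simp_all add: add.assoc)

text \<open>The error vector of the preceding lemma lives in the finite-dimensional block, where small
  multiples of the atoms absorb it.\<close>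

lemma block_in_p_convex_hull:
  fixes D :: "'a::banach_lattice set"
  assumes p: "1 < p" and D: "p_summing_bound p \<epsilon> D" and \<epsilon>: "0 < \<epsilon>"
    and G: "finite G" "G \<subseteq> atoms" and DG: "\<And>d. d \<in> D \<Longrightarrow> proj G d = d" and M: "\<And>d. d \<in> D \<Longrightarrow> norm d \<le> M"
  shows "\<exists>n (z :: nat \<Rightarrow> 'a). (\<Sum>j<n. norm (z j) powr p) \<le> (2 * 24 powr p + 1) * \<epsilon> \<and>
    (\<forall>d\<in>D. \<exists>c. (\<Sum>j<n. \<bar>c j\<bar> powr conj_exp p) \<le> 1 \<and> d = (\<Sum>j<n. c j *\<^sub>R z j))"
proof -
  define q where "q = conj_exp p"
  have q: "1 \<le> q" using p by (simp add: q_def conj_exp_def field_simps)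
  define g where "g = card G"
  define r where "r = real g + 1"
  have r: "0 < r" "1 \<le> r" by (simp_all add: r_def)
  \<comment> \<open>so small that the multiples \<open>6 * r * \<eta>\<close> of the atoms in \<open>G\<close> have \<open>p\<close>-th powers of norms adding up
    to at most \<open>\<epsilon>\<close>\<close>
  define \<eta> where "\<eta> = (\<epsilon> / r) powr (1 / p) / (6 * r)"
  have \<eta>: "0 < \<eta>" using \<epsilon> r by (simp add: \<eta>_def)
  have \<eta>p: "(6 * r * \<eta>) powr p = \<epsilon> / r" using r \<epsilon> p by (simp add: \<eta>_def powr_powr)
  have "\<exists>n (y :: nat \<Rightarrow> 'a). (\<Sum>k<n. norm (y k) powr p) \<le> 4 powr p * (2 * \<epsilon>) \<and>
    (\<forall>f d. norm f \<le> 1 \<and> d \<in> D \<longrightarrow>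
      \<bar>blinfun_apply f d\<bar> powr p \<le> (\<Sum>k<n. \<bar>blinfun_apply f (y k)\<bar> powr p) + \<eta> powr p)"
    using \<eta> by (intro domination_on_block[OF less_imp_le[OF p] D \<epsilon> G DG M]) auto
  then obtain n and y :: "nat \<Rightarrow> 'a" where y1: "(\<Sum>k<n. norm (y k) powr p) \<le> 4 powr p * (2 * \<epsilon>)"
    and y2: "\<forall>f d. norm f \<le> 1 \<and> d \<in> D \<longrightarrow>
      \<bar>blinfun_apply f d\<bar> powr p \<le> (\<Sum>k<n. \<bar>blinfun_apply f (y k)\<bar> powr p) + \<eta> powr p"
    by blast
  obtain a where a: "bij_betw a {..<g} G"
    using ex_bij_betw_nat_finite[OF G(1)] by (auto simp: atLeast0LessThan g_def)
  have aG: "a i \<in> atoms" if "i < g" for i using a G that by (auto simp: bij_betw_def)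
  define z where "z j = (if j < n then 6 *\<^sub>R proj G (y j) else (6 * r * \<eta>) *\<^sub>R a (j - n))" for j
  have "(\<Sum>j<n + g. norm (z j) powr p) = (\<Sum>j<n. norm (z j) powr p) + (\<Sum>i<g. norm (z (n + i)) powr p)"
    by (rule sum_lessThan_add)
  also have "(\<Sum>j<n. norm (z j) powr p) \<le> (\<Sum>j<n. 6 powr p * norm (y j) powr p)"
    using norm_proj_le[OF G] p by (intro sum_mono) (simp add: z_def powr_mult powr_mono2)
  also have "\<dots> = 6 powr p * (\<Sum>j<n. norm (y j) powr p)" by (simp add: sum_distrib_left)
  also have "\<dots> \<le> 6 powr p * (4 powr p * (2 * \<epsilon>))" using y1 by (intro mult_left_mono) auto
  also have "\<dots> = 2 * 24 powr p * \<epsilon>" using powr_mult[of 6 4 p] by simp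
  also have "(\<Sum>i<g. norm (z (n + i)) powr p) = (\<Sum>i<g. \<epsilon> / r)"
    using r \<eta> \<eta>p atoms_norm[OF aG] by (intro sum.cong) (auto simp: z_def)
  also have "\<dots> \<le> \<epsilon>" using r \<epsilon> by (simp add: r_def field_simps)
  finally have "(\<Sum>j<n + g. norm (z j) powr p) \<le> (2 * 24 powr p + 1) * \<epsilon>" by (simp add: distrib_right)
  moreover have "\<exists>c. (\<Sum>j<n + g. \<bar>c j\<bar> powr q) \<le> 1 \<and> d = (\<Sum>j<n + g. c j *\<^sub>R z j)" if d: "d \<in> D" for d
  proof -
    obtain b where b: "(\<Sum>j<n. \<bar>b j\<bar> powr q) \<le> 1" "norm ((1/3) *\<^sub>R d - (\<Sum>j<n. b j *\<^sub>R y j)) \<le> \<eta>"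
      using p_convex_hull_of_domination[OF p \<eta> y2[rule_format]] d by (auto simp: q_def)
    define e where "e = (1/3) *\<^sub>R d - (\<Sum>j<n. b j *\<^sub>R y j)"
    \<comment> \<open>both parts contribute at most \<open>1 / 2\<close> to the sum of the powers\<close>
    define c where "c j = (if j < n then b j / 2 else coord (a (j - n)) e / (2 * r * \<eta>))" for j
    have "proj G d = 3 *\<^sub>R ((\<Sum>j<n. b j *\<^sub>R proj G (y j)) + proj G e)"
    proof -
      have "d = 3 *\<^sub>R ((\<Sum>j<n. b j *\<^sub>R y j) + e)" by (simp add: e_def)
      then have "proj G d = proj G (3 *\<^sub>R ((\<Sum>j<n. b j *\<^sub>R y j) + e))" by simp
      then show ?thesis
        using linear_proj[OF G(2)] by (simp add: linear_add linear_sum linear_scale)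
    qed
    moreover have "proj G e = (\<Sum>i<g. coord (a i) e *\<^sub>R a i)"
      unfolding proj_def by (rule sum.reindex_bij_betw[OF a, symmetric])
    ultimately have "d = (\<Sum>j<n. c j *\<^sub>R z j) + (\<Sum>i<g. c (n + i) *\<^sub>R z (n + i))"
      using DG[OF d] r \<eta> by (simp add: c_def z_def scaleR_add_right scaleR_sum_right)
    then have "d = (\<Sum>j<n + g. c j *\<^sub>R z j)" by (simp add: sum_lessThan_add)
    moreover have "(\<Sum>j<n + g. \<bar>c j\<bar> powr q) \<le> 1"
    proof -
      have "(\<Sum>j<n. \<bar>c j\<bar> powr q) = (\<Sum>j<n. (1/2) powr q * \<bar>b j\<bar> powr q)"
      proof (rule sum.cong)
        fix j assume "j \<in> {..<n}"
        then have "\<bar>c j\<bar> = (1/2) * \<bar>b j\<bar>" by (simp add: c_def)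
        then show "\<bar>c j\<bar> powr q = (1/2) powr q * \<bar>b j\<bar> powr q" by (simp only: powr_mult)
      qed simp
      also have "\<dots> = (1/2) powr q * (\<Sum>j<n. \<bar>b j\<bar> powr q)" by (simp add: sum_distrib_left)
      also have "\<dots> \<le> (1/2) powr 1 * 1" using b(1) q by (intro mult_mono powr_mono') (auto intro: sum_nonneg)
      finally have 1: "(\<Sum>j<n. \<bar>c j\<bar> powr q) \<le> 1 / 2" by simp
      have "(\<Sum>i<g. \<bar>c (n + i)\<bar> powr q) \<le> (\<Sum>i<g. 1 / (2 * r))"
      proof (rule sum_mono)
        fix i assume "i \<in> {..<g}"
        then have "\<bar>coord (a i) e\<bar> \<le> \<eta>"
          using abs_coord_le_norm[OF aG, of i e] b(2) by (simp add: e_def)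
        then have le: "\<bar>c (n + i)\<bar> \<le> 1 / (2 * r)" using r \<eta> by (simp add: c_def field_simps)
        also have "1 / (2 * r) \<le> 1" using r by simp
        finally have "\<bar>c (n + i)\<bar> powr q \<le> \<bar>c (n + i)\<bar> powr 1"
          using q powr_mono'[of 1 q "\<bar>c (n + i)\<bar>"] by simp
        then show "\<bar>c (n + i)\<bar> powr q \<le> 1 / (2 * r)" using le by simp
      qed
      also have "\<dots> \<le> 1 / 2" using r by (simp add: r_def field_simps)
      finally show ?thesis using 1 by (simp add: sum_lessThan_add)
    qed
    ultimately show ?thesis by blast
  qed
  ultimately show ?thesis unfolding q_def by blast
qed

section \<open>Relatively \<open>p\<close>-compact sets\<close>

lemma ell_unit_ball_iff:
  assumes "0 < q"
  shows "c \<in> ell_unit_ball q \<longleftrightarrow> summable (\<lambda>n. \<bar>c n\<bar> powr q) \<and> (\<Sum>n. \<bar>c n\<bar> powr q) \<le> 1"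
proof -
  have "s powr (1 / q) \<le> 1 \<longleftrightarrow> s \<le> 1" if "0 \<le> s" for s :: real
  proof
    assume "s powr (1 / q) \<le> 1"
    then have "(s powr (1 / q)) powr q \<le> 1" using assms by (intro powr_le1) auto
    then show "s \<le> 1" using assms that by (simp add: powr_powr)
  qed (use assms that in \<open>auto intro: powr_le1\<close>)
  then show ?thesis
    using suminf_nonneg[of "\<lambda>n. \<bar>c n\<bar> powr q"] by (auto simp: ell_unit_ball_def ell_def ell_norm_def)
qed

lemma conj_exp_gt_1: "1 < p \<Longrightarrow> 1 < conj_exp p"
  by (simp add: conj_exp_def field_simps)

text \<open>Young's inequality with parameter \<open>\<delta>\<close> makes the tails of the sums uniformly small:
  \<open>\<bar>c j\<bar> norm (x j) \<le> \<delta>\<^sup>q \<bar>c j\<bar>\<^sup>q + \<delta>\<^sup>-\<^sup>p norm (x j)\<^sup>p\<close>.\<close>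

lemma relatively_p_compact_imp_relatively_compact:
  fixes A :: "'b::banach set"
  assumes p: "1 < p" and A: "relatively_p_compact p A"
  shows "relatively_compact A"
proof (rule relatively_compactI)
  define q where "q = conj_exp p"
  have q: "1 < q" "1 / p + 1 / q = 1" using conj_exp_gt_1[OF p] conj_exp[OF p] by (simp_all add: q_def)
  obtain x :: "nat \<Rightarrow> 'b" where x: "(\<lambda>n. norm (x n)) \<in> ell p"
    and cover: "\<And>y. y \<in> A \<Longrightarrow> \<exists>c\<in>ell_unit_ball q. (\<lambda>j. c j *\<^sub>R x j) sums y"
    using A unfolding relatively_p_compact_def q_def by blast
  have sx: "summable (\<lambda>n. norm (x n) powr p)" using x by (simp add: ell_def)
  fix e :: real assume e: "0 < e"
  define \<delta> where "\<delta> = (e / 4) powr (1 / q)"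
  have \<delta>: "0 < \<delta>" "\<delta> powr q = e / 4" using e q by (simp_all add: \<delta>_def powr_powr)
  have "(\<lambda>N. \<Sum>n. norm (x (n + N)) powr p) \<longlonglongrightarrow> 0" using sx by (rule suminf_exist_split2)
  moreover have "0 < e / 4 * \<delta> powr p" using e \<delta> by simp
  ultimately have "\<forall>\<^sub>F N in sequentially. (\<Sum>n. norm (x (n + N)) powr p) < e / 4 * \<delta> powr p"
    by (rule order_tendstoD)
  then obtain N where N: "(\<Sum>n. norm (x (n + N)) powr p) < e / 4 * \<delta> powr p"
    by (auto simp: eventually_sequentially)
  define K where "K = {\<Sum>j\<in>{..<N}. t j *\<^sub>R x j | t. \<forall>j\<in>{..<N}. \<bar>t j\<bar> \<le> 1}"
  have "\<exists>z\<in>K. norm (y - z) < e" if y: "y \<in> A" for y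
  proof -
    obtain c where c: "c \<in> ell_unit_ball q" "(\<lambda>j. c j *\<^sub>R x j) sums y" using cover[OF y] by blast
    have sc: "summable (\<lambda>n. \<bar>c n\<bar> powr q)" "(\<Sum>n. \<bar>c n\<bar> powr q) \<le> 1"
      using c(1) q ell_unit_ball_iff[of q c] by auto
    have c1: "\<bar>c j\<bar> \<le> 1" for j
    proof -
      have "\<bar>c j\<bar> powr q \<le> 1"
        using sum_le_suminf[OF sc(1), of "{j}"] sc(2) by simp
      then have "(\<bar>c j\<bar> powr q) powr (1 / q) \<le> 1" using q by (intro powr_le1) auto
      then show ?thesis using q by (simp add: powr_powr)
    qed
    have sxN: "summable (\<lambda>n. norm (x (n + N)) powr p)"
      using sx by (subst summable_iff_shift[of "\<lambda>n. norm (x n) powr p"])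
    have scN: "summable (\<lambda>n. \<bar>c (n + N)\<bar> powr q)"
      using sc(1) by (subst summable_iff_shift[of "\<lambda>n. \<bar>c n\<bar> powr q"])
    define T where "T n = \<delta> powr q * \<bar>c (n + N)\<bar> powr q + \<delta> powr (- p) * norm (x (n + N)) powr p" for n
    have T: "summable T" unfolding T_def by (intro summable_add summable_mult sxN scN)
    have le: "norm (c (n + N) *\<^sub>R x (n + N)) \<le> T n" for n
    proof -
      have "norm (c (n + N) *\<^sub>R x (n + N)) = (\<delta> * \<bar>c (n + N)\<bar>) * (norm (x (n + N)) / \<delta>)" using \<delta> by simp
      also have "\<dots> \<le> (\<delta> * \<bar>c (n + N)\<bar>) powr q / q + (norm (x (n + N)) / \<delta>) powr p / p"
        using p q \<delta> by (intro Youngs_inequality) (auto simp: add.commute)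
      also have "\<dots> \<le> (\<delta> * \<bar>c (n + N)\<bar>) powr q + (norm (x (n + N)) / \<delta>) powr p"
        using p q by (intro add_mono) (simp_all add: divide_le_eq mult_le_cancel_left1)
      also have "\<dots> = T n" using \<delta>(1) by (simp add: T_def powr_mult powr_divide powr_minus field_simps)
      finally show ?thesis .
    qed
    define z where "z = (\<Sum>j\<in>{..<N}. c j *\<^sub>R x j)"
    have "y - z = (\<Sum>n. c (n + N) *\<^sub>R x (n + N))"
      using suminf_split_initial_segment[of "\<lambda>j. c j *\<^sub>R x j" N] c(2) by (simp add: sums_iff z_def)
    then have "norm (y - z) \<le> suminf T" using norm_suminf_le[OF le T] by simp
    also have "suminf T = \<delta> powr q * (\<Sum>n. \<bar>c (n + N)\<bar> powr q) + \<delta> powr (- p) * (\<Sum>n. norm (x (n + N)) powr p)"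
      unfolding T_def using scN sxN by (simp add: suminf_add[symmetric] suminf_mult summable_mult)
    also have "\<dots> \<le> \<delta> powr q * 1 + \<delta> powr (- p) * (e / 4 * \<delta> powr p)"
    proof (intro add_mono mult_left_mono)
      have "(\<Sum>n. \<bar>c (n + N)\<bar> powr q) \<le> (\<Sum>n. \<bar>c n\<bar> powr q)"
        using suminf_split_initial_segment[OF sc(1), of N] sum_nonneg[of "{..<N}" "\<lambda>n. \<bar>c n\<bar> powr q"] by simp
      then show "(\<Sum>n. \<bar>c (n + N)\<bar> powr q) \<le> 1" using sc(2) by simp
    qed (use N in auto)
    also have "\<dots> = e / 4 + e / 4" using \<delta> by (simp add: powr_minus)
    finally have "norm (y - z) < e" using e by simp
    moreover have "z \<in> K" using c1 by (auto simp: K_def z_def)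
    ultimately show ?thesis by blast
  qed
  moreover have "compact K" unfolding K_def by (rule compact_box) simp
  ultimately show "\<exists>K. compact K \<and> (\<forall>x\<in>A. \<exists>y\<in>K. norm (x - y) < e)" by blast
qed

text \<open>Finite \<open>p\<close>-convex hulls with summable sizes are merged by enlarging the vectors of the \<open>k\<close>-th
  one by \<open>2\<^sup>k\<^sup>+\<^sup>1\<close> and shrinking the coefficients accordingly; all sums involved converge absolutely by
  Young's inequality, so the order of summation is irrelevant.\<close>

lemma relatively_p_compact_of_blocks:
  fixes A :: "'b::banach set" and B :: "nat \<Rightarrow> 'b \<Rightarrow> 'b" and z :: "nat \<Rightarrow> nat \<Rightarrow> 'b"
  assumes p: "1 < p" and bdd: "bounded A"
    and sums: "\<And>x. x \<in> A \<Longrightarrow> (\<lambda>k. B k x) sums x"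
    and z: "\<And>k. (\<Sum>j<n k. norm (z k j) powr p) \<le> C k"
    and hull: "\<And>k x. x \<in> A \<Longrightarrow>
      \<exists>c. (\<Sum>j<n k. \<bar>c j\<bar> powr conj_exp p) \<le> 1 \<and> B k x = (\<Sum>j<n k. c j *\<^sub>R z k j)"
    and C: "summable (\<lambda>k. (2 ^ Suc k) powr p * C k)"
  shows "relatively_p_compact p A"
proof -
  define q where "q = conj_exp p"
  have q: "1 < q" "1 / p + 1 / q = 1" using conj_exp_gt_1[OF p] conj_exp[OF p] by (simp_all add: q_def)
  define Z where "Z = (\<lambda>(k, j). if j < n k then 2 ^ Suc k *\<^sub>R z k j else 0)"
  have row: "(\<Sum>j<M. norm (Z (k, j)) powr p) \<le> (2 ^ Suc k) powr p * C k" for k M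
  proof -
    have "(\<Sum>j<M. norm (Z (k, j)) powr p) \<le> (\<Sum>j<max M (n k). norm (Z (k, j)) powr p)"
      by (intro sum_mono2) auto
    also have "\<dots> = (\<Sum>j<n k. (2 ^ Suc k) powr p * norm (z k j) powr p)"
      using p by (intro sum.mono_neutral_cong_right) (auto simp: Z_def powr_mult)
    also have "\<dots> \<le> (2 ^ Suc k) powr p * C k"
      unfolding sum_distrib_left[symmetric] using z by (intro mult_left_mono) auto
    finally show ?thesis .
  qed
  have C0: "0 \<le> (2 ^ Suc k) powr p * C k" for k using row[where M = 0 and k = k] by simp
  have sZ: "summable (\<lambda>m. norm (Z (prod_decode m)) powr p)"
  proof (rule summableI_nonneg_bounded)
    fix M
    have "(\<Sum>m<M. norm (Z (prod_decode m)) powr p) \<le> (\<Sum>k<M. \<Sum>j<M. norm (Z (k, j)) powr p)"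
      using sum_prod_decode_le[of "\<lambda>i. norm (Z i) powr p" M] by simp
    also have "\<dots> \<le> (\<Sum>k<M. (2 ^ Suc k) powr p * C k)" by (intro sum_mono row)
    also have "\<dots> \<le> (\<Sum>k. (2 ^ Suc k) powr p * C k)" by (intro sum_le_suminf C) (use C0 in auto)
    finally show "(\<Sum>m<M. norm (Z (prod_decode m)) powr p) \<le> (\<Sum>k. (2 ^ Suc k) powr p * C k)" .
  qed simp
  have "\<exists>c\<in>ell_unit_ball q. (\<lambda>m. c m *\<^sub>R Z (prod_decode m)) sums x" if x: "x \<in> A" for x
  proof -
    obtain c where c: "\<And>k. (\<Sum>j<n k. \<bar>c k j\<bar> powr q) \<le> 1" "\<And>k. B k x = (\<Sum>j<n k. c k j *\<^sub>R z k j)"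
      using hull[OF x] unfolding q_def by metis
    define \<gamma> where "\<gamma> = (\<lambda>(k, j). if j < n k then (1/2) ^ Suc k * c k j else 0)"
    have \<gamma>0: "\<gamma> (k, j) = 0" if "\<not> j < n k" for k j using that by (simp add: \<gamma>_def)
    have \<gamma>q: "\<bar>\<gamma> (k, j)\<bar> powr q = ((1/2) ^ Suc k) powr q * \<bar>c k j\<bar> powr q" if "j < n k" for k j
    proof -
      have "\<bar>\<gamma> (k, j)\<bar> = (1/2) ^ Suc k * \<bar>c k j\<bar>" using that by (simp add: \<gamma>_def abs_mult)
      then show ?thesis by (simp only: powr_mult)
    qed
    have \<gamma>row: "(\<Sum>j<M. \<bar>\<gamma> (k, j)\<bar> powr q) \<le> (1/2) ^ Suc k" for k M
    proof -
      have "(\<Sum>j<M. \<bar>\<gamma> (k, j)\<bar> powr q) \<le> (\<Sum>j<max M (n k). \<bar>\<gamma> (k, j)\<bar> powr q)"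
        by (intro sum_mono2) auto
      also have "\<dots> = (\<Sum>j<n k. ((1/2) ^ Suc k) powr q * \<bar>c k j\<bar> powr q)"
        using q by (intro sum.mono_neutral_cong_right) (auto simp: \<gamma>0 \<gamma>q simp del: power_Suc)
      also have "\<dots> \<le> ((1/2) ^ Suc k) powr q * 1"
        unfolding sum_distrib_left[symmetric] using c(1) by (intro mult_left_mono) auto
      also have "\<dots> \<le> (1/2) ^ Suc k"
        using q powr_mono'[of 1 q "(1/2) ^ Suc k"] power_le_one[of "1/2::real" "Suc k"] by simp
      finally show ?thesis .
    qed
    have \<gamma>sum: "(\<Sum>m<M. \<bar>\<gamma> (prod_decode m)\<bar> powr q) \<le> 1" for M
    proof -
      have "(\<Sum>m<M. \<bar>\<gamma> (prod_decode m)\<bar> powr q) \<le> (\<Sum>k<M. \<Sum>j<M. \<bar>\<gamma> (k, j)\<bar> powr q)"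
        using sum_prod_decode_le[of "\<lambda>i. \<bar>\<gamma> i\<bar> powr q" M] by simp
      also have "\<dots> \<le> (\<Sum>k<M. (1/2) ^ Suc k)" by (intro sum_mono \<gamma>row)
      also have "\<dots> \<le> (\<Sum>k. (1/2) ^ Suc k)"
        by (intro sum_le_suminf) (auto intro!: summable_mult summable_geometric)
      also have "\<dots> = 1" using power_half_series by (rule sums_unique[symmetric])
      finally show ?thesis .
    qed
    have s\<gamma>: "summable (\<lambda>m. \<bar>\<gamma> (prod_decode m)\<bar> powr q)"
      using \<gamma>sum by (intro summableI_nonneg_bounded) auto
    have "(\<lambda>m. \<gamma> (prod_decode m)) \<in> ell_unit_ball q"
      using q s\<gamma> \<gamma>sum by (auto simp: ell_unit_ball_iff intro: suminf_le_const)
    moreover have "(\<lambda>m. \<gamma> (prod_decode m) *\<^sub>R Z (prod_decode m)) sums x"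
    proof -
      define h where "h i = \<gamma> i *\<^sub>R Z i" for i
      have sn: "summable (\<lambda>m. norm (h (prod_decode m)))"
      proof (rule summable_comparison_test')
        show "summable (\<lambda>m. norm (Z (prod_decode m)) powr p / p + \<bar>\<gamma> (prod_decode m)\<bar> powr q / q)"
          by (intro summable_add summable_divide sZ s\<gamma>)
        fix m :: nat
        have "norm (Z (prod_decode m)) * \<bar>\<gamma> (prod_decode m)\<bar>
            \<le> norm (Z (prod_decode m)) powr p / p + \<bar>\<gamma> (prod_decode m)\<bar> powr q / q"
          using p q by (intro Youngs_inequality) auto
        then show "norm (norm (h (prod_decode m)))
            \<le> norm (Z (prod_decode m)) powr p / p + \<bar>\<gamma> (prod_decode m)\<bar> powr q / q"
          by (simp add: h_def mult.commute)
      qed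
      define s where "s = (\<Sum>m. h (prod_decode m))"
      have s: "((\<lambda>m. h (prod_decode m)) has_sum s) UNIV"
        unfolding s_def
        by (rule norm_summable_imp_has_sum[OF sn summable_sums[OF summable_norm_cancel[OF sn]]])
      have "(h has_sum s) (UNIV \<times> UNIV)"
        using s has_sum_reindex_bij_betw[OF bij_prod_decode, of h s] by simp
      moreover have "((\<lambda>j. h (k, j)) has_sum B k x) UNIV" for k
      proof -
        have "((\<lambda>j. h (k, j)) has_sum (\<Sum>j<n k. h (k, j))) UNIV"
          by (rule has_sum_finite_neutralI[of "{..<n k}"]) (auto simp: h_def \<gamma>0)
        moreover have "(\<Sum>j<n k. h (k, j)) = B k x"
          unfolding c(2) by (intro sum.cong) (auto simp: h_def \<gamma>_def Z_def power_one_over)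
        ultimately show ?thesis by simp
      qed
      ultimately have "((\<lambda>k. B k x) has_sum s) UNIV" by (rule has_sum_SigmaD)
      then have "(\<lambda>k. B k x) sums s" by (rule has_sum_imp_sums)
      then have "s = x" using sums[OF x] by (rule sums_unique2)
      then show ?thesis using has_sum_imp_sums[OF s] by (simp add: h_def)
    qed
    ultimately show ?thesis by (intro bexI[of _ "\<lambda>m. \<gamma> (prod_decode m)"])
  qed
  then show ?thesis
    using bdd sZ unfolding relatively_p_compact_def q_def
    by (intro conjI exI[of _ "\<lambda>m. Z (prod_decode m)"]) (auto simp: ell_def)
qed

lemma p_summing_bound_tail_antimono:
  fixes A :: "'a::banach_lattice set"
  assumes p: "0 \<le> p" and H: "finite H" "H \<subseteq> atoms" and F: "F \<subseteq> H"
    and b: "p_summing_bound p \<epsilon> ((\<lambda>x. x - proj F x) ` A)"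
  shows "p_summing_bound p \<epsilon> ((\<lambda>x. x - proj H x) ` A)"
proof -
  have FF: "finite F" "F \<subseteq> atoms" "F \<inter> H = F" using F H finite_subset by auto
  have "p_summing_bound p \<epsilon> ((\<lambda>x. x - proj H x) ` (\<lambda>x. x - proj F x) ` A)"
    by (rule p_summing_bound_contraction[OF _ norm_remainder_le[OF H] p b])
      (intro bounded_linear_sub bounded_linear_ident bounded_linear_proj H)
  moreover have "(x - proj F x) - proj H (x - proj F x) = x - proj H x" for x
    using linear_diff[OF linear_proj[OF H(2)]] proj_proj[OF FF(1,2) H, of x] FF(3) by simp
  ultimately show ?thesis by (simp add: image_image)
qed

text \<open>Cut \<open>A\<close> along finite sets of atoms whose tails have \<open>p\<close>-summing norm at most \<open>4\<^sup>-\<^sup>k\<close>. Each block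
  then lies in a finite \<open>p\<close>-convex hull of comparable size, however large its dimension is.\<close>

theorem p_limited_imp_relatively_p_compact:
  fixes A :: "'a::banach_lattice set"
  assumes oc: "disjoint_null TYPE('a)" and disc: "discrete_lattice TYPE('a)"
    and gr: "grothendieck TYPE('a)" and p: "1 < p" and A: "p_limited p A"
  shows "relatively_p_compact p A"
proof -
  have ap: "almost_p_limited p A" using A by (simp add: p_limited_def almost_p_limited_def)
  have p1: "1 \<le> p" using p by simp
  note approx = almost_p_limited_imp_relatively_compact(2)[OF oc disc gr p1 ap]
  have "bounded A"
    using almost_p_limited_imp_relatively_compact(1)[OF oc disc gr p1 ap] closure_subset
    unfolding relatively_compact_def by (metis bounded_subset compact_imp_bounded)
  then obtain M where M: "\<And>x. x \<in> A \<Longrightarrow> norm x \<le> M" by (auto simp: bounded_iff)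
  define \<epsilon> where "\<epsilon> k = ((1/4) ^ k) powr p" for k :: nat
  have \<epsilon>: "0 < \<epsilon> k" for k by (simp add: \<epsilon>_def)
  have "\<exists>F. finite F \<and> F \<subseteq> atoms \<and> p_summing_bound p (\<epsilon> k) ((\<lambda>x. x - proj F x) ` A)" for k
    by (rule p_limited_small_tail[OF oc gr p1 A approx \<epsilon>])
  then obtain F1 where F1: "\<And>k. finite (F1 k) \<and> F1 k \<subseteq> atoms \<and>
      p_summing_bound p (\<epsilon> k) ((\<lambda>x. x - proj (F1 k) x) ` A)" by metis
  have "\<exists>F. finite F \<and> F \<subseteq> atoms \<and> (\<forall>x\<in>A. norm (x - proj F x) < inverse (real (Suc k)))" for k
    by (rule approx) simp
  then obtain F2 where F2: "\<And>k. finite (F2 k) \<and> F2 k \<subseteq> atoms \<and>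
      (\<forall>x\<in>A. norm (x - proj (F2 k) x) < inverse (real (Suc k)))" by metis
  define H where "H k = (\<Union>i\<le>k. F1 i \<union> F2 i)" for k
  have H: "finite (H k)" "H k \<subseteq> atoms" "F1 k \<subseteq> H k" "F2 k \<subseteq> H k" "H k \<subseteq> H (Suc k)" for k
    using F1 F2 by (auto simp: H_def le_Suc_eq)
  have tail: "p_summing_bound p (\<epsilon> k) ((\<lambda>x. x - proj (H k) x) ` A)" for k
    using p_summing_bound_tail_antimono[OF _ H(1,2,3)] F1 p1 by simp
  define B where "B k = (case k of 0 \<Rightarrow> proj (H 0) | Suc i \<Rightarrow> proj (H (Suc i) - H i))" for k
  have Bsum: "(\<Sum>k<Suc m. B k x) = proj (H m) x" for m x
  proof (induction m)
    case (Suc m)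
    have "(\<Sum>k<Suc (Suc m). B k x) = (\<Sum>k<Suc m. B k x) + B (Suc m) x" by (rule sum.lessThan_Suc)
    also have "B (Suc m) x = proj (H (Suc m)) x - proj (H m) x"
      using proj_diff_subset[OF H(1,5), of m x] by (simp add: B_def)
    finally show ?case using Suc by simp
  qed (simp add: B_def)
  have sums: "(\<lambda>k. B k x) sums x" if x: "x \<in> A" for x
  proof -
    have le: "norm (proj (H m) x - x) \<le> inverse (real (Suc m))" for m
    proof -
      have "norm (x - proj (H m) x) \<le> norm (x - proj (F2 m) x)" by (rule norm_remainder_antimono[OF H(1,2,4)])
      also have "\<dots> \<le> inverse (real (Suc m))" using F2[of m] x by (meson less_imp_le)
      finally show ?thesis by (simp add: norm_minus_commute)
    qed
    have "(\<lambda>m. proj (H m) x - x) \<longlonglongrightarrow> 0"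
      by (rule Lim_null_comparison[OF always_eventually LIMSEQ_inverse_real_of_nat]) (use le in blast)
    then have "(\<lambda>m. \<Sum>k<Suc m. B k x) \<longlonglongrightarrow> x" unfolding Bsum by (simp add: Lim_null[of _ x])
    then show ?thesis unfolding sums_def by (rule LIMSEQ_imp_Suc)
  qed
  define K where "K = 2 * 24 powr p + 1"
  define block where "block k n z C \<longleftrightarrow> (\<Sum>j<n. norm (z j) powr p) \<le> C \<and>
      (\<forall>x\<in>A. \<exists>c. (\<Sum>j<n. \<bar>c j\<bar> powr conj_exp p) \<le> 1 \<and> B k x = (\<Sum>j<n. c j *\<^sub>R z j))"
    for k n C and z :: "nat \<Rightarrow> 'a"
  have later: "\<exists>n z. block (Suc k) n z (K * \<epsilon> k)" for k
  proof -
    define G where "G = H (Suc k) - H k"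
    have G: "finite G" "G \<subseteq> atoms" using H(1,2)[of "Suc k"] by (auto simp: G_def)
    define D where "D = proj G ` (\<lambda>x. x - proj (H k) x) ` A"
    have "p_summing_bound p (\<epsilon> k) D"
      unfolding D_def using p
      by (intro p_summing_bound_contraction bounded_linear_proj norm_proj_le G tail) auto
    moreover have "proj G d = d" if "d \<in> D" for d
      using that proj_proj[OF G G] by (auto simp: D_def)
    moreover have "norm d \<le> M" if "d \<in> D" for d
    proof -
      obtain x where x: "x \<in> A" "d = proj G (x - proj (H k) x)" using \<open>d \<in> D\<close> by (auto simp: D_def)
      have "norm d \<le> norm x"
        unfolding x(2) by (rule order_trans[OF norm_proj_le[OF G] norm_remainder_le[OF H(1,2)]])
      then show ?thesis using M[OF x(1)] by simp
    qed
    ultimately have "\<exists>n (z :: nat \<Rightarrow> 'a). (\<Sum>j<n. norm (z j) powr p) \<le> K * \<epsilon> k \<and>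
      (\<forall>d\<in>D. \<exists>c. (\<Sum>j<n. \<bar>c j\<bar> powr conj_exp p) \<le> 1 \<and> d = (\<Sum>j<n. c j *\<^sub>R z j))"
      unfolding K_def by (rule block_in_p_convex_hull[OF p _ \<epsilon> G])
    then obtain n and z :: "nat \<Rightarrow> 'a" where nz: "(\<Sum>j<n. norm (z j) powr p) \<le> K * \<epsilon> k"
      "\<forall>d\<in>D. \<exists>c. (\<Sum>j<n. \<bar>c j\<bar> powr conj_exp p) \<le> 1 \<and> d = (\<Sum>j<n. c j *\<^sub>R z j)" by blast
    have "B (Suc k) x \<in> D" if x: "x \<in> A" for x
    proof -
      have "H k \<inter> G = {}" by (auto simp: G_def)
      then have "proj G (x - proj (H k) x) = B (Suc k) x"
        using linear_diff[OF linear_proj[OF G(2)]] proj_proj[OF H(1,2) G, of k x]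
        by (simp add: B_def G_def proj_def[of "{}"])
      then show ?thesis using x unfolding D_def by (metis imageI)
    qed
    then show ?thesis using nz unfolding block_def by blast
  qed
  have "\<exists>n z C. block 0 n z C"
  proof -
    define g where "g = card (H 0)"
    obtain a where a: "bij_betw a {..<g} (H 0)"
      using ex_bij_betw_nat_finite[OF H(1)] by (auto simp: atLeast0LessThan g_def)
    have aH: "a j \<in> atoms" if "j < g" for j using a H(2) that by (auto simp: bij_betw_def)
    define r where "r = (\<bar>M\<bar> + 1) * (real g + 1)"
    have r: "0 < r" by (simp add: r_def)
    have "\<exists>c. (\<Sum>j<g. \<bar>c j\<bar> powr conj_exp p) \<le> 1 \<and> B 0 x = (\<Sum>j<g. c j *\<^sub>R (r *\<^sub>R a j))" if x: "x \<in> A" for x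
    proof (intro exI conjI)
      have "(\<Sum>j<g. \<bar>coord (a j) x / r\<bar> powr conj_exp p) \<le> (\<Sum>j<g. 1 / (real g + 1))"
      proof (rule sum_mono)
        fix j assume "j \<in> {..<g}"
        then have "\<bar>coord (a j) x\<bar> \<le> norm x" by (intro abs_coord_le_norm aH) simp
        then have "\<bar>coord (a j) x / r\<bar> \<le> (\<bar>M\<bar> + 1) / r" using M[OF x] r by (simp add: divide_right_mono)
        also have "(\<bar>M\<bar> + 1) / r = 1 / (real g + 1)" by (simp add: r_def)
        finally have le: "\<bar>coord (a j) x / r\<bar> \<le> 1 / (real g + 1)" .
        also have "1 / (real g + 1) \<le> 1" by simp
        finally have "\<bar>coord (a j) x / r\<bar> powr conj_exp p \<le> \<bar>coord (a j) x / r\<bar> powr 1"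
          using conj_exp_gt_1[OF p] by (intro powr_mono') auto
        then show "\<bar>coord (a j) x / r\<bar> powr conj_exp p \<le> 1 / (real g + 1)" using le by simp
      qed
      also have "\<dots> \<le> 1" by (simp add: field_simps)
      finally show "(\<Sum>j<g. \<bar>coord (a j) x / r\<bar> powr conj_exp p) \<le> 1" .
      have "B 0 x = (\<Sum>j<g. coord (a j) x *\<^sub>R a j)"
        unfolding B_def proj_def using sum.reindex_bij_betw[OF a, symmetric] by simp
      then show "B 0 x = (\<Sum>j<g. (coord (a j) x / r) *\<^sub>R (r *\<^sub>R a j))" using r by simp
    qed
    then have "block 0 g (\<lambda>j. r *\<^sub>R a j) (\<Sum>j<g. norm (r *\<^sub>R a j) powr p)" by (simp add: block_def)
    then show ?thesis by blast
  qed
  then obtain n0 z0 C0 where b0: "block 0 n0 z0 C0" by blast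
  obtain n1 z1 where b1: "\<And>k. block (Suc k) (n1 k) (z1 k) (K * \<epsilon> k)" using later by metis
  define n where "n = case_nat n0 n1"
  define z where "z = case_nat z0 z1"
  define C where "C = case_nat C0 (\<lambda>k. K * \<epsilon> k)"
  have blk: "block k (n k) (z k) (C k)" for k
    using b0 b1 by (cases k) (simp_all add: n_def z_def C_def)
  have "summable (\<lambda>k. (2 ^ Suc (Suc k)) powr p * (K * \<epsilon> k))"
  proof -
    have eq: "(2 ^ Suc (Suc k)) powr p * (K * \<epsilon> k) = K * 4 powr p * ((1/2) powr p) ^ k" for k
    proof -
      have "(2 ^ Suc (Suc k)) powr p * \<epsilon> k = (2 ^ Suc (Suc k) * (1/4) ^ k) powr p"
        by (simp add: \<epsilon>_def powr_mult)
      also have "(2::real) ^ Suc (Suc k) * (1/4) ^ k = 4 * (1/2) ^ k"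
        by (simp add: power_mult_distrib[symmetric])
      also have "(4 * (1/2::real) ^ k) powr p = 4 powr p * ((1/2) powr p) ^ k"
        by (simp add: powr_mult powr_realpow[symmetric] powr_powr mult.commute)
      finally show ?thesis by (simp add: mult.left_commute)
    qed
    have "(1/2::real) powr p < 1" using p powr_less_mono'[of "1/2" 0 p] by simp
    then show ?thesis unfolding eq by (intro summable_mult summable_geometric) simp
  qed
  then have "summable (\<lambda>k. (2 ^ Suc k) powr p * C k)"
    by (subst summable_Suc_iff[symmetric]) (simp add: C_def)
  then show ?thesis
    using blk unfolding block_def
    by (intro relatively_p_compact_of_blocks[OF p \<open>bounded A\<close> sums, where n = n and z = z and C = C]) auto
qed

section \<open>The equivalences\<close>

lemma limited_imp_almost_limited: "limited A \<Longrightarrow> almost_limited A"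
  by (simp add: limited_def almost_limited_def)

lemma p_limited_imp_almost_p_limited: "p_limited p A \<Longrightarrow> almost_p_limited p A"
  by (simp add: p_limited_def almost_p_limited_def)

theorem corollary3p9:
  fixes p :: real
  assumes "2 \<le> p"
    and "discrete_lattice TYPE('a::banach_lattice)"
    and "grothendieck TYPE('a)"
  shows "(strong_p_GP_property p TYPE('a) \<longleftrightarrow> strong_GP_property TYPE('a)) \<and>
         (strong_GP_property TYPE('a) \<longleftrightarrow> weak_p_GP_property p TYPE('a)) \<and>
         (weak_p_GP_property p TYPE('a) \<longleftrightarrow> p_GP_property p TYPE('a)) \<and>
         (p_GP_property p TYPE('a) \<longleftrightarrow> GP_property TYPE('a))"
proof -
  let ?oc = "disjoint_null TYPE('a)"
  have p: "1 \<le> p" "1 < p" using assms(1) by auto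
  have "strong_p_GP_property p TYPE('a) \<and> strong_GP_property TYPE('a) \<and> p_GP_property p TYPE('a)" if oc: ?oc
    unfolding strong_p_GP_property_def strong_GP_property_def p_GP_property_def
    using almost_p_limited_imp_relatively_compact(1)[OF oc assms(2,3) p(1)]
      almost_limited_imp_relatively_compact[OF oc assms(2)]
      p_limited_imp_relatively_p_compact[OF oc assms(2,3) p(2)]
    by simp
  moreover have "weak_p_GP_property p TYPE('a)" if "p_GP_property p TYPE('a)"
    using that relatively_p_compact_imp_relatively_compact[OF p(2), where 'b = 'a]
    by (simp add: weak_p_GP_property_def p_GP_property_def)
  moreover have "weak_p_GP_property p TYPE('a)" if "strong_p_GP_property p TYPE('a)"
    using that p_limited_imp_almost_p_limited[of p, where 'a = 'a]
    by (simp add: weak_p_GP_property_def strong_p_GP_property_def)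
  moreover have "GP_property TYPE('a)" if "strong_GP_property TYPE('a)"
    using that limited_imp_almost_limited[where 'a = 'a]
    by (simp add: GP_property_def strong_GP_property_def)
  moreover have "?oc" if "weak_p_GP_property p TYPE('a)"
    by (rule weak_p_GP_imp_disjoint_null[OF assms(1) that])
  moreover have "?oc" if "GP_property TYPE('a)"
    by (rule GP_imp_disjoint_null[OF assms(3) that])
  ultimately show ?thesis by blast
qed

end
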